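(* Let $A$, $\mathcal H$, $\mathcal H_+$, $\mathrm T=[\Gamma_0,\Gamma_1]^\top$, $J$, $Q_t$, $\mathcal A_t$, $R_t(\zeta)$ and $t_0\in[0,1]$ be as in the context, and let $\lambda$ be an isolated eigenvalue of $\mathcal A_{t_0}$ of finite multiplicity $m\in\mathbb N$. For $t$ near $t_0$ let $P_t$ be the Riesz projection of $\mathcal A_t$ for the $\lambda$-group and let $S_{t_0}$ be the reduced resolvent of $\mathcal A_{t_0}$ at $\lambda$ (both defined in the context). Then, as $t\to t_0$, $$P_t=P_{t_0}+\dot P_{t_0}(t-t_0)+\tfrac12\ddot P_{t_0}(t-t_0)^2+o((t-t_0)^2)\quad\text{in }\mathcal B(\mathcal H),$$ with $$\dot P_{t_0}:=(\mathrm TS_{t_0})^*\dot Q_{t_0}J\mathrm TP_{t_0}+(\mathrm TP_{t_0})^*\dot Q_{t_0}J\mathrm TS_{t_0}$$ and $$\begin{aligned}\ddot P_{t_0}:=\ &(\mathrm TS_{t_0})^*\ddot Q_{t_0}J\mathrm TP_{t_0}+(\mathrm TP_{t_0})^*\ddot Q_{t_0}J\mathrm TS_{t_0}\\ &+2\big(\mathrm T(\mathrm TS_{t_0})^*\dot Q_{t_0}J\mathrm TS_{t_0}\big)^*\dot Q_{t_0}J\mathrm TP_{t_0}+2\big(\mathrm T(\mathrm TS_{t_0})^*\dot Q_{t_0}J\mathrm TP_{t_0}\big)^*\dot Q_{t_0}J\mathrm TS_{t_0}\\ &+2\big(\mathrm T(\mathrm TP_{t_0})^*\dot Q_{t_0}J\mathrm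 TS_{t_0}\big)^*\dot Q_{t_0}J\mathrm TS_{t_0}-2\big(\mathrm T(\mathrm TS_{t_0}^2)^*\dot Q_{t_0}J\mathrm TP_{t_0}\big)^*\dot Q_{t_0}J\mathrm TP_{t_0}\\ &-2\big(\mathrm T(\mathrm TP_{t_0})^*\dot Q_{t_0}J\mathrm TS_{t_0}^2\big)^*\dot Q_{t_0}J\mathrm TP_{t_0}-2\big(\mathrm T(\mathrm TP_{t_0})^*\dot Q_{t_0}J\mathrm TP_{t_0}\big)^*\dot Q_{t_0}J\mathrm TS_{t_0}^2.\end{aligned}$$
   Context: Inner products are linear in the first argument. $\mathcal H$, $\mathfrak H$ are complex Hilbert spaces. $A$ is a densely defined symmetric operator in $\mathcal H$ with equal (possibly infinite) deficiency indices. $\mathcal H_+:=\operatorname{dom}(A^* )$ is equipped with the graph scalar product $\langle u,v\rangle_{\mathcal H_+}=\langle u,v\rangle_{\mathcal H}+\langle A^*u,A^*v\rangle_{\mathcal H}$. Boundary triplet: $\mathrm T:=[\Gamma_0,\Gamma_1]^\top\in\mathcal B(\mathcal H_+,\mathfrak H\times\mathfrak H)$ is bounded, surjective, and satisfies $\langle A^*u,v\rangle_{\mathcal H}-\langle u,A^*v\rangle_{\mathcal H}=\langle\Gamma_1u,\Gamma_0v\rangle_{\mathfrak H}-\langle\Gamma_0u,\Gamma_1v\rangle_{\mathfrak H}$ for all $u,v\in\mathcal H_+$. Symplectic form on $\mathfrak H\times\mathfrak H$: $\omega((f_1,f_2)^\top,(g_1,g_2)^\top)=\langle f_2,g_1\rangle_{\mathfrak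 H}-\langle f_1,g_2\rangle_{\mathfrak H}=\langle J(f_1,f_2)^\top,(g_1,g_2)^\top\rangle_{\mathfrak H\times\mathfrak H}$, with $J=\begin{bmatrix}0&I_{\mathfrak H}\\-I_{\mathfrak H}&0\end{bmatrix}$. A subspace $\mathcal F\subset\mathfrak H\times\mathfrak H$ is Lagrangian if it equals its $\omega$-annihilator $\{f:\omega(f,g)=0\ \forall g\in\mathcal F\}$. For every Lagrangian $\mathcal F$, the restriction of $A^*$ to $\mathrm T^{-1}(\mathcal F)$ is a self-adjoint extension of $A$, and all self-adjoint extensions arise this way. Family: for $t\in[0,1]$, $Q_t\in\mathcal B(\mathfrak H\times\mathfrak H)$ is an orthogonal projection whose range is Lagrangian; $t_0\in[0,1]$ is fixed and, as $t\to t_0$ (in $[0,1]$), $Q_t=Q_{t_0}+\dot Q_{t_0}(t-t_0)+\frac12\ddot Q_{t_0}(t-t_0)^2+o((t-t_0)^2)$ in $\mathcal B(\mathfrak H\times\mathfrak H)$ with $\dot Q_{t_0},\ddot Q_{t_0}\in\mathcal B(\mathfrak H\times\mathfrak H)$. $\mathcal A_t$ is the self-adjoint extension of $A$ with $\mathrm T(\operatorname{dom}(\mathcal A_t))=\operatorname{ran}(Q_t)$, and $R_t(\zeta):=(\mathcal A_t-\zeta)^{-1}$ for $\zeta\notin\operatorname{Spec}(\mathcal A_t)$. Spectral objects: $\gamma:=\{z\in\mathbb C:2|z-\lambda|=\operatorname{dist}(\lambda,\operatorname{Spec}(\mathcal A_{t_0})\setminus\{\lambda\})\}$, oriented counterclockwise.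 For $t$ sufficiently close to $t_0$, $\gamma\cap\operatorname{Spec}(\mathcal A_t)=\emptyset$ and $\gamma$ encloses $m$ eigenvalues (counted with multiplicity) of $\mathcal A_t$, the $\lambda$-group; $P_t:=\frac{-1}{2\pi\mathbf i}\int_\gamma R_t(\zeta)\,d\zeta$. The reduced resolvent is $S_{t_0}:=\frac{-1}{2\pi\mathbf i}\int_\gamma(\lambda-\zeta)^{-1}R_{t_0}(\zeta)\,d\zeta=\lim_{\zeta\to\lambda}R_{t_0}(\zeta)(I_{\mathcal H}-P_{t_0})$. The operators $P_{t_0},S_{t_0},S_{t_0}^2$ belong to $\mathcal B(\mathcal H,\mathcal H_+)$, so $\mathrm TP_{t_0},\mathrm TS_{t_0},\mathrm TS_{t_0}^2\in\mathcal B(\mathcal H,\mathfrak H\times\mathfrak H)$, and $(\cdot)^*$ denotes the adjoint of such operators, an element of $\mathcal B(\mathfrak H\times\mathfrak H,\mathcal H)$. The operators $(\mathrm TX)^*\dot Q_{t_0}J\mathrm TY$ with $X,Y\in\{P_{t_0},S_{t_0},S_{t_0}^2\}$ map $\mathcal H$ boundedly into $\mathcal H_+$, so $\mathrm T(\mathrm TX)^*\dot Q_{t_0}J\mathrm TY\in\mathcal B(\mathcal H,\mathfrak H\times\mathfrak H)$ and its adjoint is well defined. *)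

theory Defs
  imports
    "HOL-Analysis.Analysis"
    "HOL-Complex_Analysis.Complex_Analysis"
    "HOL-Library.Equipollence"
    "HOL-Library.Landau_Symbols"
begin

section \<open>Complex Hilbert spaces\<close>

class scaleC =
  fixes scaleC :: "complex \<Rightarrow> 'a \<Rightarrow> 'a"  (infixr \<open>*\<^sub>C\<close> 75)

text \<open>The inner product is linear in its first argument. Completeness comes from
  \<^class>\<open>banach\<close>, and the norm is the one induced by the inner product.\<close>

class complex_hilbert = banach + scaleC +
  fixes cinner :: "'a \<Rightarrow> 'a \<Rightarrow> complex"
  assumes scaleC_add_right: "a *\<^sub>C (x + y) = a *\<^sub>C x + a *\<^sub>C y"
    and scaleC_add_left: "(a + b) *\<^sub>C x = a *\<^sub>C x + b *\<^sub>C x"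
    and scaleC_scaleC: "a *\<^sub>C b *\<^sub>C x = (a * b) *\<^sub>C x"
    and scaleR_scaleC: "r *\<^sub>R x = complex_of_real r *\<^sub>C x"
    and cinner_commute: "cinner x y = cnj (cinner y x)"
    and cinner_add_left: "cinner (x + y) z = cinner x z + cinner y z"
    and cinner_scaleC_left: "cinner (a *\<^sub>C x) y = a * cinner x y"
    and cinner_norm: "cinner x x = complex_of_real ((norm x)\<^sup>2)"

lemma scaleC_one: "1 *\<^sub>C x = (x :: 'a::complex_hilbert)"
  using scaleR_scaleC[of 1 x] by simp

lemma cinner_scaleC_right: "cinner x (a *\<^sub>C y) = cnj a * cinner x (y :: 'a::complex_hilbert)"
  by (metis cinner_commute cinner_scaleC_left complex_cnj_mult)

lemma norm_scaleC: "norm (a *\<^sub>C x) = cmod a * norm (x :: 'a::complex_hilbert)"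
proof -
  have "complex_of_real ((norm (a *\<^sub>C x))\<^sup>2) = a * cnj a * complex_of_real ((norm x)\<^sup>2)"
    by (simp only: cinner_norm[symmetric] cinner_scaleC_left cinner_scaleC_right ac_simps)
  also have "\<dots> = complex_of_real ((cmod a * norm x)\<^sup>2)"
    by (simp only: power_mult_distrib of_real_mult complex_norm_square)
  finally have "(norm (a *\<^sub>C x))\<^sup>2 = (cmod a * norm x)\<^sup>2"
    by (simp only: of_real_eq_iff)
  then show ?thesis
    by simp
qed

global_interpretation complex_vector:
  vector_space "scaleC :: complex \<Rightarrow> 'a \<Rightarrow> 'a::complex_hilbert"
  by unfold_locales (simp_all add: scaleC_add_right scaleC_add_left scaleC_scaleC scaleC_one)

instantiation complex :: complex_hilbert
begin
definition scaleC_complex :: "complex \<Rightarrow> complex \<Rightarrow> complex" where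
  "scaleC_complex a x = a * x"
definition cinner_complex :: "complex \<Rightarrow> complex \<Rightarrow> complex" where
  "cinner_complex x y = x * cnj y"
instance
  by standard
    (simp_all add: scaleC_complex_def cinner_complex_def algebra_simps scaleR_conv_of_real
      complex_norm_square[symmetric])
end

text \<open>The norm of the library's product type is the Euclidean one, so
  \<^typ>\<open>'a \<times> 'b\<close> is the orthogonal sum of Hilbert spaces.\<close>

instantiation prod :: (complex_hilbert, complex_hilbert) complex_hilbert
begin
definition scaleC_prod :: "complex \<Rightarrow> 'a \<times> 'b \<Rightarrow> 'a \<times> 'b" where
  "scaleC_prod a x = (a *\<^sub>C fst x, a *\<^sub>C snd x)"
definition cinner_prod :: "'a \<times> 'b \<Rightarrow> 'a \<times> 'b \<Rightarrow> complex" where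
  "cinner_prod x y = cinner (fst x) (fst y) + cinner (snd x) (snd y)"
instance
proof
  fix x y z :: "'a \<times> 'b" and a b :: complex and r :: real
  show "cinner x y = cnj (cinner y x)"
    using cinner_commute[of "fst x" "fst y"] cinner_commute[of "snd x" "snd y"]
    by (simp add: cinner_prod_def)
  show "cinner x x = complex_of_real ((norm x)\<^sup>2)"
    by (simp add: cinner_prod_def cinner_norm norm_prod_def)
qed (simp_all add: scaleC_prod_def cinner_prod_def scaleC_add_right scaleC_add_left
      scaleC_scaleC scaleR_scaleC cinner_add_left cinner_scaleC_left algebra_simps prod_eq_iff)
end


section \<open>Bounded operators\<close>

text \<open>\<^typ>\<open>'a \<Rightarrow>\<^sub>L 'b\<close> is the Banach space of bounded real-linear maps with the operator
  norm; the space of bounded operators of complex Hilbert space theory is its closed subspace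
  of complex-homogeneous elements.\<close>

definition complex_linear :: "('a::complex_hilbert \<Rightarrow>\<^sub>L 'b::complex_hilbert) \<Rightarrow> bool" where
  "complex_linear F \<longleftrightarrow> (\<forall>c x. F (c *\<^sub>C x) = c *\<^sub>C F x)"

instantiation blinfun :: (real_normed_vector, complex_hilbert) scaleC
begin
lift_definition scaleC_blinfun :: "complex \<Rightarrow> 'a \<Rightarrow>\<^sub>L 'b \<Rightarrow> 'a \<Rightarrow>\<^sub>L 'b" is "\<lambda>c F x. c *\<^sub>C F x"
proof -
  fix c :: complex and F :: "'a \<Rightarrow> 'b"
  assume F: "bounded_linear F"
  have "bounded_linear (\<lambda>y :: 'b. c *\<^sub>C y)"
    by (rule bounded_linear_intro[where K = "cmod c"])
      (simp_all add: scaleC_add_right scaleR_scaleC scaleC_scaleC mult.commute norm_scaleC)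
  then show "bounded_linear (\<lambda>x. c *\<^sub>C F x)"
    using F by (rule bounded_linear_compose)
qed
instance ..
end

definition hilbert_adjoint ::
    "('a::complex_hilbert \<Rightarrow>\<^sub>L 'b::complex_hilbert) \<Rightarrow> ('b \<Rightarrow>\<^sub>L 'a)"  (\<open>(_\<^sup>\<dagger>)\<close> [1000] 999) where
  "F\<^sup>\<dagger> = (THE G :: 'b \<Rightarrow>\<^sub>L 'a. \<forall>x y. cinner (F x) y = cinner x (G y))"

definition orthogonal_projection :: "('a::complex_hilbert \<Rightarrow>\<^sub>L 'a) \<Rightarrow> bool" where
  "orthogonal_projection Q \<longleftrightarrow> complex_linear Q \<and> Q o\<^sub>L Q = Q \<and> Q\<^sup>\<dagger> = Q"

text \<open>Second-order expansion at \<open>t\<^sub>0\<close> in the complex space of bounded operators, for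
  \<open>t \<rightarrow> t\<^sub>0\<close> within \<open>[0,1]\<close>; membership in that space is part of the assertion.\<close>

definition second_order_expansion ::
    "(real \<Rightarrow> ('a::complex_hilbert \<Rightarrow>\<^sub>L 'b::complex_hilbert)) \<Rightarrow> real
      \<Rightarrow> ('a \<Rightarrow>\<^sub>L 'b) \<Rightarrow> ('a \<Rightarrow>\<^sub>L 'b) \<Rightarrow> bool" where
  "second_order_expansion F t\<^sub>0 F' F'' \<longleftrightarrow>
     (\<forall>\<^sub>F t in at t\<^sub>0 within {0..1}. complex_linear (F t)) \<and>
     complex_linear (F t\<^sub>0) \<and> complex_linear F' \<and> complex_linear F'' \<and>
     (\<lambda>t. norm (F t - (F t\<^sub>0 + (t - t\<^sub>0) *\<^sub>R F' + (1/2 * (t - t\<^sub>0)\<^sup>2) *\<^sub>R F'')))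
       \<in> o[at t\<^sub>0 within {0..1}](\<lambda>t. (t - t\<^sub>0)\<^sup>2)"


section \<open>Unbounded operators\<close>

text \<open>An operator in a Hilbert space is a partial map with its domain \<^term>\<open>dom A\<close>; extension
  of operators is \<^term>\<open>A \<subseteq>\<^sub>m B\<close>.\<close>

definition linear_operator :: "('a::complex_hilbert \<rightharpoonup> 'a) \<Rightarrow> bool" where
  "linear_operator A \<longleftrightarrow> complex_vector.subspace (dom A) \<and>
     (\<forall>x\<in>dom A. \<forall>y\<in>dom A. the (A (x + y)) = the (A x) + the (A y)) \<and>
     (\<forall>c. \<forall>x\<in>dom A. the (A (c *\<^sub>C x)) = c *\<^sub>C the (A x))"

definition densely_defined :: "('a::complex_hilbert \<rightharpoonup> 'a) \<Rightarrow> bool" where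
  "densely_defined A \<longleftrightarrow> closure (dom A) = UNIV"

definition symmetric_operator :: "('a::complex_hilbert \<rightharpoonup> 'a) \<Rightarrow> bool" where
  "symmetric_operator A \<longleftrightarrow> linear_operator A \<and>
     (\<forall>x\<in>dom A. \<forall>y\<in>dom A. cinner (the (A x)) y = cinner x (the (A y)))"

text \<open>Meaningful for densely defined \<open>A\<close>, where the vector \<open>z\<close> is unique.\<close>

definition op_adjoint :: "('a::complex_hilbert \<rightharpoonup> 'a) \<Rightarrow> ('a \<rightharpoonup> 'a)" where
  "op_adjoint A = (\<lambda>y.
     if \<exists>z. \<forall>x\<in>dom A. cinner (the (A x)) y = cinner x z
     then Some (THE z. \<forall>x\<in>dom A. cinner (the (A x)) y = cinner x z)
     else None)"

definition self_adjoint :: "('a::complex_hilbert \<rightharpoonup> 'a) \<Rightarrow> bool" where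
  "self_adjoint A \<longleftrightarrow> linear_operator A \<and> densely_defined A \<and> op_adjoint A = A"

definition eigenspace :: "('a::complex_hilbert \<rightharpoonup> 'a) \<Rightarrow> complex \<Rightarrow> 'a set" where
  "eigenspace A z = {x \<in> dom A. the (A x) = z *\<^sub>C x}"

definition orthonormal_basis :: "'a::complex_hilbert set \<Rightarrow> 'a set \<Rightarrow> bool" where
  "orthonormal_basis B M \<longleftrightarrow>
     (\<forall>x\<in>B. \<forall>y\<in>B. cinner x y = (if x = y then 1 else 0)) \<and>
     closure (complex_vector.span B) = M"

text \<open>The deficiency indices are the Hilbert space dimensions of \<open>ker (A\<^sup>* \<mp> \<i>)\<close>, which are
  compared as arbitrary cardinals.\<close>

definition equal_deficiency_indices :: "('a::complex_hilbert \<rightharpoonup> 'a) \<Rightarrow> bool" where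
  "equal_deficiency_indices A \<longleftrightarrow>
     (\<exists>B C. orthonormal_basis B (eigenspace (op_adjoint A) \<i>) \<and>
            orthonormal_basis C (eigenspace (op_adjoint A) (- \<i>)) \<and> B \<approx> C)"

definition is_resolvent_at ::
    "('a::complex_hilbert \<rightharpoonup> 'a) \<Rightarrow> complex \<Rightarrow> ('a \<Rightarrow>\<^sub>L 'a) \<Rightarrow> bool" where
  "is_resolvent_at A z R \<longleftrightarrow> complex_linear R \<and>
     (\<forall>y. R y \<in> dom A \<and> the (A (R y)) - z *\<^sub>C R y = y) \<and>
     (\<forall>x\<in>dom A. R (the (A x) - z *\<^sub>C x) = x)"

definition spectrum :: "('a::complex_hilbert \<rightharpoonup> 'a) \<Rightarrow> complex set" where
  "spectrum A = {z. \<nexists>R. is_resolvent_at A z R}"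

text \<open>\<open>(A - z)\<^sup>-\<^sup>1\<close>, for \<open>z\<close> outside the spectrum.\<close>

definition resolvent :: "('a::complex_hilbert \<rightharpoonup> 'a) \<Rightarrow> complex \<Rightarrow> ('a \<Rightarrow>\<^sub>L 'a)" where
  "resolvent A z = (THE R. is_resolvent_at A z R)"

text \<open>The library's \<^const>\<open>vector_space.dim\<close> is \<open>0\<close> on infinite-dimensional spaces; for an
  eigenvalue the multiplicity is positive, so \<open>0 < m\<close> expresses finite multiplicity.\<close>

definition isolated_eigenvalue :: "('a::complex_hilbert \<rightharpoonup> 'a) \<Rightarrow> complex \<Rightarrow> nat \<Rightarrow> bool" where
  "isolated_eigenvalue A \<mu> m \<longleftrightarrow> \<mu> isolated_in spectrum A \<and>
     eigenspace A \<mu> \<noteq> {0} \<and> 0 < m \<and> complex_vector.dim (eigenspace A \<mu>) = m"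


section \<open>Riesz projections\<close>

text \<open>The vector-valued version of the library's complex-valued \<^const>\<open>contour_integral\<close>.\<close>

definition vector_contour_integral ::
    "(real \<Rightarrow> complex) \<Rightarrow> (complex \<Rightarrow> 'b::{real_normed_vector,scaleC}) \<Rightarrow> 'b" where
  "vector_contour_integral g f =
     integral {0..1} (\<lambda>x. vector_derivative g (at x within {0..1}) *\<^sub>C f (g x))"

text \<open>The counterclockwise circle \<open>2 |z - \<mu>| = dist(\<mu>, Spec A - {\<mu>})\<close>. If the spectrum is
  \<open>{\<mu>}\<close>, that distance is infinite and any radius will do.\<close>

definition eigenvalue_contour ::
    "('a::complex_hilbert \<rightharpoonup> 'a) \<Rightarrow> complex \<Rightarrow> real \<Rightarrow> complex" where
  "eigenvalue_contour A \<mu> = circlepath \<mu>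
     (if spectrum A \<subseteq> {\<mu>} then 1 else infdist \<mu> (spectrum A - {\<mu>}) / 2)"

definition riesz_projection ::
    "(real \<Rightarrow> complex) \<Rightarrow> ('a::complex_hilbert \<rightharpoonup> 'a) \<Rightarrow> ('a \<Rightarrow>\<^sub>L 'a)" where
  "riesz_projection g A =
     (- 1 / (2 * complex_of_real pi * \<i>)) *\<^sub>C vector_contour_integral g (resolvent A)"

definition reduced_resolvent ::
    "(real \<Rightarrow> complex) \<Rightarrow> ('a::complex_hilbert \<rightharpoonup> 'a) \<Rightarrow> complex \<Rightarrow> ('a \<Rightarrow>\<^sub>L 'a)" where
  "reduced_resolvent g A \<mu> =
     (- 1 / (2 * complex_of_real pi * \<i>)) *\<^sub>C
       vector_contour_integral g (\<lambda>\<zeta>. inverse (\<mu> - \<zeta>) *\<^sub>C resolvent A \<zeta>)"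


section \<open>Boundary triplets and Lagrangian subspaces\<close>

definition graph_cinner :: "('a::complex_hilbert \<rightharpoonup> 'a) \<Rightarrow> 'a \<Rightarrow> 'a \<Rightarrow> complex" where
  "graph_cinner A u v = cinner u v + cinner (the (A u)) (the (A v))"

definition graph_norm :: "('a::complex_hilbert \<rightharpoonup> 'a) \<Rightarrow> 'a \<Rightarrow> real" where
  "graph_norm A u = sqrt (Re (graph_cinner A u u))"

text \<open>The boundary maps live on \<open>dom (A\<^sup>*)\<close>; their values elsewhere are irrelevant.\<close>

definition boundary_triplet ::
    "('h::complex_hilbert \<rightharpoonup> 'h) \<Rightarrow> ('h \<Rightarrow> 'k) \<Rightarrow> ('h \<Rightarrow> 'k::complex_hilbert) \<Rightarrow> bool" where
  "boundary_triplet A \<Gamma>\<^sub>0 \<Gamma>\<^sub>1 \<longleftrightarrow>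
     (let As = op_adjoint A; D = dom As; T = (\<lambda>u. (\<Gamma>\<^sub>0 u, \<Gamma>\<^sub>1 u)) in
       (\<forall>u\<in>D. \<forall>v\<in>D. T (u + v) = T u + T v) \<and>
       (\<forall>c. \<forall>u\<in>D. T (c *\<^sub>C u) = c *\<^sub>C T u) \<and>
       (\<exists>K. \<forall>u\<in>D. norm (T u) \<le> K * graph_norm As u) \<and>
       T ` D = UNIV \<and>
       (\<forall>u\<in>D. \<forall>v\<in>D. cinner (the (As u)) v - cinner u (the (As v))
                      = cinner (\<Gamma>\<^sub>1 u) (\<Gamma>\<^sub>0 v) - cinner (\<Gamma>\<^sub>0 u) (\<Gamma>\<^sub>1 v)))"

definition symplectic_form :: "'k::complex_hilbert \<times> 'k \<Rightarrow> 'k \<times> 'k \<Rightarrow> complex" where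
  "symplectic_form f g = cinner (snd f) (fst g) - cinner (fst f) (snd g)"

definition lagrangian :: "('k::complex_hilbert \<times> 'k) set \<Rightarrow> bool" where
  "lagrangian F \<longleftrightarrow> F = {f. \<forall>g\<in>F. symplectic_form f g = 0}"

lift_definition symplectic_J :: "('k::complex_hilbert \<times> 'k) \<Rightarrow>\<^sub>L ('k \<times> 'k)" (\<open>\<J>\<close>)
  is "\<lambda>f. (snd f, - fst f)"
  by (intro bounded_linear_Pair bounded_linear_minus bounded_linear_fst bounded_linear_snd)

lemma symplectic_form_J: "symplectic_form f g = cinner (\<J> f) g"
proof -
  have "cinner (- x) y = - cinner x y" for x y :: 'a
    using cinner_scaleC_left[of "-1" x y] scaleR_scaleC[of "-1" x] by simp
  then show ?thesis
    by (simp add: symplectic_form_def symplectic_J.rep_eq cinner_prod_def)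
qed

text \<open>The product of a boundary map \<open>T\<close>, bounded on \<open>dom (A\<^sup>*)\<close> with the graph norm, and an
  operator \<open>X\<close> mapping boundedly into that space.\<close>

definition boundary_compose ::
    "('h \<Rightarrow> 'b::complex_hilbert) \<Rightarrow> ('a::complex_hilbert \<Rightarrow>\<^sub>L 'h::complex_hilbert) \<Rightarrow> ('a \<Rightarrow>\<^sub>L 'b)"
    (infixr \<open>\<odot>\<close> 75) where
  "T \<odot> X = Blinfun (\<lambda>x. T (X x))"

end

theory Submission
  imports Defs
begin

text \<open>
  Write \<open>R\<^sub>t(z)\<close> for the resolvent of \<open>\<A> t\<close> and \<open>\<Delta> = Q t - Q t\<^sub>0\<close>. Green's formula, applied to
  \<open>R\<^sub>t\<^sub>0(z) x\<close> and \<open>R\<^sub>t(cnj z) y\<close>, gives a Krein-type formula: the difference \<open>R\<^sub>t(z) - R\<^sub>t\<^sub>0(z)\<close> equals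
  \<open>(T R\<^sub>t(cnj z))\<^sup>\<dagger> \<Delta> \<J> T R\<^sub>t\<^sub>0(z)\<close>. The factor \<open>\<Delta>\<close> appears because boundary values of \<open>R\<^sub>t\<close> lie in
  \<open>ran (Q t)\<close>, while \<open>\<J>\<close> maps \<open>ran (Q t\<^sub>0)\<close> into the kernel of \<open>Q t\<^sub>0\<close> (\<open>krein_formula\<close>). The operators
  \<open>(T R(cnj z))\<^sup>\<dagger>\<close> take values in \<open>ker (A\<^sup>* - z)\<close>, on which the graph norm is equivalent to the norm; so
  \<open>T\<close> can be applied to them, and the formula can be iterated. This expands \<open>R\<^sub>t(z)\<close> up to an error of
  third order in \<open>\<Delta>\<close>, uniformly on the contour (\<open>resolvent_second_order\<close>, \<open>resolvent_expansion_error\<close>).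
  The contour belongs to the resolvent set of \<open>\<A> t\<close> for \<open>t\<close> near \<open>t\<^sub>0\<close> by a contraction argument for
  boundary values (\<open>resolvent_set_stable\<close>). Inserting the expansion of \<open>Q\<close> and integrating over the
  contour yields the expansion of the Riesz projection, with contour integrals as coefficients
  (\<open>riesz_projection_expansion\<close>).

  These integrals are residues. Since \<open>\<A> t\<^sub>0\<close> is self-adjoint, its resolvent has a simple pole at the
  isolated eigenvalue: \<open>R(z) = P / (\<mu> - z) + S - (\<mu> - z) S\<^sup>2 + \<dots>\<close>. This is proved without spectral
  theory: for a symmetric operator \<open>B\<close>, one of \<open>\<plusminus>\<parallel>B\<parallel>\<close> is an approximate eigenvalue, and applied to a
  suitable combination of resolvents this shows that \<open>(\<mu> - s) R(s)\<close> is Lipschitz for real \<open>s\<close> near \<open>\<mu>\<close>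
  (\<open>isolated_point_estimate\<close>, \<open>isolated_point_simple_pole\<close>). The first-order coefficient of the Riesz
  projection collects the products of two Laurent coefficients whose orders add up to \<open>-1\<close>; the
  second-order coefficient does the same for two and for three factors
  (\<open>circle_residue_first_order\<close>, \<open>circle_residue_second_order\<close>).
\<close>


section \<open>Elementary geometry of complex Hilbert spaces\<close>

lemma cinner_add_right: "cinner x (y + z) = cinner x y + cinner x (z :: 'a::complex_hilbert)"
  by (metis cinner_add_left cinner_commute complex_cnj_add)

lemma cinner_zero_left [simp]: "cinner 0 (y :: 'a::complex_hilbert) = 0"
  using cinner_add_left[of 0 0 y] by simp

lemma cinner_zero_right [simp]: "cinner (y :: 'a::complex_hilbert) 0 = 0"
  using cinner_add_right[of y 0 0] by simp

lemma cinner_minus_left: "cinner (- x) y = - cinner x (y :: 'a::complex_hilbert)"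
  using cinner_add_left[of x "- x" y] by (simp add: add_eq_0_iff)

lemma cinner_minus_right: "cinner x (- y) = - cinner x (y :: 'a::complex_hilbert)"
  using cinner_add_right[of x y "- y"] by (simp add: add_eq_0_iff)

lemma cinner_diff_left: "cinner (x - y) z = cinner x z - cinner y (z :: 'a::complex_hilbert)"
  using cinner_add_left[of x "- y" z] by (simp add: cinner_minus_left)

lemma cinner_diff_right: "cinner x (y - z) = cinner x y - cinner x (z :: 'a::complex_hilbert)"
  using cinner_add_right[of x y "- z"] by (simp add: cinner_minus_right)

lemma cinner_scaleR_left: "cinner (r *\<^sub>R x) y = of_real r * cinner x (y :: 'a::complex_hilbert)"
  by (simp add: scaleR_scaleC cinner_scaleC_left)

lemma cinner_scaleR_right: "cinner x (r *\<^sub>R y) = of_real r * cinner x (y :: 'a::complex_hilbert)"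
  by (simp add: scaleR_scaleC cinner_scaleC_right)

lemmas cinner_simps = cinner_add_left cinner_add_right cinner_diff_left cinner_diff_right
  cinner_minus_left cinner_minus_right cinner_scaleC_left cinner_scaleC_right
  cinner_scaleR_left cinner_scaleR_right

lemma cinner_self_eq_0 [simp]: "cinner x x = 0 \<longleftrightarrow> x = (0 :: 'a::complex_hilbert)"
  by (simp add: cinner_norm)

lemma cinner_eq_all_left: "(\<And>y. cinner x y = cinner x' y) \<Longrightarrow> x = (x' :: 'a::complex_hilbert)"
  by (metis cinner_diff_left cinner_self_eq_0 eq_iff_diff_eq_0)

lemma cinner_eq_all_right: "(\<And>y. cinner y x = cinner y x') \<Longrightarrow> x = (x' :: 'a::complex_hilbert)"
  by (metis cinner_diff_right cinner_self_eq_0 eq_iff_diff_eq_0)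

lemma scaleC_zero_left [simp]: "0 *\<^sub>C (x :: 'a::complex_hilbert) = 0"
  by simp

lemma scaleC_minus1 [simp]: "(- 1) *\<^sub>C (x :: 'a::complex_hilbert) = - x"
  using scaleR_scaleC[of "-1" x] by simp

lemma power2_norm_eq_Re_cinner: "(norm (x :: 'a::complex_hilbert))\<^sup>2 = Re (cinner x x)"
  by (simp add: cinner_norm)

lemma norm_diff_squared:
  "(norm (x - y))\<^sup>2 = (norm x)\<^sup>2 + (norm y)\<^sup>2 - 2 * Re (cinner x (y :: 'a::complex_hilbert))"
proof -
  have "Re (cinner y x) = Re (cinner x y)"
    by (subst cinner_commute) simp
  then show ?thesis
    by (simp add: power2_norm_eq_Re_cinner cinner_simps)
qed

lemma norm_add_squared:
  "(norm (x + y))\<^sup>2 = (norm x)\<^sup>2 + (norm y)\<^sup>2 + 2 * Re (cinner x (y :: 'a::complex_hilbert))"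
  using norm_diff_squared[of x "- y"] by (simp add: cinner_minus_right)

lemma norm_minus_projection:
  fixes x y :: "'a::complex_hilbert"
  assumes "y \<noteq> 0"
  shows "(norm (x - (cinner x y / of_real ((norm y)\<^sup>2)) *\<^sub>C y))\<^sup>2
    = (norm x)\<^sup>2 - (cmod (cinner x y))\<^sup>2 / (norm y)\<^sup>2"
proof -
  define a where "a = cinner x y / of_real ((norm y)\<^sup>2)"
  have "cinner x (a *\<^sub>C y) = of_real ((cmod (cinner x y))\<^sup>2 / (norm y)\<^sup>2)"
    by (simp add: a_def cinner_simps complex_mult_cnj cmod_power2 mult.commute)
  then have 1: "Re (cinner x (a *\<^sub>C y)) = (cmod (cinner x y))\<^sup>2 / (norm y)\<^sup>2"
    by (simp only: Re_complex_of_real)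
  have "norm (a *\<^sub>C y) = cmod (cinner x y) / (norm y)\<^sup>2 * norm y"
    by (simp only: a_def norm_scaleC norm_divide norm_of_real) simp
  then have 2: "(norm (a *\<^sub>C y))\<^sup>2 = (cmod (cinner x y))\<^sup>2 / (norm y)\<^sup>2"
    using assms by (simp add: power2_eq_square)
  show ?thesis
    unfolding a_def[symmetric] norm_diff_squared 1 2 by simp
qed

lemma cauchy_schwarz: "cmod (cinner x y) \<le> norm x * norm (y :: 'a::complex_hilbert)"
proof (cases "y = 0")
  case False
  have "0 \<le> (norm x)\<^sup>2 - (cmod (cinner x y))\<^sup>2 / (norm y)\<^sup>2"
    unfolding norm_minus_projection[OF False, symmetric] by simp
  then have "(cmod (cinner x y))\<^sup>2 \<le> (norm x * norm y)\<^sup>2"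
    using False by (simp add: divide_le_eq power_mult_distrib)
  then show ?thesis
    by (rule power2_le_imp_le) simp
qed simp

lemma Re_cinner_le: "Re (cinner x y) \<le> norm x * norm (y :: 'a::complex_hilbert)"
  using cauchy_schwarz[of x y] complex_Re_le_cmod[of "cinner x y"] by linarith

lemma bounded_bilinear_cinner:
  "bounded_bilinear (cinner :: 'a::complex_hilbert \<Rightarrow> 'a \<Rightarrow> complex)"
proof
  show "\<exists>K. \<forall>a b :: 'a. cmod (cinner a b) \<le> norm a * norm b * K"
    by (rule exI[of _ 1]) (simp add: cauchy_schwarz)
qed (simp_all add: cinner_simps scaleR_conv_of_real)

lemmas tendsto_cinner = bounded_bilinear.tendsto[OF bounded_bilinear_cinner]

lemma bounded_bilinear_scaleC:
  "bounded_bilinear ((*\<^sub>C) :: complex \<Rightarrow> 'a \<Rightarrow> 'a::complex_hilbert)"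
proof
  show "\<exists>K. \<forall>a. \<forall>b :: 'a. norm (a *\<^sub>C b) \<le> norm a * norm b * K"
    by (rule exI[of _ 1]) (simp add: norm_scaleC)
qed (simp_all add: scaleC_add_left scaleC_add_right scaleR_scaleC scaleC_scaleC
    scaleC_complex_def mult.commute)

lemmas tendsto_scaleC = bounded_bilinear.tendsto[OF bounded_bilinear_scaleC]

text \<open>A vector representing \<open>\<phi>\<close> is, up to a factor, the element of least norm \<open>z\<close> of the affine
  hyperplane \<open>\<phi> = 1\<close>: by the parallelogram law a minimising sequence is a Cauchy sequence, and
  minimality makes \<open>z\<close> orthogonal to the kernel of \<open>\<phi>\<close>.\<close>

lemma riesz_representation:
  fixes \<phi> :: "'a::complex_hilbert \<Rightarrow> complex"
  assumes bl: "bounded_linear \<phi>" and hom: "\<And>c x. \<phi> (c *\<^sub>C x) = c * \<phi> x"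
  shows "\<exists>z. \<forall>x. \<phi> x = cinner x z"
proof (cases "\<forall>x. \<phi> x = 0")
  case True
  then show ?thesis
    by (intro exI[of _ 0]) simp
next
  case False
  then obtain x0 where x0: "\<phi> x0 \<noteq> 0"
    by auto
  interpret \<phi>: bounded_linear \<phi> by (rule bl)
  define N where "N = norm ` {x. \<phi> x = 1}"
  define d where "d = Inf N"
  have "\<phi> ((1 / \<phi> x0) *\<^sub>C x0) = 1"
    using x0 by (simp add: hom)
  then have Nne: "N \<noteq> {}"
    unfolding N_def by blast
  have bdd: "bdd_below N"
    unfolding N_def by (rule bdd_belowI[of _ 0]) auto
  have d_le: "d \<le> norm x" if "\<phi> x = 1" for x
    unfolding d_def using that by (intro cInf_lower bdd) (auto simp: N_def)
  have d0: "0 \<le> d"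
    unfolding d_def by (rule cInf_greatest[OF Nne]) (auto simp: N_def)
  have "\<exists>x. \<phi> x = 1 \<and> norm x < d + 1 / real (Suc n)" for n
  proof -
    have "Inf N < d + 1 / real (Suc n)"
      unfolding d_def by simp
    then obtain y where "y \<in> N" "y < d + 1 / real (Suc n)"
      using cInf_lessD[OF Nne] by blast
    then show ?thesis
      unfolding N_def by auto
  qed
  then obtain X where X: "\<And>n. \<phi> (X n) = 1" and Xd: "\<And>n. norm (X n) < d + 1 / real (Suc n)"
    by metis
  have par: "(norm (x - y))\<^sup>2 \<le> 2 * (norm x)\<^sup>2 + 2 * (norm y)\<^sup>2 - 4 * d\<^sup>2"
    if "\<phi> x = 1" "\<phi> y = 1" for x y
  proof -
    have "\<phi> ((1/2) *\<^sub>R (x + y)) = 1"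
      using that by (simp add: \<phi>.scaleR \<phi>.add scaleR_conv_of_real)
    from d_le[OF this] have "2 * d \<le> norm (x + y)"
      by simp
    then have "(2 * d)\<^sup>2 \<le> (norm (x + y))\<^sup>2"
      using d0 by (intro power_mono) auto
    then show ?thesis
      unfolding norm_add_squared norm_diff_squared by (simp add: power_mult_distrib)
  qed
  have "Cauchy X"
  proof (rule metric_CauchyI)
    fix e :: real
    assume e: "0 < e"
    have "(\<lambda>n. 4 * (d + 1 / real (Suc n))\<^sup>2 - 4 * d\<^sup>2) \<longlonglongrightarrow> 4 * (d + 0)\<^sup>2 - 4 * d\<^sup>2"
      by (intro tendsto_intros LIMSEQ_Suc[OF lim_1_over_n])
    then have "\<forall>\<^sub>F n in sequentially. 4 * (d + 1 / real (Suc n))\<^sup>2 - 4 * d\<^sup>2 < e\<^sup>2"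
      using e by (intro order_tendstoD(2)[where y = 0]) auto
    then obtain M where M: "4 * (d + 1 / real (Suc M))\<^sup>2 - 4 * d\<^sup>2 < e\<^sup>2"
      unfolding eventually_sequentially by blast
    have small: "(norm (X n))\<^sup>2 \<le> (d + 1 / real (Suc M))\<^sup>2" if "n \<ge> M" for n
    proof (rule power_mono)
      have "1 / real (Suc n) \<le> 1 / real (Suc M)"
        using that by (simp add: frac_le)
      then show "norm (X n) \<le> d + 1 / real (Suc M)"
        using Xd[of n] by linarith
    qed simp
    have "dist (X m) (X n) < e" if "m \<ge> M" "n \<ge> M" for m n
    proof -
      have "(norm (X m - X n))\<^sup>2 < e\<^sup>2"
        using par[OF X[of m] X[of n]] small[OF that(1)] small[OF that(2)] M by linarith
      then show ?thesis
        using e by (simp add: dist_norm power_less_imp_less_base)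
    qed
    then show "\<exists>M. \<forall>m\<ge>M. \<forall>n\<ge>M. dist (X m) (X n) < e"
      by blast
  qed
  then obtain z where z: "X \<longlonglongrightarrow> z"
    using convergent_eq_Cauchy by blast
  have "(\<lambda>n. \<phi> (X n)) \<longlonglongrightarrow> \<phi> z"
    by (rule \<phi>.tendsto[OF z])
  then have \<phi>z: "\<phi> z = 1"
    by (simp add: X LIMSEQ_const_iff)
  have "norm z \<le> d"
  proof (rule LIMSEQ_le[OF tendsto_norm[OF z]])
    show "(\<lambda>n. d + 1 / real (Suc n)) \<longlonglongrightarrow> d"
      using tendsto_add[OF tendsto_const[of d] LIMSEQ_Suc[OF lim_1_over_n]] by simp
  qed (use Xd less_imp_le in blast)
  then have zmin: "norm z \<le> norm x" if "\<phi> x = 1" for x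
    using d_le[OF that] by linarith
  have z0: "z \<noteq> 0"
    using \<phi>z \<phi>.zero by auto
  have orth: "cinner h z = 0" if h: "\<phi> h = 0" for h
  proof (cases "h = 0")
    case False
    define a where "a = cinner z h / of_real ((norm h)\<^sup>2)"
    have nh: "(norm h)\<^sup>2 > 0"
      using False by simp
    have "\<phi> (z - a *\<^sub>C h) = 1"
      using h \<phi>z by (simp add: \<phi>.diff hom)
    then have "(norm z)\<^sup>2 \<le> (norm (z - a *\<^sub>C h))\<^sup>2"
      using zmin by (intro power_mono) auto
    then have "(cmod (cinner z h))\<^sup>2 / (norm h)\<^sup>2 \<le> 0"
      unfolding a_def norm_minus_projection[OF False] by linarith
    then have "(cmod (cinner z h))\<^sup>2 \<le> 0"
      using nh by (simp add: divide_le_0_iff)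
    then have "cinner z h = 0"
      by simp
    then show ?thesis
      by (subst cinner_commute) simp
  qed simp
  have "\<phi> x = cinner x ((1 / of_real ((norm z)\<^sup>2)) *\<^sub>C z)" for x
  proof -
    have "\<phi> (x - \<phi> x *\<^sub>C z) = 0"
      by (simp add: \<phi>.diff hom \<phi>z)
    from orth[OF this] have "cinner x z = \<phi> x * of_real ((norm z)\<^sup>2)"
      by (simp add: cinner_simps cinner_norm)
    then show ?thesis
      using z0 by (simp add: cinner_simps)
  qed
  then show ?thesis
    by blast
qed


section \<open>Bounded operators and their adjoints\<close>

lemma scaleC_blinfun_apply [simp]: "blinfun_apply (c *\<^sub>C F) x = c *\<^sub>C F x"
  by (simp add: scaleC_blinfun.rep_eq)

lemma norm_scaleC_blinfun:
  fixes F :: "'a::real_normed_vector \<Rightarrow>\<^sub>L 'b::complex_hilbert"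
  shows "norm (c *\<^sub>C F) \<le> cmod c * norm F"
proof (rule norm_blinfun_bound)
  fix x
  have "norm (F x) \<le> norm F * norm x"
    by (rule norm_blinfun)
  then show "norm ((c *\<^sub>C F) x) \<le> cmod c * norm F * norm x"
    by (simp add: norm_scaleC mult.assoc mult_left_mono)
qed simp

lemma bounded_bilinear_scaleC_blinfun:
  "bounded_bilinear ((*\<^sub>C) :: complex \<Rightarrow> ('a::real_normed_vector \<Rightarrow>\<^sub>L 'b) \<Rightarrow> 'a \<Rightarrow>\<^sub>L 'b::complex_hilbert)"
proof
  show "\<exists>K. \<forall>a. \<forall>b :: 'a \<Rightarrow>\<^sub>L 'b. norm (a *\<^sub>C b) \<le> norm a * norm b * K"
    by (rule exI[of _ 1]) (simp add: norm_scaleC_blinfun)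
qed (auto intro!: blinfun_eqI simp: blinfun.bilinear_simps scaleC_add_left scaleC_add_right
    scaleR_scaleC scaleC_scaleC scaleC_complex_def mult.commute)

lemma scaleC_blinfun_scaleC [simp]:
  "a *\<^sub>C (b *\<^sub>C (F :: 'a::real_normed_vector \<Rightarrow>\<^sub>L 'b::complex_hilbert)) = (a * b) *\<^sub>C F"
  by (rule blinfun_eqI) (simp add: scaleC_scaleC)

lemma scaleC_blinfun_one [simp]: "1 *\<^sub>C (F :: 'a::real_normed_vector \<Rightarrow>\<^sub>L 'b::complex_hilbert) = F"
  by (rule blinfun_eqI) simp

lemma scaleC_blinfun_zero [simp]:
  "0 *\<^sub>C (F :: 'a::real_normed_vector \<Rightarrow>\<^sub>L 'b::complex_hilbert) = 0"
  "c *\<^sub>C (0 :: 'a::real_normed_vector \<Rightarrow>\<^sub>L 'b::complex_hilbert) = 0"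
  by (rule blinfun_eqI, simp)+

lemma complex_linear_apply: "complex_linear F \<Longrightarrow> F (c *\<^sub>C x) = c *\<^sub>C F x"
  unfolding complex_linear_def by blast

named_theorems complex_linear_intros

lemma complex_linear_add [complex_linear_intros]:
  "complex_linear F \<Longrightarrow> complex_linear G \<Longrightarrow> complex_linear (F + G)"
  by (simp add: complex_linear_def blinfun.bilinear_simps scaleC_add_right)

lemma complex_linear_diff [complex_linear_intros]:
  "complex_linear F \<Longrightarrow> complex_linear G \<Longrightarrow> complex_linear (F - G)"
  by (simp add: complex_linear_def blinfun.bilinear_simps complex_vector.scale_right_diff_distrib)

lemma complex_linear_minus [complex_linear_intros]:
  "complex_linear F \<Longrightarrow> complex_linear (- F)"
  by (simp add: complex_linear_def blinfun.bilinear_simps)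

lemma complex_linear_compose [complex_linear_intros]:
  "complex_linear F \<Longrightarrow> complex_linear G \<Longrightarrow> complex_linear (F o\<^sub>L G)"
  by (simp add: complex_linear_def)

lemma complex_linear_scaleC [complex_linear_intros]:
  "complex_linear F \<Longrightarrow> complex_linear (c *\<^sub>C F)"
  by (simp add: complex_linear_def scaleC_scaleC mult.commute)

lemma complex_linear_scaleR [complex_linear_intros]:
  "complex_linear F \<Longrightarrow> complex_linear (r *\<^sub>R F)"
  by (simp add: complex_linear_def scaleR_scaleC scaleC_scaleC mult.commute blinfun.bilinear_simps)

lemma complex_linear_zero [complex_linear_intros]: "complex_linear 0"
  by (simp add: complex_linear_def)

lemma complex_linear_id [complex_linear_intros]: "complex_linear id_blinfun"
  by (simp add: complex_linear_def)

lemma complex_linear_J [complex_linear_intros]: "complex_linear \<J>"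
  by (simp add: complex_linear_def symplectic_J.rep_eq scaleC_prod_def)

lemma complex_linear_LIMSEQ:
  assumes "X \<longlonglongrightarrow> F" and "\<And>n. complex_linear (X n)"
  shows "complex_linear F"
  unfolding complex_linear_def
proof (intro allI)
  fix c x
  have "(\<lambda>n. X n (c *\<^sub>C x)) \<longlonglongrightarrow> F (c *\<^sub>C x)"
    by (intro blinfun.tendsto assms(1) tendsto_const)
  moreover have "(\<lambda>n. X n (c *\<^sub>C x)) \<longlonglongrightarrow> c *\<^sub>C F x"
    using assms(2) by (simp add: complex_linear_apply tendsto_scaleC blinfun.tendsto assms(1))
  ultimately show "F (c *\<^sub>C x) = c *\<^sub>C F x"
    by (rule LIMSEQ_unique)
qed

lemma hilbert_adjoint_unique:
  fixes F :: "'a::complex_hilbert \<Rightarrow>\<^sub>L 'b::complex_hilbert" and G :: "'b \<Rightarrow>\<^sub>L 'a"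
  assumes "\<And>x y. cinner (F x) y = cinner x (G y)"
  shows "F\<^sup>\<dagger> = G"
  unfolding hilbert_adjoint_def
proof (rule the_equality)
  fix H :: "'b \<Rightarrow>\<^sub>L 'a"
  assume "\<forall>x y. cinner (F x) y = cinner x (H y)"
  then have "cinner x (H y) = cinner x (G y)" for x y
    by (metis assms)
  then show "H = G"
    by (intro blinfun_eqI) (rule cinner_eq_all_right)
qed (use assms in blast)

lemma hilbert_adjoint_exists:
  fixes F :: "'a::complex_hilbert \<Rightarrow>\<^sub>L 'b::complex_hilbert"
  assumes F: "complex_linear F"
  shows "\<exists>G :: 'b \<Rightarrow>\<^sub>L 'a. \<forall>x y. cinner (F x) y = cinner x (G y)"
proof -
  have "\<exists>z. \<forall>x. cinner (F x) y = cinner x z" for y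
  proof (rule riesz_representation)
    show "bounded_linear (\<lambda>x. cinner (F x) y)"
      by (rule bounded_linear_compose[OF bounded_bilinear.bounded_linear_left[OF bounded_bilinear_cinner]
            blinfun.bounded_linear_right])
  qed (simp add: F complex_linear_apply cinner_simps)
  then obtain g where g: "\<And>x y. cinner (F x) y = cinner x (g y)"
    by metis
  have "g (x + y) = g x + g y" for x y
    by (rule cinner_eq_all_right) (simp add: cinner_simps flip: g)
  moreover have "g (r *\<^sub>R x) = r *\<^sub>R g x" for r x
    by (rule cinner_eq_all_right) (simp add: cinner_simps flip: g)
  moreover have "norm (g y) \<le> norm y * norm F" for y
  proof -
    have "(norm (g y))\<^sup>2 = Re (cinner (F (g y)) y)"
      by (simp add: g power2_norm_eq_Re_cinner)
    also have "\<dots> \<le> norm (F (g y)) * norm y"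
      by (rule Re_cinner_le)
    also have "\<dots> \<le> norm F * norm (g y) * norm y"
      by (intro mult_right_mono norm_blinfun) simp
    finally show ?thesis
      by (cases "norm (g y) = 0") (simp_all add: power2_eq_square mult_ac)
  qed
  ultimately have "bounded_linear g"
    by (rule bounded_linear_intro)
  then show ?thesis
    by (intro exI[of _ "Blinfun g"]) (simp add: bounded_linear_Blinfun_apply g)
qed

lemma cinner_adjoint:
  assumes "complex_linear F"
  shows "cinner (F x) y = cinner x ((F\<^sup>\<dagger>) y)"
proof -
  obtain G where "\<And>x y. cinner (F x) y = cinner x (blinfun_apply G y)"
    using hilbert_adjoint_exists[OF assms] by blast
  with hilbert_adjoint_unique[of F G] show ?thesis
    by simp
qed

lemma cinner_adjoint':
  assumes "complex_linear F"
  shows "cinner ((F\<^sup>\<dagger>) x) y = cinner x (F y)"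
  using cinner_adjoint[OF assms, of y x] by (subst (1 2) cinner_commute) simp

lemma complex_linear_adjoint [complex_linear_intros]:
  "complex_linear F \<Longrightarrow> complex_linear (F\<^sup>\<dagger>)"
  unfolding complex_linear_def[of "F\<^sup>\<dagger>"]
  by (intro allI, rule cinner_eq_all_left) (simp add: cinner_adjoint' cinner_simps)

lemma adjoint_compose:
  "complex_linear F \<Longrightarrow> complex_linear G \<Longrightarrow> (F o\<^sub>L G)\<^sup>\<dagger> = G\<^sup>\<dagger> o\<^sub>L F\<^sup>\<dagger>"
  by (rule hilbert_adjoint_unique) (simp add: cinner_adjoint)

lemma adjoint_add:
  "complex_linear F \<Longrightarrow> complex_linear G \<Longrightarrow> (F + G)\<^sup>\<dagger> = F\<^sup>\<dagger> + G\<^sup>\<dagger>"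
  by (rule hilbert_adjoint_unique) (simp add: cinner_adjoint blinfun.bilinear_simps cinner_simps)

lemma adjoint_diff:
  "complex_linear F \<Longrightarrow> complex_linear G \<Longrightarrow> (F - G)\<^sup>\<dagger> = F\<^sup>\<dagger> - G\<^sup>\<dagger>"
  by (rule hilbert_adjoint_unique) (simp add: cinner_adjoint blinfun.bilinear_simps cinner_simps)

lemma adjoint_scaleC: "complex_linear F \<Longrightarrow> (c *\<^sub>C F)\<^sup>\<dagger> = cnj c *\<^sub>C F\<^sup>\<dagger>"
  by (rule hilbert_adjoint_unique) (simp add: cinner_adjoint cinner_simps)

lemma adjoint_scaleR: "complex_linear F \<Longrightarrow> (r *\<^sub>R F)\<^sup>\<dagger> = r *\<^sub>R F\<^sup>\<dagger>"
  by (rule hilbert_adjoint_unique) (simp add: cinner_adjoint blinfun.bilinear_simps cinner_simps)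

lemma adjoint_adjoint: "complex_linear F \<Longrightarrow> (F\<^sup>\<dagger>)\<^sup>\<dagger> = F"
  by (rule hilbert_adjoint_unique) (simp add: cinner_adjoint')

lemma adjoint_id: "(id_blinfun :: 'a::complex_hilbert \<Rightarrow>\<^sub>L 'a)\<^sup>\<dagger> = id_blinfun"
  by (rule hilbert_adjoint_unique) simp

lemma norm_adjoint_le: 
  assumes F: "complex_linear F"
  shows "norm (F\<^sup>\<dagger>) \<le> norm F"
proof (rule norm_blinfun_bound)
  fix y
  have "(norm ((F\<^sup>\<dagger>) y))\<^sup>2 = Re (cinner (F ((F\<^sup>\<dagger>) y)) y)"
    by (simp add: F cinner_adjoint power2_norm_eq_Re_cinner)
  also have "\<dots> \<le> norm (F ((F\<^sup>\<dagger>) y)) * norm y"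
    by (rule Re_cinner_le)
  also have "\<dots> \<le> norm F * norm ((F\<^sup>\<dagger>) y) * norm y"
    by (intro mult_right_mono norm_blinfun) simp
  finally show "norm ((F\<^sup>\<dagger>) y) \<le> norm F * norm y"
    by (cases "norm ((F\<^sup>\<dagger>) y) = 0") (simp_all add: power2_eq_square mult_ac)
qed simp

lemma compose_assoc:
  fixes F :: "'c::real_normed_vector \<Rightarrow>\<^sub>L 'd::real_normed_vector"
    and G :: "'b::real_normed_vector \<Rightarrow>\<^sub>L 'c" and H :: "'a::real_normed_vector \<Rightarrow>\<^sub>L 'b"
  shows "(F o\<^sub>L G) o\<^sub>L H = F o\<^sub>L (G o\<^sub>L H)"
  by (rule blinfun_eqI) simp

lemma compose_zero [simp]:
  fixes F :: "'b::real_normed_vector \<Rightarrow>\<^sub>L 'c::real_normed_vector"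
    and G :: "'a::real_normed_vector \<Rightarrow>\<^sub>L 'b"
  shows "(0 :: 'b \<Rightarrow>\<^sub>L 'c) o\<^sub>L G = 0" and "F o\<^sub>L (0 :: 'a \<Rightarrow>\<^sub>L 'b) = 0"
  by (rule blinfun_eqI, simp)+

lemma compose_id [simp]:
  fixes F :: "'a::real_normed_vector \<Rightarrow>\<^sub>L 'b::real_normed_vector"
  shows "id_blinfun o\<^sub>L F = F" and "F o\<^sub>L id_blinfun = F"
  by (rule blinfun_eqI, simp)+

lemmas blinfun_compose_distribs =
  bounded_bilinear.add_left[OF bounded_bilinear_blinfun_compose]
  bounded_bilinear.add_right[OF bounded_bilinear_blinfun_compose]
  bounded_bilinear.diff_left[OF bounded_bilinear_blinfun_compose]
  bounded_bilinear.diff_right[OF bounded_bilinear_blinfun_compose]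
  bounded_bilinear.minus_left[OF bounded_bilinear_blinfun_compose]
  bounded_bilinear.minus_right[OF bounded_bilinear_blinfun_compose]
  bounded_bilinear.scaleR_left[OF bounded_bilinear_blinfun_compose]
  bounded_bilinear.scaleR_right[OF bounded_bilinear_blinfun_compose]

lemma compose_scaleC_left:
  fixes F :: "'b::complex_hilbert \<Rightarrow>\<^sub>L 'c::complex_hilbert"
    and G :: "'a::complex_hilbert \<Rightarrow>\<^sub>L 'b"
  shows "(c *\<^sub>C F) o\<^sub>L G = c *\<^sub>C (F o\<^sub>L G)"
  by (rule blinfun_eqI) simp

lemma compose_scaleC_right:
  fixes F :: "'b::complex_hilbert \<Rightarrow>\<^sub>L 'c::complex_hilbert"
    and G :: "'a::complex_hilbert \<Rightarrow>\<^sub>L 'b"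
  assumes "complex_linear F"
  shows "F o\<^sub>L (c *\<^sub>C G) = c *\<^sub>C (F o\<^sub>L G)"
  by (rule blinfun_eqI) (simp add: assms complex_linear_apply)

lemmas scaleC_blinfun_distribs =
  bounded_bilinear.add_left[OF bounded_bilinear_scaleC_blinfun]
  bounded_bilinear.add_right[OF bounded_bilinear_scaleC_blinfun]
  bounded_bilinear.diff_left[OF bounded_bilinear_scaleC_blinfun]
  bounded_bilinear.diff_right[OF bounded_bilinear_scaleC_blinfun]
  bounded_bilinear.minus_left[OF bounded_bilinear_scaleC_blinfun]
  bounded_bilinear.minus_right[OF bounded_bilinear_scaleC_blinfun]

section \<open>Operator-valued holomorphic functions\<close>

text \<open>The derivative is a real Frechet derivative of the special form \<open>h \<mapsto> h F'\<close>, so that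
  the product rules for bounded bilinear maps apply as they stand.\<close>

definition op_holomorphic ::
    "(complex \<Rightarrow> 'a::complex_hilbert \<Rightarrow>\<^sub>L 'b::complex_hilbert) \<Rightarrow> complex set \<Rightarrow> bool" where
  "op_holomorphic F D \<longleftrightarrow> (\<forall>z\<in>D. complex_linear (F z) \<and>
     (\<exists>F'. complex_linear F' \<and> (F has_derivative (\<lambda>h. h *\<^sub>C F')) (at z)))"

lemma op_holomorphic_linear: "op_holomorphic F D \<Longrightarrow> z \<in> D \<Longrightarrow> complex_linear (F z)"
  unfolding op_holomorphic_def by blast

lemma op_holomorphic_const: "complex_linear A \<Longrightarrow> op_holomorphic (\<lambda>z. A) D"
  unfolding op_holomorphic_def
  by (auto intro!: exI[of _ 0] complex_linear_zero derivative_eq_intros)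

lemma op_holomorphic_add:
  assumes "op_holomorphic F D" "op_holomorphic G D"
  shows "op_holomorphic (\<lambda>z. F z + G z) D"
  unfolding op_holomorphic_def
proof (intro ballI conjI)
  fix z assume z: "z \<in> D"
  obtain F' G' where "complex_linear F'" "(F has_derivative (\<lambda>h. h *\<^sub>C F')) (at z)"
    "complex_linear G'" "(G has_derivative (\<lambda>h. h *\<^sub>C G')) (at z)"
    using assms z unfolding op_holomorphic_def by blast
  then show "\<exists>H. complex_linear H \<and> ((\<lambda>z. F z + G z) has_derivative (\<lambda>h. h *\<^sub>C H)) (at z)"
    by (intro exI[of _ "F' + G'"])
      (auto intro!: complex_linear_intros has_derivative_eq_rhs[OF has_derivative_add]
        simp: scaleC_blinfun_distribs)
qed (use assms in \<open>auto intro!: complex_linear_intros simp: op_holomorphic_linear\<close>)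

lemma op_holomorphic_compose:
  assumes "op_holomorphic F D" "op_holomorphic G D"
  shows "op_holomorphic (\<lambda>z. F z o\<^sub>L G z) D"
  unfolding op_holomorphic_def
proof (intro ballI conjI)
  fix z assume z: "z \<in> D"
  obtain F' G' where F': "complex_linear F'" "(F has_derivative (\<lambda>h. h *\<^sub>C F')) (at z)"
    and G': "complex_linear G'" "(G has_derivative (\<lambda>h. h *\<^sub>C G')) (at z)"
    using assms z unfolding op_holomorphic_def by blast
  have lin: "complex_linear (F z)" "complex_linear (G z)"
    using assms z by (simp_all add: op_holomorphic_linear)
  have "((\<lambda>z. F z o\<^sub>L G z) has_derivative (\<lambda>h. h *\<^sub>C ((F z o\<^sub>L G') + (F' o\<^sub>L G z)))) (at z)"
    by (rule has_derivative_eq_rhs[OF bounded_bilinear.FDERIV[OF bounded_bilinear_blinfun_compose F'(2) G'(2)]])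
      (simp add: compose_scaleC_left compose_scaleC_right lin scaleC_blinfun_distribs)
  then show "\<exists>H. complex_linear H \<and> ((\<lambda>z. F z o\<^sub>L G z) has_derivative (\<lambda>h. h *\<^sub>C H)) (at z)"
    using F' G' lin by (intro exI[of _ "(F z o\<^sub>L G') + (F' o\<^sub>L G z)"] conjI complex_linear_intros)
qed (use assms in \<open>auto intro!: complex_linear_intros simp: op_holomorphic_linear\<close>)

lemma op_holomorphic_scaleC:
  assumes "open D" "f holomorphic_on D" "op_holomorphic F D"
  shows "op_holomorphic (\<lambda>z. f z *\<^sub>C F z) D"
  unfolding op_holomorphic_def
proof (intro ballI conjI)
  fix z assume z: "z \<in> D"
  obtain F' where F': "complex_linear F'" "(F has_derivative (\<lambda>h. h *\<^sub>C F')) (at z)"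
    using assms z unfolding op_holomorphic_def by blast
  obtain f' where f': "(f has_derivative (\<lambda>h. f' * h)) (at z)"
    using holomorphic_derivI[OF assms(2,1) z] unfolding has_field_derivative_def by blast
  have lin: "complex_linear (F z)"
    using assms z by (simp add: op_holomorphic_linear)
  have "((\<lambda>z. f z *\<^sub>C F z) has_derivative (\<lambda>h. h *\<^sub>C (f z *\<^sub>C F' + f' *\<^sub>C F z))) (at z)"
    by (rule has_derivative_eq_rhs[OF bounded_bilinear.FDERIV[OF bounded_bilinear_scaleC_blinfun f' F'(2)]])
      (simp add: scaleC_blinfun_distribs mult.commute)
  then show "\<exists>H. complex_linear H \<and> ((\<lambda>z. f z *\<^sub>C F z) has_derivative (\<lambda>h. h *\<^sub>C H)) (at z)"
    using F' lin by (intro exI[of _ "f z *\<^sub>C F' + f' *\<^sub>C F z"] conjI complex_linear_intros)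
qed (use assms in \<open>auto intro!: complex_linear_intros simp: op_holomorphic_linear\<close>)

lemma op_holomorphic_continuous_on:
  assumes "op_holomorphic F D"
  shows "continuous_on D F"
  using assms unfolding op_holomorphic_def
  by (meson continuous_at_imp_continuous_on has_derivative_continuous)

lemma cinner_op_holomorphic:
  assumes "op_holomorphic F D"
  shows "(\<lambda>z. cinner (F z x) y) holomorphic_on D"
proof (rule holomorphic_onI)
  fix z assume "z \<in> D"
  then obtain F' where F': "(F has_derivative (\<lambda>h. h *\<^sub>C F')) (at z)"
    using assms unfolding op_holomorphic_def by blast
  have bl: "bounded_linear (\<lambda>X :: 'a \<Rightarrow>\<^sub>L 'b. cinner (X x) y)"
    by (rule bounded_linear_compose[OF bounded_bilinear.bounded_linear_left[OF bounded_bilinear_cinner]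
          blinfun.bounded_linear_left])
  have "((\<lambda>z. cinner (F z x) y) has_derivative (\<lambda>h. cinner ((h *\<^sub>C F') x) y)) (at z)"
    by (rule bounded_linear.has_derivative[OF bl F'])
  then have "((\<lambda>z. cinner (F z x) y) has_field_derivative cinner (F' x) y) (at z)"
    unfolding has_field_derivative_def by (simp add: cinner_simps mult_commute_abs)
  then show "(\<lambda>z. cinner (F z x) y) field_differentiable at z within D"
    using field_differentiable_at_within field_differentiable_def by blast
qed


section \<open>Circle integrals of operator-valued functions\<close>

text \<open>The sign is that of the Riesz projection: the value picks out the coefficient of
  \<open>(\<mu> - z)\<^sup>-\<^sup>1\<close>, not that of \<open>(z - \<mu>)\<^sup>-\<^sup>1\<close>.\<close>

definition circle_residue ::
    "complex \<Rightarrow> real \<Rightarrow> (complex \<Rightarrow> 'a::complex_hilbert \<Rightarrow>\<^sub>L 'b::complex_hilbert) \<Rightarrow> 'a \<Rightarrow>\<^sub>L 'b" where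
  "circle_residue \<mu> r F =
     (- 1 / (2 * complex_of_real pi * \<i>)) *\<^sub>C vector_contour_integral (circlepath \<mu> r) F"

abbreviation circle_integrand ::
    "complex \<Rightarrow> real \<Rightarrow> (complex \<Rightarrow> 'a::complex_hilbert \<Rightarrow>\<^sub>L 'b::complex_hilbert) \<Rightarrow> real \<Rightarrow> 'a \<Rightarrow>\<^sub>L 'b" where
  "circle_integrand \<mu> r F \<equiv> \<lambda>x. vector_derivative (circlepath \<mu> r) (at x within {0..1}) *\<^sub>C F (circlepath \<mu> r x)"

lemma circlepath_in_sphere: "0 \<le> r \<Longrightarrow> t \<in> {0..1} \<Longrightarrow> circlepath \<mu> r t \<in> sphere \<mu> r"
  using path_image_circlepath_nonneg[of r \<mu>] unfolding path_image_def by blast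

lemma circle_integrand_integrable:
  assumes r: "0 \<le> r" and F: "continuous_on (sphere \<mu> r) F"
  shows "circle_integrand \<mu> r F integrable_on {0..1}"
proof (rule integrable_continuous_real)
  have "continuous_on {0..1} (\<lambda>x. F (circlepath \<mu> r x))"
  proof (rule continuous_on_compose2[OF F])
    show "continuous_on {0..1} (circlepath \<mu> r)"
      using valid_path_circlepath valid_path_imp_path path_def by blast
    show "circlepath \<mu> r ` {0..1} \<subseteq> sphere \<mu> r"
      using r path_image_circlepath[of \<mu> r] by (simp add: path_image_def)
  qed
  then have "continuous_on {0..1}
      (\<lambda>x. (2 * complex_of_real pi * \<i> * complex_of_real r * exp (2 * of_real pi * \<i> * of_real x)) *\<^sub>C F (circlepath \<mu> r x))"
    by (intro bounded_bilinear.continuous_on[OF bounded_bilinear_scaleC_blinfun] continuous_intros)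
  then show "continuous_on {0..1} (circle_integrand \<mu> r F)"
    by (rule continuous_on_eq) (simp add: vector_derivative_circlepath01)
qed

lemma circle_residue_add:
  assumes "0 \<le> r" "continuous_on (sphere \<mu> r) F" "continuous_on (sphere \<mu> r) G"
  shows "circle_residue \<mu> r (\<lambda>z. F z + G z) = circle_residue \<mu> r F + circle_residue \<mu> r G"
  using assms unfolding circle_residue_def vector_contour_integral_def
  by (simp add: scaleC_blinfun_distribs integral_add circle_integrand_integrable)

lemma circle_residue_diff:
  assumes "0 \<le> r" "continuous_on (sphere \<mu> r) F" "continuous_on (sphere \<mu> r) G"
  shows "circle_residue \<mu> r (\<lambda>z. F z - G z) = circle_residue \<mu> r F - circle_residue \<mu> r G"
  using assms unfolding circle_residue_def vector_contour_integral_def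
  by (simp add: scaleC_blinfun_distribs integral_diff circle_integrand_integrable)

lemma circle_residue_scaleR:
  shows "circle_residue \<mu> r (\<lambda>z. a *\<^sub>R F z) = a *\<^sub>R circle_residue \<mu> r F"
  unfolding circle_residue_def vector_contour_integral_def
  by (simp add: bounded_bilinear.scaleR_right[OF bounded_bilinear_scaleC_blinfun])

lemma circle_residue_cong:
  assumes "0 \<le> r" "\<And>z. z \<in> sphere \<mu> r \<Longrightarrow> F z = G z"
  shows "circle_residue \<mu> r F = circle_residue \<mu> r G"
proof -
  have "circlepath \<mu> r x \<in> sphere \<mu> r" if "x \<in> {0..1}" for x
    using assms(1) that by (rule circlepath_in_sphere)
  then show ?thesis
    unfolding circle_residue_def vector_contour_integral_def
    by (intro arg_cong2[of _ _ _ _ "(*\<^sub>C)"] integral_cong) (auto simp: assms(2))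
qed

lemma norm_circle_residue_le:
  assumes r: "0 \<le> r" and F: "continuous_on (sphere \<mu> r) F"
    and B: "\<And>z. z \<in> sphere \<mu> r \<Longrightarrow> norm (F z) \<le> B"
  shows "norm (circle_residue \<mu> r F) \<le> r * B"
proof -
  have "norm (vector_contour_integral (circlepath \<mu> r) F) \<le> integral {0..1} (\<lambda>x::real. 2 * pi * r * B)"
    unfolding vector_contour_integral_def
  proof (rule integral_norm_bound_integral[OF circle_integrand_integrable[OF r F]])
    fix x :: real assume x: "x \<in> {0..1}"
    then have "circlepath \<mu> r x \<in> sphere \<mu> r"
      using r by (intro circlepath_in_sphere)
    then have "norm (F (circlepath \<mu> r x)) \<le> B"
      by (rule B)
    moreover have "cmod (vector_derivative (circlepath \<mu> r) (at x within {0..1})) = 2 * pi * r"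
      using x r by (simp add: vector_derivative_circlepath01 norm_mult)
    ultimately show "norm (circle_integrand \<mu> r F x) \<le> 2 * pi * r * B"
      using r by (intro order_trans[OF norm_scaleC_blinfun]) (simp add: mult_left_mono)
  qed (rule integrable_const_ivl)
  then have v: "norm (vector_contour_integral (circlepath \<mu> r) F) \<le> 2 * pi * r * B"
    by simp
  have "norm (circle_residue \<mu> r F) \<le> 1 / (2 * pi) * norm (vector_contour_integral (circlepath \<mu> r) F)"
    unfolding circle_residue_def
    by (rule order_trans[OF norm_scaleC_blinfun]) (simp add: norm_divide norm_mult)
  also have "\<dots> \<le> 1 / (2 * pi) * (2 * pi * r * B)"
    using v by (intro mult_left_mono) auto
  finally show ?thesis
    by simp
qed

lemma circle_residue_apply:
  assumes "0 \<le> r" "continuous_on (sphere \<mu> r) F"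
  shows "circle_residue \<mu> r F x = (- 1 / (2 * complex_of_real pi * \<i>)) *\<^sub>C
    integral {0..1} (\<lambda>t. circle_integrand \<mu> r F t x)"
  unfolding circle_residue_def vector_contour_integral_def
  using integral_linear[OF circle_integrand_integrable[OF assms] blinfun.bounded_linear_left[of x]]
  by (simp add: o_def)

lemma complex_linear_circle_residue:
  assumes "0 \<le> r" "continuous_on (sphere \<mu> r) F"
    and lin: "\<And>z. z \<in> sphere \<mu> r \<Longrightarrow> complex_linear (F z)"
  shows "complex_linear (circle_residue \<mu> r F)"
  unfolding complex_linear_def
proof (intro allI)
  fix c x
  have bl: "bounded_linear (\<lambda>y :: 'b. c *\<^sub>C y)"
    by (rule bounded_bilinear.bounded_linear_right[OF bounded_bilinear_scaleC])
  have int: "(\<lambda>t. circle_integrand \<mu> r F t x) integrable_on {0..1}"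
    using integrable_linear[OF circle_integrand_integrable[OF assms(1,2)] blinfun.bounded_linear_left[of x]]
    by (simp add: o_def)
  have "circlepath \<mu> r t \<in> sphere \<mu> r" if "t \<in> {0..1}" for t
    using assms(1) that by (rule circlepath_in_sphere)
  then have "integral {0..1} (\<lambda>t. circle_integrand \<mu> r F t (c *\<^sub>C x))
      = integral {0..1} (\<lambda>t. c *\<^sub>C circle_integrand \<mu> r F t x)"
    by (intro integral_cong) (simp add: lin complex_linear_apply scaleC_scaleC mult.commute)
  also have "\<dots> = c *\<^sub>C integral {0..1} (\<lambda>t. circle_integrand \<mu> r F t x)"
    using integral_linear[OF int bl] by (simp add: o_def)
  finally show "circle_residue \<mu> r F (c *\<^sub>C x) = c *\<^sub>C circle_residue \<mu> r F x"
    by (simp only: circle_residue_apply[OF assms(1,2)] scaleC_scaleC mult.commute)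
qed

text \<open>Testing with \<open>\<langle>\<cdot> x, y\<rangle>\<close> reduces operator-valued contour integrals to scalar ones.\<close>

lemma circle_residue_eqI:
  fixes F :: "complex \<Rightarrow> 'a::complex_hilbert \<Rightarrow>\<^sub>L 'b::complex_hilbert" and C :: "'a \<Rightarrow>\<^sub>L 'b"
  assumes r: "0 \<le> r" and F: "continuous_on (sphere \<mu> r) F"
    and hci: "\<And>x y. ((\<lambda>z. cinner (F z x) y) has_contour_integral - (2 * complex_of_real pi * \<i>) * cinner (C x) y)
      (circlepath \<mu> r)"
  shows "circle_residue \<mu> r F = C"
proof (intro blinfun_eqI, rule cinner_eq_all_left)
  fix x y
  have bl: "bounded_linear (\<lambda>X :: 'a \<Rightarrow>\<^sub>L 'b. cinner (X x) y)"
    by (rule bounded_linear_compose[OF bounded_bilinear.bounded_linear_left[OF bounded_bilinear_cinner]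
          blinfun.bounded_linear_left])
  have "cinner (vector_contour_integral (circlepath \<mu> r) F x) y
      = integral {0..1} (\<lambda>t. cinner (circle_integrand \<mu> r F t x) y)"
    unfolding vector_contour_integral_def
    using integral_linear[OF circle_integrand_integrable[OF r F] bl] by (simp add: o_def)
  also have "\<dots> = - (2 * complex_of_real pi * \<i>) * cinner (C x) y"
    using hci[of x y] unfolding has_contour_integral_def
    by (intro integral_unique) (simp add: cinner_simps mult.commute)
  finally show "cinner (circle_residue \<mu> r F x) y = cinner (C x) y"
    by (simp add: circle_residue_def cinner_simps)
qed

lemma contour_integral_inverse_power:
  assumes r: "0 < r"
  shows "((\<lambda>z. \<alpha> / (\<mu> - z) ^ Suc k) has_contour_integral (if k = 0 then - (2 * complex_of_real pi * \<i>) * \<alpha> else 0))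
    (circlepath \<mu> r)"
proof -
  have "((\<lambda>z. ((- 1) ^ Suc k * \<alpha>) / (z - \<mu>) ^ Suc k) has_contour_integral
      (2 * complex_of_real pi * \<i> / fact k * (deriv ^^ k) (\<lambda>z. (- 1) ^ Suc k * \<alpha>) \<mu>)) (circlepath \<mu> r)"
    using r Cauchy_has_contour_integral_higher_derivative_circlepath
      [of \<mu> r "\<lambda>z. (- 1) ^ Suc k * \<alpha>" \<mu> k] by (simp add: mult_ac)
  moreover have "((- 1) ^ Suc k * \<alpha>) / (z - \<mu>) ^ Suc k = \<alpha> / (\<mu> - z) ^ Suc k" for z
  proof -
    have "(\<mu> - z) ^ Suc k = (- 1) ^ Suc k * (z - \<mu>) ^ Suc k"
      by (metis minus_diff_eq mult_minus1 power_mult_distrib)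
    moreover have "((- 1) ^ Suc k :: complex) * (- 1) ^ Suc k = 1"
      by (simp flip: power_mult_distrib)
    ultimately show ?thesis
      by (cases "z = \<mu>") (auto simp: divide_simps)
  qed
  ultimately show ?thesis
    by (cases "k = 0") (simp_all add: higher_deriv_const)
qed

lemma circle_residue_laurent:
  assumes r: "0 < r" "r < d" and H: "op_holomorphic H (ball \<mu> d)"
    and F: "\<And>z. z \<in> sphere \<mu> r \<Longrightarrow>
      F z = (1 / (\<mu> - z) ^ 3) *\<^sub>C A + (1 / (\<mu> - z) ^ 2) *\<^sub>C B + (1 / (\<mu> - z)) *\<^sub>C C + H z"
  shows "continuous_on (sphere \<mu> r) F" and "circle_residue \<mu> r F = C"
proof -
  have sub: "sphere \<mu> r \<subseteq> ball \<mu> d"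
    using r by auto
  have "continuous_on (sphere \<mu> r) H"
    using op_holomorphic_continuous_on[OF H] sub continuous_on_subset by blast
  moreover have nz: "\<mu> - z \<noteq> 0" if "z \<in> sphere \<mu> r" for z
    using that r by auto
  ultimately have "continuous_on (sphere \<mu> r) (\<lambda>z. (1 / (\<mu> - z) ^ 3) *\<^sub>C A
      + (1 / (\<mu> - z) ^ 2) *\<^sub>C B + (1 / (\<mu> - z)) *\<^sub>C C + H z)"
    by (intro bounded_bilinear.continuous_on[OF bounded_bilinear_scaleC_blinfun] continuous_intros)
      (auto simp: power_eq_0_iff)
  then show cont: "continuous_on (sphere \<mu> r) F"
    by (rule continuous_on_eq) (simp add: F)
  show "circle_residue \<mu> r F = C"
  proof (rule circle_residue_eqI[OF less_imp_le[OF r(1)] cont])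
    fix x y
    have "((\<lambda>z. cinner (H z x) y) has_contour_integral 0) (circlepath \<mu> r)"
    proof (rule Cauchy_theorem_disc_simple[OF cinner_op_holomorphic[OF H]])
      show "path_image (circlepath \<mu> r) \<subseteq> ball \<mu> d"
        using r sub by (simp add: path_image_circlepath)
    qed simp_all
    from has_contour_integral_add[OF has_contour_integral_add[OF has_contour_integral_add[OF
      contour_integral_inverse_power[OF r(1), of "cinner (A x) y" \<mu> 2]
      contour_integral_inverse_power[OF r(1), of "cinner (B x) y" \<mu> 1]]
      contour_integral_inverse_power[OF r(1), of "cinner (C x) y" \<mu> 0]] this]
    have "((\<lambda>z. cinner (A x) y / (\<mu> - z) ^ 3 + cinner (B x) y / (\<mu> - z) ^ 2 + cinner (C x) y / (\<mu> - z)
        + cinner (H z x) y) has_contour_integral - (2 * complex_of_real pi * \<i>) * cinner (C x) y) (circlepath \<mu> r)"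
      by (simp add: numeral_2_eq_2 numeral_3_eq_3)
    then show "((\<lambda>z. cinner (F z x) y) has_contour_integral - (2 * complex_of_real pi * \<i>) * cinner (C x) y) (circlepath \<mu> r)"
    proof (rule has_contour_integral_eq)
      fix z assume "z \<in> path_image (circlepath \<mu> r)"
      then have "z \<in> sphere \<mu> r"
        using r by (simp add: path_image_circlepath)
      then show "cinner (A x) y / (\<mu> - z) ^ 3 + cinner (B x) y / (\<mu> - z) ^ 2 + cinner (C x) y / (\<mu> - z)
          + cinner (H z x) y = cinner (F z x) y"
        by (simp add: F blinfun.bilinear_simps cinner_simps)
    qed
  qed
qed

text \<open>Second-order Taylor expansion in \<open>\<mu> - z\<close> of a function that is holomorphic up to a removable
  singularity at \<open>\<mu>\<close>. Laurent expansions of functions with a pole at \<open>\<mu>\<close> are handled by multiplying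
  with a power of \<open>\<mu> - z\<close>.\<close>

definition expansion :: "complex \<Rightarrow> complex set \<Rightarrow>
    (complex \<Rightarrow> 'a::complex_hilbert \<Rightarrow>\<^sub>L 'b::complex_hilbert) \<Rightarrow>
    ('a \<Rightarrow>\<^sub>L 'b) \<Rightarrow> ('a \<Rightarrow>\<^sub>L 'b) \<Rightarrow> ('a \<Rightarrow>\<^sub>L 'b) \<Rightarrow> bool" where
  "expansion \<mu> D F a b c \<longleftrightarrow> complex_linear a \<and> complex_linear b \<and> complex_linear c \<and>
     (\<exists>H. op_holomorphic H D \<and> (\<forall>z\<in>D - {\<mu>}.
        F z = a + (\<mu> - z) *\<^sub>C b + (\<mu> - z) ^ 2 *\<^sub>C c + (\<mu> - z) ^ 3 *\<^sub>C H z))"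

lemma expansion_const: "complex_linear A \<Longrightarrow> expansion \<mu> D (\<lambda>z. A) A 0 0"
  unfolding expansion_def
  by (auto intro!: exI[of _ "\<lambda>z. 0"] complex_linear_intros op_holomorphic_const)

lemma expansion_add:
  assumes "expansion \<mu> D F a b c" "expansion \<mu> D G a' b' c'"
  shows "expansion \<mu> D (\<lambda>z. F z + G z) (a + a') (b + b') (c + c')"
proof -
  obtain H H' where "op_holomorphic H D" "op_holomorphic H' D"
    "\<forall>z\<in>D - {\<mu>}. F z = a + (\<mu> - z) *\<^sub>C b + (\<mu> - z) ^ 2 *\<^sub>C c + (\<mu> - z) ^ 3 *\<^sub>C H z"
    "\<forall>z\<in>D - {\<mu>}. G z = a' + (\<mu> - z) *\<^sub>C b' + (\<mu> - z) ^ 2 *\<^sub>C c' + (\<mu> - z) ^ 3 *\<^sub>C H' z"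
    using assms unfolding expansion_def by blast
  then show ?thesis
    using assms unfolding expansion_def
    by (auto intro!: exI[of _ "\<lambda>z. H z + H' z"] op_holomorphic_add complex_linear_intros
        simp: scaleC_blinfun_distribs)
qed

lemma expansion_compose:
  assumes "open D" and F: "expansion \<mu> D F a b c" and G: "expansion \<mu> D G a' b' c'"
  shows "expansion \<mu> D (\<lambda>z. F z o\<^sub>L G z) (a o\<^sub>L a') ((a o\<^sub>L b') + (b o\<^sub>L a'))
    ((a o\<^sub>L c') + (b o\<^sub>L b') + (c o\<^sub>L a'))"
proof -
  obtain H H' where H: "op_holomorphic H D" and H': "op_holomorphic H' D"
    and Fz: "\<And>z. z \<in> D - {\<mu>} \<Longrightarrow> F z = a + (\<mu> - z) *\<^sub>C b + (\<mu> - z) ^ 2 *\<^sub>C c + (\<mu> - z) ^ 3 *\<^sub>C H z"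
    and Gz: "\<And>z. z \<in> D - {\<mu>} \<Longrightarrow> G z = a' + (\<mu> - z) *\<^sub>C b' + (\<mu> - z) ^ 2 *\<^sub>C c' + (\<mu> - z) ^ 3 *\<^sub>C H' z"
    using F G unfolding expansion_def by blast
  have lin: "complex_linear a" "complex_linear b" "complex_linear c"
    "complex_linear a'" "complex_linear b'" "complex_linear c'"
    using F G unfolding expansion_def by blast+
  define R where "R = (\<lambda>z. (b o\<^sub>L c') + (c o\<^sub>L b') + (\<mu> - z) *\<^sub>C (c o\<^sub>L c')
     + ((a + (\<mu> - z) *\<^sub>C b + (\<mu> - z) ^ 2 *\<^sub>C c) o\<^sub>L H' z)
     + (H z o\<^sub>L (a' + (\<mu> - z) *\<^sub>C b' + (\<mu> - z) ^ 2 *\<^sub>C c' + (\<mu> - z) ^ 3 *\<^sub>C H' z)))"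
  have "op_holomorphic R D"
    unfolding R_def using assms(1) lin H H'
    by (intro op_holomorphic_add op_holomorphic_compose op_holomorphic_scaleC op_holomorphic_const
        complex_linear_intros holomorphic_intros)
  moreover have "F z o\<^sub>L G z = (a o\<^sub>L a') + (\<mu> - z) *\<^sub>C ((a o\<^sub>L b') + (b o\<^sub>L a'))
      + (\<mu> - z) ^ 2 *\<^sub>C ((a o\<^sub>L c') + (b o\<^sub>L b') + (c o\<^sub>L a')) + (\<mu> - z) ^ 3 *\<^sub>C R z"
    if z: "z \<in> D - {\<mu>}" for z
  proof -
    have "complex_linear (H z)"
      using H z by (simp add: op_holomorphic_linear)
    moreover define w where "w = \<mu> - z"
    ultimately show ?thesis
      unfolding Fz[OF z] Gz[OF z] R_def w_def[symmetric]
      by (simp add: blinfun_compose_distribs scaleC_blinfun_distribs compose_scaleC_left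
          compose_scaleC_right lin power2_eq_square power3_eq_cube mult_ac)
  qed
  ultimately show ?thesis
    unfolding expansion_def using lin by (auto intro!: complex_linear_intros)
qed

lemma expansion_scalar:
  assumes "open D" and F: "expansion \<mu> D F a b c"
  shows "expansion \<mu> D (\<lambda>z. (\<alpha> + \<beta> * (\<mu> - z)) *\<^sub>C F z) (\<alpha> *\<^sub>C a) (\<alpha> *\<^sub>C b + \<beta> *\<^sub>C a) (\<alpha> *\<^sub>C c + \<beta> *\<^sub>C b)"
proof -
  have lin: "complex_linear a" "complex_linear b" "complex_linear c"
    using F unfolding expansion_def by blast+
  obtain H where H: "op_holomorphic H D"
    and Fz: "\<And>z. z \<in> D - {\<mu>} \<Longrightarrow> F z = a + (\<mu> - z) *\<^sub>C b + (\<mu> - z) ^ 2 *\<^sub>C c + (\<mu> - z) ^ 3 *\<^sub>C H z"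
    using F unfolding expansion_def by blast
  define R where "R = (\<lambda>z. \<beta> *\<^sub>C c + (\<alpha> + \<beta> * (\<mu> - z)) *\<^sub>C H z)"
  have "op_holomorphic R D"
    unfolding R_def using assms(1) lin H
    by (intro op_holomorphic_add op_holomorphic_scaleC op_holomorphic_const
        complex_linear_intros holomorphic_intros)
  moreover have "(\<alpha> + \<beta> * (\<mu> - z)) *\<^sub>C F z = \<alpha> *\<^sub>C a + (\<mu> - z) *\<^sub>C (\<alpha> *\<^sub>C b + \<beta> *\<^sub>C a)
      + (\<mu> - z) ^ 2 *\<^sub>C (\<alpha> *\<^sub>C c + \<beta> *\<^sub>C b) + (\<mu> - z) ^ 3 *\<^sub>C R z"
    if z: "z \<in> D - {\<mu>}" for z
  proof -
    define w where "w = \<mu> - z"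
    show ?thesis
      unfolding Fz[OF z] R_def w_def[symmetric]
      by (simp add: scaleC_blinfun_distribs power2_eq_square power3_eq_cube ring_distribs mult_ac)
  qed
  ultimately show ?thesis
    unfolding expansion_def using lin by (auto intro!: complex_linear_intros)
qed

lemma circle_residue_expansion:
  assumes r: "0 < r" "r < d" and F: "expansion \<mu> (ball \<mu> d) F a b c"
  shows circle_residue_expansion3: "circle_residue \<mu> r (\<lambda>z. (1 / (\<mu> - z) ^ 3) *\<^sub>C F z) = c"
    and circle_residue_expansion2: "circle_residue \<mu> r (\<lambda>z. (1 / (\<mu> - z) ^ 2) *\<^sub>C F z) = b"
    and circle_residue_expansion1: "circle_residue \<mu> r (\<lambda>z. (1 / (\<mu> - z)) *\<^sub>C F z) = a"
proof -
  have lin: "complex_linear a" "complex_linear b" "complex_linear c"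
    using F unfolding expansion_def by blast+
  obtain H where H: "op_holomorphic H (ball \<mu> d)"
    and Fz: "\<And>z. z \<in> ball \<mu> d - {\<mu>} \<Longrightarrow> F z = a + (\<mu> - z) *\<^sub>C b + (\<mu> - z) ^ 2 *\<^sub>C c + (\<mu> - z) ^ 3 *\<^sub>C H z"
    using F unfolding expansion_def by blast
  have Fz: "F z = a + (\<mu> - z) *\<^sub>C b + (\<mu> - z) ^ 2 *\<^sub>C c + (\<mu> - z) ^ 3 *\<^sub>C H z" and nz: "\<mu> - z \<noteq> 0"
    if "z \<in> sphere \<mu> r" for z
    using Fz[of z] that r by auto
  show "circle_residue \<mu> r (\<lambda>z. (1 / (\<mu> - z) ^ 3) *\<^sub>C F z) = c"
  proof (rule circle_residue_laurent(2)[OF r H])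
    fix z assume z: "z \<in> sphere \<mu> r"
    define w where "w = \<mu> - z"
    have "w \<noteq> 0"
      using nz[OF z] by (simp add: w_def)
    then show "(1 / (\<mu> - z) ^ 3) *\<^sub>C F z = (1 / (\<mu> - z) ^ 3) *\<^sub>C a + (1 / (\<mu> - z) ^ 2) *\<^sub>C b
        + (1 / (\<mu> - z)) *\<^sub>C c + H z"
      unfolding Fz[OF z] w_def[symmetric]
      by (simp add: scaleC_blinfun_distribs power2_eq_square power3_eq_cube)
  qed
  show "circle_residue \<mu> r (\<lambda>z. (1 / (\<mu> - z) ^ 2) *\<^sub>C F z) = b"
  proof (rule circle_residue_laurent(2)[OF r])
    show "op_holomorphic (\<lambda>z. c + (\<mu> - z) *\<^sub>C H z) (ball \<mu> d)"
      using H lin by (intro op_holomorphic_add op_holomorphic_scaleC op_holomorphic_const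
          complex_linear_intros holomorphic_intros) auto
    fix z assume z: "z \<in> sphere \<mu> r"
    define w where "w = \<mu> - z"
    have "w \<noteq> 0"
      using nz[OF z] by (simp add: w_def)
    then show "(1 / (\<mu> - z) ^ 2) *\<^sub>C F z = (1 / (\<mu> - z) ^ 3) *\<^sub>C 0 + (1 / (\<mu> - z) ^ 2) *\<^sub>C a
        + (1 / (\<mu> - z)) *\<^sub>C b + (c + (\<mu> - z) *\<^sub>C H z)"
      unfolding Fz[OF z] w_def[symmetric]
      by (simp add: scaleC_blinfun_distribs power2_eq_square power3_eq_cube)
  qed
  show "circle_residue \<mu> r (\<lambda>z. (1 / (\<mu> - z)) *\<^sub>C F z) = a"
  proof (rule circle_residue_laurent(2)[OF r])
    show "op_holomorphic (\<lambda>z. b + (\<mu> - z) *\<^sub>C c + (\<mu> - z) ^ 2 *\<^sub>C H z) (ball \<mu> d)"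
      using H lin by (intro op_holomorphic_add op_holomorphic_scaleC op_holomorphic_const
          complex_linear_intros holomorphic_intros) auto
    fix z assume z: "z \<in> sphere \<mu> r"
    define w where "w = \<mu> - z"
    have "w \<noteq> 0"
      using nz[OF z] by (simp add: w_def)
    then show "(1 / (\<mu> - z)) *\<^sub>C F z = (1 / (\<mu> - z) ^ 3) *\<^sub>C 0 + (1 / (\<mu> - z) ^ 2) *\<^sub>C 0
        + (1 / (\<mu> - z)) *\<^sub>C a + (b + (\<mu> - z) *\<^sub>C c + (\<mu> - z) ^ 2 *\<^sub>C H z)"
      unfolding Fz[OF z] w_def[symmetric]
      by (simp add: scaleC_blinfun_distribs power2_eq_square power3_eq_cube)
  qed
qed

section \<open>Resolvents of self-adjoint operators\<close>

text \<open>The resolvent identity alone gives holomorphy and commutativity. The notion is separated from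
  resolvents because the reduced resolvent satisfies the identity on a full neighbourhood of the
  eigenvalue.\<close>

definition pseudo_resolvent ::
    "(complex \<Rightarrow> 'a::complex_hilbert \<Rightarrow>\<^sub>L 'a) \<Rightarrow> complex set \<Rightarrow> bool" where
  "pseudo_resolvent F D \<longleftrightarrow> (\<forall>z\<in>D. complex_linear (F z)) \<and>
     (\<forall>z\<in>D. \<forall>w\<in>D. F z - F w = (z - w) *\<^sub>C (F z o\<^sub>L F w))"

lemma pseudo_resolvent_linear: "pseudo_resolvent F D \<Longrightarrow> z \<in> D \<Longrightarrow> complex_linear (F z)"
  unfolding pseudo_resolvent_def by blast

lemma pseudo_resolvent_diff:
  "pseudo_resolvent F D \<Longrightarrow> z \<in> D \<Longrightarrow> w \<in> D \<Longrightarrow> F z - F w = (z - w) *\<^sub>C (F z o\<^sub>L F w)"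
  unfolding pseudo_resolvent_def by blast

lemma pseudo_resolvent_subset: "pseudo_resolvent F D \<Longrightarrow> E \<subseteq> D \<Longrightarrow> pseudo_resolvent F E"
  unfolding pseudo_resolvent_def by blast

lemma pseudo_resolvent_commute:
  assumes F: "pseudo_resolvent F D" and z: "z \<in> D" and w: "w \<in> D"
  shows "F z o\<^sub>L F w = F w o\<^sub>L F z"
proof (cases "z = w")
  case False
  have "(z - w) *\<^sub>C (F z o\<^sub>L F w) = - ((w - z) *\<^sub>C (F w o\<^sub>L F z))"
    using pseudo_resolvent_diff[OF F z w] pseudo_resolvent_diff[OF F w z] by (metis minus_diff_eq)
  also have "\<dots> = (z - w) *\<^sub>C (F w o\<^sub>L F z)"
    by (simp flip: scaleC_blinfun_distribs(5))
  finally have "(1 / (z - w)) *\<^sub>C ((z - w) *\<^sub>C (F z o\<^sub>L F w)) = (1 / (z - w)) *\<^sub>C ((z - w) *\<^sub>C (F w o\<^sub>L F z))"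
    by simp
  then show ?thesis
    using False by simp
qed simp

lemma pseudo_resolvent_bound:
  assumes F: "pseudo_resolvent F D" and z: "z \<in> D" and w: "w \<in> D"
    and small: "cmod (w - z) * norm (F z) \<le> 1 / 2"
  shows "norm (F w) \<le> 2 * norm (F z)"
proof -
  have "F w = F z + (w - z) *\<^sub>C (F w o\<^sub>L F z)"
    using pseudo_resolvent_diff[OF F w z] by (simp add: algebra_simps)
  then have "norm (F w) \<le> norm (F z) + norm ((w - z) *\<^sub>C (F w o\<^sub>L F z))"
    by (metis norm_triangle_ineq)
  also have "norm ((w - z) *\<^sub>C (F w o\<^sub>L F z)) \<le> cmod (w - z) * (norm (F w) * norm (F z))"
    by (rule order_trans[OF norm_scaleC_blinfun]) (simp add: mult_left_mono norm_blinfun_compose)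
  also have "\<dots> = (cmod (w - z) * norm (F z)) * norm (F w)"
    by simp
  also have "\<dots> \<le> 1 / 2 * norm (F w)"
    by (rule mult_right_mono[OF small]) simp
  finally show ?thesis
    by simp
qed

lemma pseudo_resolvent_has_derivative:
  assumes F: "pseudo_resolvent F D" and z: "z \<in> D"
  shows "(F has_derivative (\<lambda>h. h *\<^sub>C (F z o\<^sub>L F z))) (at z within D)"
proof (rule has_derivativeI_sandwich)
  define N where "N = norm (F z)"
  show "0 < 1 / (2 * N + 1)"
    by (simp add: N_def add_nonneg_pos)
  show "bounded_linear (\<lambda>h. h *\<^sub>C (F z o\<^sub>L F z))"
    by (rule bounded_bilinear.bounded_linear_left[OF bounded_bilinear_scaleC_blinfun])
  fix w assume w: "w \<in> D" "w \<noteq> z" "dist w z < 1 / (2 * N + 1)"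
  have "cmod (w - z) * N \<le> 1 / (2 * N + 1) * N"
    using w(3) by (intro mult_right_mono) (auto simp: dist_norm N_def)
  also have "\<dots> \<le> 1 / 2"
    by (simp add: N_def add_nonneg_pos divide_le_eq)
  finally have bnd: "norm (F w) \<le> 2 * N"
    unfolding N_def by (rule pseudo_resolvent_bound[OF F z w(1)])
  have "F w - F z - (w - z) *\<^sub>C (F z o\<^sub>L F z) = (w - z) *\<^sub>C ((F w - F z) o\<^sub>L F z)"
    unfolding blinfun_compose_distribs(3) scaleC_blinfun_distribs(4)
    by (simp only: pseudo_resolvent_diff[OF F w(1) z])
  also have "\<dots> = ((w - z) * (w - z)) *\<^sub>C ((F w o\<^sub>L F z) o\<^sub>L F z)"
    by (simp add: pseudo_resolvent_diff[OF F w(1) z] compose_scaleC_left)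
  finally have "norm (F w - F z - (w - z) *\<^sub>C (F z o\<^sub>L F z))
      \<le> cmod ((w - z) * (w - z)) * (norm (F w) * norm (F z) * norm (F z))"
    by (metis (no_types, lifting) norm_scaleC_blinfun order_trans mult_left_mono norm_ge_zero
        norm_blinfun_compose mult_right_mono)
  also have "\<dots> \<le> cmod ((w - z) * (w - z)) * (2 * N * N * N)"
    using bnd unfolding N_def by (intro mult_left_mono mult_right_mono) auto
  finally show "norm (F w - F z - (w - z) *\<^sub>C (F z o\<^sub>L F z)) / norm (w - z) \<le> norm (w - z) * (2 * N * N * N)"
    using w(2) by (simp add: divide_le_eq norm_mult mult_ac)
next
  have "((\<lambda>w. norm (w - z) * (2 * norm (F z) * norm (F z) * norm (F z))) \<longlongrightarrow>
      norm (z - z) * (2 * norm (F z) * norm (F z) * norm (F z))) (at z within D)"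
    by (intro tendsto_intros)
  then show "((\<lambda>w. norm (w - z) * (2 * norm (F z) * norm (F z) * norm (F z))) \<longlongrightarrow> 0) (at z within D)"
    by simp
qed

lemma pseudo_resolvent_continuous_on: "pseudo_resolvent F D \<Longrightarrow> continuous_on D F"
  unfolding continuous_on_eq_continuous_within
  using has_derivative_continuous pseudo_resolvent_has_derivative by blast

lemma pseudo_resolvent_holomorphic:
  assumes F: "pseudo_resolvent F D" and D: "open D"
  shows "op_holomorphic F D"
  unfolding op_holomorphic_def
proof (intro ballI conjI)
  fix z assume z: "z \<in> D"
  show "complex_linear (F z)"
    by (rule pseudo_resolvent_linear[OF F z])
  then show "\<exists>F'. complex_linear F' \<and> (F has_derivative (\<lambda>h. h *\<^sub>C F')) (at z)"
    using pseudo_resolvent_has_derivative[OF F z] at_within_open[OF z D]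
    by (intro exI[of _ "F z o\<^sub>L F z"]) (auto intro!: complex_linear_intros)
qed

lemma is_resolvent_at_unique:
  assumes "is_resolvent_at A z R" "is_resolvent_at A z R'"
  shows "R = R'"
proof (rule blinfun_eqI)
  fix y
  have "R y \<in> dom A" "the (A (R y)) - z *\<^sub>C R y = y"
    using assms(1) unfolding is_resolvent_at_def by blast+
  then show "R y = R' y"
    using assms(2) unfolding is_resolvent_at_def by metis
qed

lemma resolvent_eqI: "is_resolvent_at A z R \<Longrightarrow> resolvent A z = R"
  unfolding resolvent_def by (rule the_equality) (auto intro: is_resolvent_at_unique)

lemma is_resolvent_at_resolvent: "z \<notin> spectrum A \<Longrightarrow> is_resolvent_at A z (resolvent A z)"
  unfolding spectrum_def using resolvent_eqI by fastforce

lemma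
  assumes "is_resolvent_at A z R"
  shows is_resolvent_linear: "complex_linear R"
    and is_resolvent_dom: "R y \<in> dom A"
    and is_resolvent_right: "the (A (R y)) = y + z *\<^sub>C R y"
    and is_resolvent_left: "x \<in> dom A \<Longrightarrow> R (the (A x) - z *\<^sub>C x) = x"
  using assms unfolding is_resolvent_at_def by (auto simp: algebra_simps)

lemma pseudo_resolvent_resolvent: "pseudo_resolvent (resolvent A) (- spectrum A)"
  unfolding pseudo_resolvent_def
proof (intro conjI ballI)
  fix z w assume "z \<in> - spectrum A" "w \<in> - spectrum A"
  then have z: "is_resolvent_at A z (resolvent A z)" and w: "is_resolvent_at A w (resolvent A w)"
    by (auto intro: is_resolvent_at_resolvent)
  show "resolvent A z - resolvent A w = (z - w) *\<^sub>C (resolvent A z o\<^sub>L resolvent A w)"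
  proof (rule blinfun_eqI)
    fix y
    define u where "u = resolvent A w y"
    have u: "u \<in> dom A" "the (A u) = y + w *\<^sub>C u"
      unfolding u_def by (rule is_resolvent_dom[OF w], rule is_resolvent_right[OF w])
    have "the (A u) - z *\<^sub>C u = y - (z - w) *\<^sub>C u"
      by (simp add: u(2) complex_vector.scale_left_diff_distrib)
    then have "resolvent A z (y - (z - w) *\<^sub>C u) = u"
      using is_resolvent_left[OF z u(1)] by simp
    then show "(resolvent A z - resolvent A w) y = ((z - w) *\<^sub>C (resolvent A z o\<^sub>L resolvent A w)) y"
      by (simp add: blinfun.bilinear_simps complex_linear_apply[OF is_resolvent_linear[OF z]]
          algebra_simps flip: u_def)
  qed
qed (auto intro: is_resolvent_linear is_resolvent_at_resolvent)

lemma linear_operator_facts: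
  assumes "linear_operator A"
  shows linear_operator_add_dom: "x \<in> dom A \<Longrightarrow> y \<in> dom A \<Longrightarrow> x + y \<in> dom A"
    and linear_operator_scaleC_dom: "x \<in> dom A \<Longrightarrow> c *\<^sub>C x \<in> dom A"
    and linear_operator_diff_dom: "x \<in> dom A \<Longrightarrow> y \<in> dom A \<Longrightarrow> x - y \<in> dom A"
    and linear_operator_zero_dom: "0 \<in> dom A"
    and linear_operator_add: "x \<in> dom A \<Longrightarrow> y \<in> dom A \<Longrightarrow> the (A (x + y)) = the (A x) + the (A y)"
    and linear_operator_scaleC: "x \<in> dom A \<Longrightarrow> the (A (c *\<^sub>C x)) = c *\<^sub>C the (A x)"
    and linear_operator_diff: "x \<in> dom A \<Longrightarrow> y \<in> dom A \<Longrightarrow> the (A (x - y)) = the (A x) - the (A y)"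
proof -
  have sub: "complex_vector.subspace (dom A)"
    using assms unfolding linear_operator_def by blast
  show add: "x + y \<in> dom A" if "x \<in> dom A" "y \<in> dom A" for x y
    using sub that by (rule complex_vector.subspace_add)
  show sc: "c *\<^sub>C x \<in> dom A" if "x \<in> dom A" for c x
    using sub that by (rule complex_vector.subspace_scale)
  show "x - y \<in> dom A" if "x \<in> dom A" "y \<in> dom A"
    using sub that by (rule complex_vector.subspace_diff)
  show "0 \<in> dom A"
    using sub by (rule complex_vector.subspace_0)
  show addA: "the (A (x + y)) = the (A x) + the (A y)" if "x \<in> dom A" "y \<in> dom A" for x y
    using assms that unfolding linear_operator_def by blast
  show scA: "the (A (c *\<^sub>C x)) = c *\<^sub>C the (A x)" if "x \<in> dom A" for c x
    using assms that unfolding linear_operator_def by blast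
  show "the (A (x - y)) = the (A x) - the (A y)" if "x \<in> dom A" "y \<in> dom A"
    using addA[OF that(1) sc[OF that(2), of "- 1"]] scA[OF that(2), of "- 1"] by simp
qed

lemma resolvent_existsI:
  assumes A: "linear_operator A"
    and surj: "\<And>y. \<exists>u\<in>dom A. the (A u) - z *\<^sub>C u = y"
    and bound: "\<And>u. u \<in> dom A \<Longrightarrow> norm u \<le> K * norm (the (A u) - z *\<^sub>C u)"
  shows "z \<notin> spectrum A"
proof -
  obtain g where g: "\<And>y. g y \<in> dom A" "\<And>y. the (A (g y)) - z *\<^sub>C g y = y"
    using surj by metis
  have uniq: "u = v" if "u \<in> dom A" "v \<in> dom A" "the (A u) - z *\<^sub>C u = the (A v) - z *\<^sub>C v" for u v
  proof -
    have "the (A (u - v)) - z *\<^sub>C (u - v) = 0"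
      using that by (simp add: linear_operator_diff[OF A] complex_vector.scale_right_diff_distrib
          algebra_simps)
    then show ?thesis
      using bound[OF linear_operator_diff_dom[OF A that(1,2)]] by simp
  qed
  have add: "g (x + y) = g x + g y" for x y
  proof (rule uniq[OF g(1) linear_operator_add_dom[OF A g(1) g(1)]])
    have "(the (A (g x)) - z *\<^sub>C g x) + (the (A (g y)) - z *\<^sub>C g y)
        = the (A (g x + g y)) - z *\<^sub>C (g x + g y)"
      by (simp only: linear_operator_add[OF A g(1) g(1)] scaleC_add_right add_diff_add)
    then show "the (A (g (x + y))) - z *\<^sub>C g (x + y) = the (A (g x + g y)) - z *\<^sub>C (g x + g y)"
      by (simp only: g(2))
  qed
  have scaleC: "g (c *\<^sub>C x) = c *\<^sub>C g x" for c x
  proof (rule uniq[OF g(1) linear_operator_scaleC_dom[OF A g(1)]])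
    have "c *\<^sub>C (the (A (g x)) - z *\<^sub>C g x) = the (A (c *\<^sub>C g x)) - z *\<^sub>C c *\<^sub>C g x"
      by (simp add: linear_operator_scaleC[OF A g(1)] complex_vector.scale_right_diff_distrib
          mult.commute)
    then show "the (A (g (c *\<^sub>C x))) - z *\<^sub>C g (c *\<^sub>C x) = the (A (c *\<^sub>C g x)) - z *\<^sub>C c *\<^sub>C g x"
      by (simp add: g(2))
  qed
  have "norm (g y) \<le> norm y * K" for y
    using bound[OF g(1), of y] unfolding g(2) by (simp only: mult.commute)
  moreover have "g (r *\<^sub>R x) = r *\<^sub>R g x" for r x
    unfolding scaleR_scaleC by (rule scaleC)
  ultimately have "bounded_linear g"
    using add by (intro bounded_linear_intro[where K = K])
  then have "is_resolvent_at A z (Blinfun g)"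
    unfolding is_resolvent_at_def complex_linear_def
    using g uniq by (auto simp: bounded_linear_Blinfun_apply scaleC)
  then show ?thesis
    unfolding spectrum_def by blast
qed

lemma dense_cinner_unique:
  assumes "closure M = UNIV" and eq: "\<And>x. x \<in> M \<Longrightarrow> cinner x z = cinner x z'"
  shows "z = (z' :: 'a::complex_hilbert)"
proof -
  have "continuous_on UNIV (\<lambda>x :: 'a. cinner x (z - z'))"
    by (intro linear_continuous_on bounded_bilinear.bounded_linear_left[OF bounded_bilinear_cinner])
  then have "closed {x. cinner x (z - z') = 0}"
    by (intro closed_Collect_eq continuous_on_const)
  moreover have "M \<subseteq> {x. cinner x (z - z') = 0}"
    by (auto simp: cinner_diff_right eq)
  ultimately have "closure M \<subseteq> {x. cinner x (z - z') = 0}"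
    by (rule closure_minimal[rotated])
  then have "cinner (z - z') (z - z') = 0"
    unfolding assms(1) by blast
  then show ?thesis
    by simp
qed

lemma op_adjoint_eq_Some_iff:
  assumes "densely_defined A"
  shows "op_adjoint A y = Some z \<longleftrightarrow> (\<forall>x\<in>dom A. cinner (the (A x)) y = cinner x z)" (is "_ \<longleftrightarrow> ?P z")
proof -
  have "z' = z" if "?P z" "?P z'" for z z'
    using assms that unfolding densely_defined_def by (intro dense_cinner_unique[of "dom A"]) auto
  then have "(THE z. ?P z) = z" if "?P z" for z
    using that by (intro the_equality) blast+
  then show ?thesis
    unfolding op_adjoint_def by (smt (verit, best) option.distinct(1) option.inject)
qed

lemma self_adjoint_symmetric:
  assumes A: "self_adjoint A" and "x \<in> dom A" "y \<in> dom A"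
  shows "cinner (the (A x)) y = cinner x (the (A y))"
proof -
  have "densely_defined A" "op_adjoint A y = Some (the (A y))"
    using assms unfolding self_adjoint_def by auto
  then show ?thesis
    using op_adjoint_eq_Some_iff assms(2) by blast
qed

lemma self_adjoint_domI:
  assumes A: "self_adjoint A" and "\<And>x. x \<in> dom A \<Longrightarrow> cinner (the (A x)) y = cinner x z"
  shows "y \<in> dom A" "the (A y) = z"
proof -
  have "op_adjoint A y = Some z"
    using assms op_adjoint_eq_Some_iff unfolding self_adjoint_def by blast
  then have "A y = Some z"
    using A unfolding self_adjoint_def by simp
  then show "y \<in> dom A" "the (A y) = z"
    by auto
qed

lemma is_resolvent_at_adjoint:
  assumes A: "self_adjoint A" and R: "is_resolvent_at A z R"
  shows "is_resolvent_at A (cnj z) (R\<^sup>\<dagger>)"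
proof -
  note lin = is_resolvent_linear[OF R]
  have test: "cinner (the (A x)) ((R\<^sup>\<dagger>) y) = cinner x (y + cnj z *\<^sub>C (R\<^sup>\<dagger>) y)" if x: "x \<in> dom A" for x y
  proof -
    have "cinner (the (A x) - z *\<^sub>C x) ((R\<^sup>\<dagger>) y) = cinner x y"
      unfolding cinner_adjoint[OF lin, symmetric] is_resolvent_left[OF R x] ..
    then show ?thesis
      by (simp add: cinner_simps algebra_simps)
  qed
  have "(R\<^sup>\<dagger>) (the (A x) - cnj z *\<^sub>C x) = x" if x: "x \<in> dom A" for x
  proof (rule cinner_eq_all_right)
    fix y
    have "cinner y ((R\<^sup>\<dagger>) (the (A x) - cnj z *\<^sub>C x)) = cinner (R y) (the (A x)) - z * cinner (R y) x"
      by (simp add: cinner_simps flip: cinner_adjoint[OF lin])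
    also have "cinner (R y) (the (A x)) = cinner y x + z * cinner (R y) x"
      unfolding self_adjoint_symmetric[OF A is_resolvent_dom[OF R] x, symmetric]
      by (simp add: is_resolvent_right[OF R] cinner_simps)
    finally show "cinner y ((R\<^sup>\<dagger>) (the (A x) - cnj z *\<^sub>C x)) = cinner y x"
      by simp
  qed
  then show ?thesis
    unfolding is_resolvent_at_def using self_adjoint_domI[OF A test] lin
    by (auto intro: complex_linear_adjoint)
qed

lemma resolvent_cnj:
  assumes A: "self_adjoint A" and z: "z \<notin> spectrum A"
  shows "cnj z \<notin> spectrum A" and "resolvent A (cnj z) = (resolvent A z)\<^sup>\<dagger>"
  using is_resolvent_at_adjoint[OF A is_resolvent_at_resolvent[OF z]] resolvent_eqI
  unfolding spectrum_def by blast+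

lemma self_adjoint_eigenvalue_real:
  assumes A: "self_adjoint A" and "eigenspace A \<mu> \<noteq> {0}"
  shows "\<mu> \<in> \<real>"
proof -
  have lin: "linear_operator A"
    using A unfolding self_adjoint_def by blast
  have "0 \<in> eigenspace A \<mu>"
    using linear_operator_zero_dom[OF lin] linear_operator_scaleC[OF lin, of 0 0]
    unfolding eigenspace_def by simp
  then obtain x where x: "x \<in> dom A" "the (A x) = \<mu> *\<^sub>C x" "x \<noteq> 0"
    using assms(2) unfolding eigenspace_def by blast
  have "\<mu> * cinner x x = cnj \<mu> * cinner x x"
    using self_adjoint_symmetric[OF A x(1) x(1)] by (simp add: x(2) cinner_simps)
  then show ?thesis
    using x(3) by (simp add: Reals_cnj_iff)
qed

section \<open>Isolated real singularities of symmetric pseudo-resolvents\<close>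

definition bounded_below :: "('a::real_normed_vector \<Rightarrow>\<^sub>L 'b::real_normed_vector) \<Rightarrow> bool" where
  "bounded_below F \<longleftrightarrow> (\<exists>L. \<forall>x. norm x \<le> L * norm (F x))"

lemma bounded_below_compose:
  assumes "bounded_below F" "bounded_below G"
  shows "bounded_below (F o\<^sub>L G)"
proof -
  obtain L K where L: "\<And>x. norm x \<le> L * norm (F x)" and K: "\<And>x. norm x \<le> K * norm (G x)"
    using assms unfolding bounded_below_def by blast
  have "norm x \<le> \<bar>K\<bar> * \<bar>L\<bar> * norm ((F o\<^sub>L G) x)" for x
  proof -
    have "norm x \<le> \<bar>K\<bar> * norm (G x)"
      using K[of x] by (meson abs_ge_self mult_right_mono norm_ge_zero order_trans)
    also have "norm (G x) \<le> \<bar>L\<bar> * norm (F (G x))"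
      using L[of "G x"] by (meson abs_ge_self mult_right_mono norm_ge_zero order_trans)
    finally show ?thesis
      by (simp add: mult_left_mono mult.assoc)
  qed
  then show ?thesis
    unfolding bounded_below_def by blast
qed

lemma bounded_below_left_inverse:
  assumes "G o\<^sub>L F = id_blinfun"
  shows "bounded_below F"
proof -
  have "norm x \<le> norm G * norm (F x)" for x
    using norm_blinfun[of G "F x"] arg_cong[OF assms, of "\<lambda>H. H x"] by simp
  then show ?thesis
    unfolding bounded_below_def by blast
qed

lemma bounded_below_scaleC:
  assumes "bounded_below F" "c \<noteq> 0"
  shows "bounded_below (c *\<^sub>C F)"
proof -
  obtain L where L: "\<And>x. norm x \<le> L * norm (F x)"
    using assms unfolding bounded_below_def by blast
  have "norm x \<le> L / cmod c * norm ((c *\<^sub>C F) x)" for x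
    using L[of x] assms(2) by (simp add: norm_scaleC)
  then show ?thesis
    unfolding bounded_below_def by blast
qed

text \<open>A symmetric operator \<open>B\<close> attains its norm approximately at approximate eigenvectors: on unit
  vectors with \<open>\<parallel>B x\<parallel>\<close> close to \<open>\<parallel>B\<parallel>\<close>, expanding the square shows that
  \<open>B\<^sup>2 x - \<parallel>B\<parallel>\<^sup>2 x\<close> is small.\<close>

lemma symmetric_norm_not_bounded_below:
  fixes B :: "'a::complex_hilbert \<Rightarrow>\<^sub>L 'a"
  assumes sym: "\<And>x y. cinner (B x) y = cinner x (B y)" and pos: "norm B > 0"
  shows "\<not> bounded_below ((B o\<^sub>L B) - (norm B)\<^sup>2 *\<^sub>R id_blinfun)"
proof
  define k where "k = norm B"
  assume "bounded_below ((B o\<^sub>L B) - (norm B)\<^sup>2 *\<^sub>R id_blinfun)"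
  then obtain L0 where L0: "\<And>x. norm x \<le> L0 * norm (B (B x) - k\<^sup>2 *\<^sub>R x)"
    unfolding bounded_below_def by (auto simp: blinfun.bilinear_simps k_def)
  define L where "L = max L0 1"
  have L: "norm x \<le> L * norm (B (B x) - k\<^sup>2 *\<^sub>R x)" and L1: "L > 0" for x
    using order_trans[OF L0 mult_right_mono[of L0 L]] by (auto simp: L_def)
  have k: "k > 0"
    using pos by (simp add: k_def)
  define c where "c = k\<^sup>2 - 1 / (L\<^sup>2 * k\<^sup>2)"
  have main: "(norm (B x))\<^sup>2 \<le> c * (norm x)\<^sup>2" for x
  proof -
    have "Re (cinner (B (B x)) (k\<^sup>2 *\<^sub>R x)) = k\<^sup>2 * (norm (B x))\<^sup>2"
      by (simp add: cinner_simps sym[of "B x" x] power2_norm_eq_Re_cinner)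
    then have eq: "(norm (B (B x) - k\<^sup>2 *\<^sub>R x))\<^sup>2
        = (norm (B (B x)))\<^sup>2 + (k\<^sup>2 * norm x)\<^sup>2 - 2 * (k\<^sup>2 * (norm (B x))\<^sup>2)"
      unfolding norm_diff_squared by simp
    have "norm (B (B x)) \<le> k * norm (B x)"
      unfolding k_def by (rule norm_blinfun)
    then have "(norm (B (B x)))\<^sup>2 \<le> k\<^sup>2 * (norm (B x))\<^sup>2"
      by (metis norm_ge_zero power_mono power_mult_distrib)
    then have "(norm (B (B x) - k\<^sup>2 *\<^sub>R x))\<^sup>2 \<le> k\<^sup>2 * (k\<^sup>2 * (norm x)\<^sup>2 - (norm (B x))\<^sup>2)"
      unfolding eq by (simp add: power_mult_distrib power2_eq_square algebra_simps)
    moreover have "(norm x)\<^sup>2 \<le> L\<^sup>2 * (norm (B (B x) - k\<^sup>2 *\<^sub>R x))\<^sup>2"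
      using power_mono[OF L[of x], of 2] by (simp add: power_mult_distrib)
    ultimately have "(norm x)\<^sup>2 \<le> L\<^sup>2 * (k\<^sup>2 * (k\<^sup>2 * (norm x)\<^sup>2 - (norm (B x))\<^sup>2))"
      by (meson mult_left_mono order_trans zero_le_power2)
    then have "(norm x)\<^sup>2 / (L\<^sup>2 * k\<^sup>2) \<le> k\<^sup>2 * (norm x)\<^sup>2 - (norm (B x))\<^sup>2"
      using L1 k by (simp add: divide_le_eq mult_ac)
    then show ?thesis
      by (simp add: c_def left_diff_distrib)
  qed
  have "norm B \<le> sqrt (max c 0)"
  proof (rule norm_blinfun_bound)
    fix x
    have "(norm (B x))\<^sup>2 \<le> max c 0 * (norm x)\<^sup>2"
      by (rule order_trans[OF main]) (simp add: mult_right_mono)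
    then show "norm (B x) \<le> sqrt (max c 0) * norm x"
      using real_le_rsqrt by (fastforce simp: real_sqrt_mult)
  qed simp
  then have "k\<^sup>2 \<le> max c 0"
    using k unfolding k_def by (metis max.cobounded2 norm_ge_zero power_mono real_sqrt_pow2)
  moreover have "c < k\<^sup>2"
    using k L1 by (simp add: c_def)
  ultimately show False
    using k by (simp add: max_def split: if_splits)
qed

lemma complex_quadratic_roots: "\<exists>z w :: complex. z + w = p \<and> z * w = q"
proof -
  define e where "e = csqrt (p\<^sup>2 - 4 * q)"
  have "e * e = p\<^sup>2 - 4 * q"
    using power2_csqrt[of "p\<^sup>2 - 4 * q"] by (simp add: e_def power2_eq_square)
  then have "(p + e) / 2 * ((p - e) / 2) = q"
    by (simp add: field_simps power2_eq_square)
  then show ?thesis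
    by (intro exI[of _ "(p + e) / 2"] exI[of _ "(p - e) / 2"]) (simp add: field_simps)
qed

text \<open>For resolvents \<open>F z = (A - z)\<^sup>-\<^sup>1\<close> this operator is \<open>(A - z)(A - s)\<^sup>-\<^sup>1\<close>, and its inverse is
  the same expression with \<open>z\<close> and \<open>s\<close> exchanged.\<close>

lemma pseudo_resolvent_shift_bounded_below:
  assumes F: "pseudo_resolvent F D" and z: "z \<in> D" and s: "s \<in> D"
  shows "bounded_below (id_blinfun + (s - z) *\<^sub>C F s)"
proof (rule bounded_below_left_inverse)
  have "(id_blinfun + (z - s) *\<^sub>C F z) o\<^sub>L (id_blinfun + (s - z) *\<^sub>C F s)
      = id_blinfun + (s - z) *\<^sub>C F s + (z - s) *\<^sub>C F z - (z - s) *\<^sub>C ((z - s) *\<^sub>C (F z o\<^sub>L F s))"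
    by (rule blinfun_eqI)
      (simp add: blinfun.bilinear_simps complex_linear_apply[OF pseudo_resolvent_linear[OF F]] z s
        scaleC_scaleC flip: complex_vector.scale_minus_left mult_minus_right)
  also have "\<dots> = id_blinfun"
    unfolding pseudo_resolvent_diff[OF F z s, symmetric] by (simp add: scaleC_blinfun_distribs)
  finally show "(id_blinfun + (z - s) *\<^sub>C F z) o\<^sub>L (id_blinfun + (s - z) *\<^sub>C F s) = id_blinfun" .
qed

text \<open>If \<open>F z = (A - z)\<^sup>-\<^sup>1\<close>, then \<open>B - k\<close> for the operator \<open>B\<close> below is
  \<open>- k (A - z\<^sub>1) (A - z\<^sub>2) F s F s'\<close>, where \<open>z\<^sub>1\<close> and \<open>z\<^sub>2\<close> are the solutions of
  \<open>\<mu> - z = k (z - s) (z - s')\<close>. When \<open>\<bar>k\<bar> > 4 / d\<close>, both lie in the punctured disc, so neither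
  \<open>k\<close> nor \<open>- k\<close> is an approximate eigenvalue of \<open>B\<close>, and \<open>\<parallel>B\<parallel>\<close> cannot exceed \<open>4 / d\<close>. The operator is
  the difference quotient of \<open>s \<mapsto> (\<mu> - s) F s\<close>, which is thus Lipschitz along the real axis near
  \<open>\<mu>\<close>.\<close>

lemma isolated_point_estimate:
  fixes F :: "complex \<Rightarrow> 'a::complex_hilbert \<Rightarrow>\<^sub>L 'a"
  assumes d: "d > 0" and \<mu>: "\<mu> \<in> \<real>"
    and F: "pseudo_resolvent F (ball \<mu> d - {\<mu>})"
    and sym: "\<And>s x y. s \<in> \<real> \<Longrightarrow> s \<in> ball \<mu> d - {\<mu>} \<Longrightarrow> cinner (F s x) y = cinner x (F s y)"
    and s: "s \<in> \<real>" "s \<noteq> \<mu>" "cmod (s - \<mu>) < d / 2"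
    and s': "s' \<in> \<real>" "s' \<noteq> \<mu>" "cmod (s' - \<mu>) < d / 2"
  shows "norm ((\<mu> - s) *\<^sub>C (F s o\<^sub>L F s') - F s') \<le> 4 / d"
proof (rule ccontr)
  define D where "D = ball \<mu> d - {\<mu>}"
  define B where "B = (\<mu> - s) *\<^sub>C (F s o\<^sub>L F s') - F s'"
  define K where "K = norm B"
  assume "\<not> norm ((\<mu> - s) *\<^sub>C (F s o\<^sub>L F s') - F s') \<le> 4 / d"
  then have K: "K > 4 / d"
    by (simp add: K_def B_def)
  have sD: "s \<in> D" "s' \<in> D"
    using s s' d by (auto simp: D_def dist_norm norm_minus_commute)
  note F' = F[folded D_def]
  have lin: "complex_linear (F s)" "complex_linear (F s')"
    using pseudo_resolvent_linear[OF F'] sD by auto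
  have bb: "bounded_below (B - k *\<^sub>C id_blinfun)" if k: "cmod k = K" for k
  proof -
    have k0: "k \<noteq> 0"
      using k K d by (metis divide_pos_pos less_trans norm_zero order_less_irrefl zero_less_numeral)
    obtain z w where zw: "z + w = s + s' - 1 / k" "z * w = s * s' - \<mu> / k"
      using complex_quadratic_roots by blast
    have root: "u \<in> D" if u: "u = z \<or> u = w" for u
    proof -
      have uu: "u * u = (z + w) * u - z * w"
        using u by (auto simp: algebra_simps)
      have "k * (u * u) = k * (s + s') * u - u - k * (s * s') + \<mu>"
        unfolding uu zw using k0 by (simp add: left_diff_distrib right_diff_distrib)
      then have eq: "k * ((u - s) * (u - s')) = \<mu> - u"
        by (simp add: algebra_simps)
      have "u \<noteq> \<mu>"
        using eq k0 s(2) s'(2) by auto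
      moreover have "cmod (u - \<mu>) < d"
      proof (rule ccontr)
        assume "\<not> cmod (u - \<mu>) < d"
        then have ge: "cmod (u - \<mu>) \<ge> d"
          by simp
        have "cmod (u - \<mu>) / 2 \<le> cmod (u - s)" "cmod (u - \<mu>) / 2 \<le> cmod (u - s')"
          using norm_triangle_ineq[of "u - s" "s - \<mu>"] norm_triangle_ineq[of "u - s'" "s' - \<mu>"]
            s(3) s'(3) ge by auto
        then have "cmod (u - \<mu>) / 2 * (cmod (u - \<mu>) / 2) \<le> cmod (u - s) * cmod (u - s')"
          by (intro mult_mono) auto
        then have "K * (cmod (u - \<mu>) / 2 * (cmod (u - \<mu>) / 2)) \<le> K * (cmod (u - s) * cmod (u - s'))"
          by (intro mult_left_mono) (simp_all add: K_def)
        also have "\<dots> = cmod (\<mu> - u)"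
          using arg_cong[OF eq, of cmod] by (simp add: norm_mult k)
        finally have "K * cmod (u - \<mu>) * cmod (u - \<mu>) \<le> 4 * cmod (u - \<mu>)"
          by (simp add: norm_minus_commute)
        then have "K * cmod (u - \<mu>) \<le> 4"
          by (rule mult_right_le_imp_le) (use ge d in linarith)
        moreover have "K * d \<le> K * cmod (u - \<mu>)"
          using ge by (intro mult_left_mono) (simp_all add: K_def)
        ultimately show False
          using K d by (simp add: divide_less_eq)
      qed
      ultimately show ?thesis
        by (simp add: D_def dist_norm norm_minus_commute)
    qed
    have c1: "- k * ((s - z) + (s' - w)) = - 1"
    proof -
      have "(s - z) + (s' - w) = 1 / k"
        using zw(1) by (simp add: algebra_simps)
      then show ?thesis
        using k0 by simp
    qed
    have c2: "- k * ((s - z) * (s - s') + (s - z) * (s' - w)) = \<mu> - s"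
    proof -
      have "(s - z) * (s - s') + (s - z) * (s' - w) = s * s - (z + w) * s + z * w"
        by (simp add: algebra_simps)
      also have "\<dots> = (s - \<mu>) / k"
        unfolding zw using k0 by (simp add: field_simps)
      finally show ?thesis
        using k0 by simp
    qed
    have Fs: "F s = F s' + (s - s') *\<^sub>C (F s o\<^sub>L F s')"
      using pseudo_resolvent_diff[OF F' sD] by (simp add: algebra_simps)
    have "(- k) *\<^sub>C ((id_blinfun + (s - z) *\<^sub>C F s) o\<^sub>L (id_blinfun + (s' - w) *\<^sub>C F s'))
      = (- k) *\<^sub>C id_blinfun + (- k * (s - z)) *\<^sub>C F s + (- k * (s' - w)) *\<^sub>C F s'
        + (- k * ((s - z) * (s' - w))) *\<^sub>C (F s o\<^sub>L F s')"
      by (rule blinfun_eqI)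
        (simp only: blinfun.bilinear_simps scaleC_blinfun_apply blinfun_apply_blinfun_compose
          id_blinfun.rep_eq complex_linear_apply[OF lin(1)] scaleC_scaleC scaleC_add_right mult.assoc
          id_apply ac_simps)
    also have "\<dots> = (- k) *\<^sub>C id_blinfun
        + ((- k * (s - z)) *\<^sub>C F s' + (- k * ((s - z) * (s - s'))) *\<^sub>C (F s o\<^sub>L F s'))
        + (- k * (s' - w)) *\<^sub>C F s' + (- k * ((s - z) * (s' - w))) *\<^sub>C (F s o\<^sub>L F s')"
      by (subst Fs) (simp add: scaleC_blinfun_distribs(2) mult.assoc)
    also have "\<dots> = (- k) *\<^sub>C id_blinfun + (- k * ((s - z) + (s' - w))) *\<^sub>C F s'
        + (- k * ((s - z) * (s - s') + (s - z) * (s' - w))) *\<^sub>C (F s o\<^sub>L F s')"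
      by (simp only: distrib_left scaleC_blinfun_distribs(1) ac_simps)
    also have "\<dots> = B - k *\<^sub>C id_blinfun"
      unfolding c1 c2 by (simp add: B_def scaleC_blinfun_distribs)
    finally have "B - k *\<^sub>C id_blinfun
        = (- k) *\<^sub>C ((id_blinfun + (s - z) *\<^sub>C F s) o\<^sub>L (id_blinfun + (s' - w) *\<^sub>C F s'))"
      by simp
    then show ?thesis
      using k0 pseudo_resolvent_shift_bounded_below[OF F' root sD(1)]
        pseudo_resolvent_shift_bounded_below[OF F' root sD(2)]
      by (auto intro!: bounded_below_scaleC bounded_below_compose)
  qed
  have "bounded_below ((B - of_real K *\<^sub>C id_blinfun) o\<^sub>L (B - of_real (- K) *\<^sub>C id_blinfun))"
    by (intro bounded_below_compose bb) (simp_all add: K_def)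
  moreover have "(B - of_real K *\<^sub>C id_blinfun) o\<^sub>L (B - of_real (- K) *\<^sub>C id_blinfun)
      = (B o\<^sub>L B) - (norm B)\<^sup>2 *\<^sub>R id_blinfun"
    by (rule blinfun_eqI) (simp add: blinfun.bilinear_simps K_def power2_eq_square algebra_simps
        flip: scaleR_scaleC)
  moreover have "cinner (B x) y = cinner x (B y)" for x y
  proof -
    have "cinner (F s (F s' x)) y = cinner x (F s (F s' y))"
      using sym s s' sD pseudo_resolvent_commute[OF F' sD] unfolding D_def
      by (metis blinfun_apply_blinfun_compose)
    moreover have "cnj (\<mu> - s) = \<mu> - s"
      using \<mu> s(1) by (simp add: Reals_cnj_iff)
    ultimately show ?thesis
      using sym s' sD by (simp add: B_def blinfun.bilinear_simps cinner_simps D_def)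
  qed
  moreover have "norm B > 0"
    using K d by (metis K_def divide_pos_pos less_trans zero_less_numeral)
  ultimately show False
    using symmetric_norm_not_bounded_below[of B] by simp
qed

lemma lipschitz_sequence_convergent:
  fixes X :: "nat \<Rightarrow> 'a::banach" and y :: "nat \<Rightarrow> 'b::real_normed_vector"
  assumes lip: "\<And>m n. norm (X m - X n) \<le> C * norm (y m - y n)" and y: "y \<longlonglongrightarrow> l"
  shows "\<exists>L. X \<longlonglongrightarrow> L \<and> (\<forall>n. norm (X n - L) \<le> C * norm (y n - l))"
proof -
  define C' where "C' = max C 1"
  have C': "C' > 0"
    by (simp add: C'_def)
  have lip': "norm (X m - X n) \<le> C' * norm (y m - y n)" for m n
    by (rule order_trans[OF lip mult_right_mono]) (simp_all add: C'_def)
  have "Cauchy X"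
  proof (rule metric_CauchyI)
    fix e :: real assume "e > 0"
    then have "e / C' > 0"
      using C' by simp
    then obtain M where M: "\<And>m n. m \<ge> M \<Longrightarrow> n \<ge> M \<Longrightarrow> dist (y m) (y n) < e / C'"
      using LIMSEQ_imp_Cauchy[OF y] metric_CauchyD by metis
    have "dist (X m) (X n) < e" if "m \<ge> M" "n \<ge> M" for m n
    proof -
      have "C' * norm (y m - y n) < e"
        using M[OF that] C' by (simp add: dist_norm less_divide_eq mult.commute)
      then show ?thesis
        using lip'[of m n] by (simp add: dist_norm)
    qed
    then show "\<exists>M. \<forall>m\<ge>M. \<forall>n\<ge>M. dist (X m) (X n) < e"
      by blast
  qed
  then obtain L where L: "X \<longlonglongrightarrow> L"
    using convergent_eq_Cauchy by blast
  have "norm (X n - L) \<le> C * norm (y n - l)" for n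
  proof (rule LIMSEQ_le)
    show "(\<lambda>m. norm (X n - X m)) \<longlonglongrightarrow> norm (X n - L)"
      by (intro tendsto_intros L)
    show "(\<lambda>m. C * norm (y n - y m)) \<longlonglongrightarrow> C * norm (y n - l)"
      by (intro tendsto_intros y)
  qed (use lip in blast)
  with L show ?thesis
    by blast
qed

lemmas tendsto_scaleC_blinfun = bounded_bilinear.tendsto[OF bounded_bilinear_scaleC_blinfun]
lemmas tendsto_compose_blinfun = bounded_bilinear.tendsto[OF bounded_bilinear_blinfun_compose]

lemma symmetric_LIMSEQ:
  fixes X :: "nat \<Rightarrow> 'a::complex_hilbert \<Rightarrow>\<^sub>L 'a"
  assumes X: "X \<longlonglongrightarrow> L" and sym: "\<And>n x y. cinner (X n x) y = cinner x (X n y)"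
  shows "cinner (L x) y = cinner x (L y)"
proof (rule LIMSEQ_unique)
  show "(\<lambda>n. cinner (X n x) y) \<longlonglongrightarrow> cinner (L x) y"
    by (intro tendsto_cinner blinfun.tendsto X tendsto_const)
  show "(\<lambda>n. cinner (X n x) y) \<longlonglongrightarrow> cinner x (L y)"
    unfolding sym by (intro tendsto_cinner blinfun.tendsto X tendsto_const)
qed

text \<open>The singularity is a simple pole: \<open>P\<close> is the limit of \<open>(\<mu> - s) F s\<close> as \<open>s\<close> tends to
  \<open>\<mu>\<close> along the real axis, and the Lipschitz bound shows that what remains of \<open>F\<close> after subtracting
  the polar part stays bounded along such a sequence; by the resolvent identity it then extends to \<open>\<mu>\<close>.\<close>

theorem isolated_point_simple_pole:
  fixes F :: "complex \<Rightarrow> 'a::complex_hilbert \<Rightarrow>\<^sub>L 'a"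
  assumes d: "d > 0" and \<mu>: "\<mu> \<in> \<real>"
    and F: "pseudo_resolvent F (ball \<mu> d - {\<mu>})"
    and sym: "\<And>s x y. s \<in> \<real> \<Longrightarrow> s \<in> ball \<mu> d - {\<mu>} \<Longrightarrow> cinner (F s x) y = cinner x (F s y)"
  obtains P S where "complex_linear P" "complex_linear S" "P\<^sup>\<dagger> = P" "S\<^sup>\<dagger> = S" "P o\<^sub>L S = 0"
    "\<And>z. z \<in> ball \<mu> d - {\<mu>} \<Longrightarrow> (\<mu> - z) *\<^sub>C (F z o\<^sub>L P) = P"
    "pseudo_resolvent (\<lambda>z. if z = \<mu> then S else F z - (1 / (\<mu> - z)) *\<^sub>C P) (ball \<mu> d)"
proof -
  define D where "D = ball \<mu> d - {\<mu>}"
  note F' = F[folded D_def]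
  define s where "s = (\<lambda>n. \<mu> + of_real (d / real (n + 3)))"
  have s_diff: "s n - \<mu> = of_real (d / real (n + 3))" for n
    by (simp add: s_def)
  have s_less: "cmod (s n - \<mu>) < d / 2" for n
  proof -
    have "\<bar>d / real (n + 3)\<bar> = d / real (n + 3)"
      using d by simp
    also have "\<dots> < d / 2"
      using d by (intro divide_strict_left_mono) auto
    finally show ?thesis
      unfolding s_diff norm_of_real .
  qed
  have s_neq: "s n \<noteq> \<mu>" for n
  proof
    assume "s n = \<mu>"
    then have "complex_of_real (d / real (n + 3)) = 0"
      using s_diff[of n] by (simp only: diff_self)
    then have "d / real (n + 3) = 0"
      by (simp only: of_real_eq_0_iff)
    then show False
      using d by simp
  qed
  have s_real: "s n \<in> \<real>" for n
    using \<mu> by (simp add: s_def)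
  have sD: "s n \<in> D" for n
    using s_less[of n] s_neq[of n] d by (auto simp: D_def dist_norm norm_minus_commute)
  have "(\<lambda>n. d / real (n + 3)) \<longlonglongrightarrow> 0"
    using LIMSEQ_ignore_initial_segment[OF lim_const_over_n[of d], of 3] by simp
  then have "(\<lambda>n. \<mu> + complex_of_real (d / real (n + 3))) \<longlonglongrightarrow> \<mu> + of_real 0"
    by (intro tendsto_intros)
  then have s_lim: "s \<longlonglongrightarrow> \<mu>"
    by (simp add: s_def)
  define T where "T = (\<lambda>n. (\<mu> - s n) *\<^sub>C F (s n))"
  have "norm (T m - T n) \<le> 4 / d * norm (s m - s n)" for m n
  proof -
    have "T m - T n = (\<mu> - s m) *\<^sub>C (F (s m) - F (s n)) - (s m - s n) *\<^sub>C F (s n)"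
      unfolding T_def by (simp add: scaleC_blinfun_distribs)
    also have "\<dots> = (s m - s n) *\<^sub>C ((\<mu> - s m) *\<^sub>C (F (s m) o\<^sub>L F (s n)) - F (s n))"
      unfolding pseudo_resolvent_diff[OF F' sD sD] scaleC_blinfun_distribs(4) scaleC_blinfun_scaleC
      by (simp only: mult.commute)
    finally have "norm (T m - T n) \<le> norm (s m - s n) * norm ((\<mu> - s m) *\<^sub>C (F (s m) o\<^sub>L F (s n)) - F (s n))"
      by (simp only: norm_scaleC_blinfun)
    also have "\<dots> \<le> norm (s m - s n) * (4 / d)"
      by (intro mult_left_mono isolated_point_estimate[OF d \<mu> F sym] s_real s_neq s_less) auto
    finally show ?thesis
      by (simp add: mult.commute)
  qed
  from lipschitz_sequence_convergent[OF this s_lim]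
  obtain P where P: "T \<longlonglongrightarrow> P" and TP: "\<And>n. norm (T n - P) \<le> 4 / d * norm (s n - \<mu>)"
    by blast
  have linP: "complex_linear P"
    by (rule complex_linear_LIMSEQ[OF P])
      (simp add: T_def complex_linear_intros pseudo_resolvent_linear[OF F' sD])
  have symF: "cinner (F (s n) x) y = cinner x (F (s n) y)" for n x y
    using sym[OF s_real] sD unfolding D_def by blast
  have symP: "cinner (P x) y = cinner x (P y)" for x y
  proof (rule symmetric_LIMSEQ[OF P])
    fix n x y
    have "cnj (\<mu> - s n) = \<mu> - s n"
      using \<mu> s_real by (simp add: Reals_cnj_iff)
    then show "cinner (T n x) y = cinner x (T n y)"
      by (simp add: T_def cinner_simps symF)
  qed
  have FP: "(\<mu> - z) *\<^sub>C (F z o\<^sub>L P) = P" if z: "z \<in> D" for z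
  proof -
    have "(z - s n) *\<^sub>C (F z o\<^sub>L T n) = (\<mu> - s n) *\<^sub>C F z - T n" for n
    proof -
      have "(z - s n) *\<^sub>C (F z o\<^sub>L T n) = (\<mu> - s n) *\<^sub>C ((z - s n) *\<^sub>C (F z o\<^sub>L F (s n)))"
        by (simp add: T_def compose_scaleC_right pseudo_resolvent_linear[OF F' z] mult.commute)
      then show ?thesis
        unfolding pseudo_resolvent_diff[OF F' z sD, symmetric] scaleC_blinfun_distribs(4) T_def .
    qed
    moreover have "(\<lambda>n. (z - s n) *\<^sub>C (F z o\<^sub>L T n)) \<longlonglongrightarrow> (z - \<mu>) *\<^sub>C (F z o\<^sub>L P)"
      by (intro tendsto_scaleC_blinfun tendsto_compose_blinfun tendsto_diff tendsto_const s_lim P)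
    moreover have "(\<lambda>n. (\<mu> - s n) *\<^sub>C F z - T n) \<longlonglongrightarrow> (\<mu> - \<mu>) *\<^sub>C F z - P"
      by (intro tendsto_scaleC_blinfun tendsto_diff tendsto_const s_lim P)
    ultimately have "(z - \<mu>) *\<^sub>C (F z o\<^sub>L P) = - P"
      using LIMSEQ_unique by fastforce
    then have "- ((z - \<mu>) *\<^sub>C (F z o\<^sub>L P)) = P"
      by simp
    then show ?thesis
      by (simp flip: scaleC_blinfun_distribs(5))
  qed
  have FP': "F z o\<^sub>L P = (1 / (\<mu> - z)) *\<^sub>C P" if z: "z \<in> D" for z
  proof -
    have "(1 / (\<mu> - z)) *\<^sub>C ((\<mu> - z) *\<^sub>C (F z o\<^sub>L P)) = (1 / (\<mu> - z)) *\<^sub>C P"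
      by (simp only: FP[OF z])
    moreover have "\<mu> - z \<noteq> 0"
      using z by (auto simp: D_def)
    ultimately show ?thesis
      by simp
  qed
  have PF': "P o\<^sub>L F z = (1 / (\<mu> - z)) *\<^sub>C P" if z: "z \<in> D" for z
  proof -
    have "T n o\<^sub>L F z = F z o\<^sub>L T n" for n
      using pseudo_resolvent_commute[OF F' z sD] pseudo_resolvent_linear[OF F' z]
      by (simp add: T_def compose_scaleC_left compose_scaleC_right)
    moreover have "(\<lambda>n. T n o\<^sub>L F z) \<longlonglongrightarrow> (P o\<^sub>L F z)" "(\<lambda>n. F z o\<^sub>L T n) \<longlonglongrightarrow> (F z o\<^sub>L P)"
      by (intro tendsto_compose_blinfun tendsto_const P)+
    ultimately have "P o\<^sub>L F z = F z o\<^sub>L P"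
      using LIMSEQ_unique by fastforce
    then show ?thesis
      using FP'[OF z] by simp
  qed
  have PP: "P o\<^sub>L P = P"
  proof -
    have "T n o\<^sub>L P = P" for n
      by (simp add: T_def compose_scaleC_left FP sD)
    moreover have "(\<lambda>n. T n o\<^sub>L P) \<longlonglongrightarrow> (P o\<^sub>L P)"
      by (intro tendsto_compose_blinfun tendsto_const P)
    ultimately have "(\<lambda>n::nat. P) \<longlonglongrightarrow> (P o\<^sub>L P)"
      by simp
    then show ?thesis
      by (simp add: LIMSEQ_const_iff)
  qed
  define G where "G = (\<lambda>z. F z - (1 / (\<mu> - z)) *\<^sub>C P)"
  have G_eq: "G z = F z - (1 / (\<mu> - z)) *\<^sub>C P" for z
    by (simp add: G_def)
  have PG: "P o\<^sub>L G z = 0" if z: "z \<in> D" for z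
    by (simp add: G_def blinfun_compose_distribs compose_scaleC_right linP PF'[OF z] PP)
  have G: "pseudo_resolvent G D"
    unfolding pseudo_resolvent_def
  proof (intro conjI ballI)
    fix z assume "z \<in> D"
    then show "complex_linear (G z)"
      unfolding G_def by (intro complex_linear_intros linP pseudo_resolvent_linear[OF F'])
  next
    fix z w assume z: "z \<in> D" and w: "w \<in> D"
    have nz: "\<mu> - z \<noteq> 0" "\<mu> - w \<noteq> 0"
      using z w by (auto simp: D_def)
    have "G z o\<^sub>L G w = F z o\<^sub>L G w"
      unfolding G_eq[of z] by (simp add: blinfun_compose_distribs compose_scaleC_left PG[OF w])
    also have "\<dots> = (F z o\<^sub>L F w) - (1 / (\<mu> - w)) *\<^sub>C (F z o\<^sub>L P)"
      by (simp add: G_def blinfun_compose_distribs compose_scaleC_right pseudo_resolvent_linear[OF F' z])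
    finally have "(z - w) *\<^sub>C (G z o\<^sub>L G w)
        = (F z - F w) - ((z - w) * (1 / (\<mu> - w) * (1 / (\<mu> - z)))) *\<^sub>C P"
      by (simp only: FP'[OF z] scaleC_blinfun_distribs(4) scaleC_blinfun_scaleC mult.assoc
          pseudo_resolvent_diff[OF F' z w])
    also have "(z - w) * (1 / (\<mu> - w) * (1 / (\<mu> - z))) = 1 / (\<mu> - z) - 1 / (\<mu> - w)"
      using nz by (simp add: field_simps)
    finally show "G z - G w = (z - w) *\<^sub>C (G z o\<^sub>L G w)"
      by (simp add: G_def scaleC_blinfun_distribs)
  qed
  have Gs: "norm (G (s n)) \<le> 4 / d" for n
  proof -
    have nz: "\<mu> - s n \<noteq> 0"
      using s_neq[of n] by simp
    then have "(1 / (\<mu> - s n)) *\<^sub>C T n = F (s n)"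
      by (simp add: T_def)
    then have "G (s n) = (1 / (\<mu> - s n)) *\<^sub>C (T n - P)"
      by (simp only: G_eq scaleC_blinfun_distribs(4))
    then have "norm (G (s n)) \<le> cmod (1 / (\<mu> - s n)) * norm (T n - P)"
      by (simp only: norm_scaleC_blinfun)
    also have "\<dots> \<le> cmod (1 / (\<mu> - s n)) * (4 / d * norm (s n - \<mu>))"
      by (intro mult_left_mono TP) simp
    also have "\<dots> = 4 / d"
      using nz by (simp add: norm_divide norm_minus_commute)
    finally show ?thesis .
  qed
  have "norm (G (s m) - G (s n)) \<le> (4 / d * (4 / d)) * norm (s m - s n)" for m n
  proof -
    have "norm (G (s m) - G (s n)) \<le> norm (s m - s n) * norm (G (s m) o\<^sub>L G (s n))"
      unfolding pseudo_resolvent_diff[OF G sD sD] by (rule norm_scaleC_blinfun)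
    also have "\<dots> \<le> norm (s m - s n) * (4 / d * (4 / d))"
      using Gs d by (intro mult_left_mono order_trans[OF norm_blinfun_compose] mult_mono) auto
    finally show ?thesis
      by (simp add: mult.commute)
  qed
  from lipschitz_sequence_convergent[OF this s_lim]
  obtain S where S: "(\<lambda>n. G (s n)) \<longlonglongrightarrow> S"
    by blast
  have linS: "complex_linear S"
    by (rule complex_linear_LIMSEQ[OF S]) (rule pseudo_resolvent_linear[OF G sD])
  have symS: "cinner (S x) y = cinner x (S y)" for x y
  proof (rule symmetric_LIMSEQ[OF S])
    fix n x y
    have "cnj (1 / (\<mu> - s n)) = 1 / (\<mu> - s n)"
      using \<mu> s_real by (simp add: Reals_cnj_iff)
    then show "cinner (G (s n) x) y = cinner x (G (s n) y)"
      by (simp add: G_def cinner_simps symF symP blinfun.bilinear_simps)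
  qed
  have SG: "S - G w = (\<mu> - w) *\<^sub>C (S o\<^sub>L G w)" if w: "w \<in> D" for w
  proof (rule LIMSEQ_unique)
    show "(\<lambda>n. G (s n) - G w) \<longlonglongrightarrow> S - G w"
      by (intro tendsto_diff tendsto_const S)
    show "(\<lambda>n. G (s n) - G w) \<longlonglongrightarrow> (\<mu> - w) *\<^sub>C (S o\<^sub>L G w)"
      unfolding pseudo_resolvent_diff[OF G sD w]
      by (intro tendsto_scaleC_blinfun tendsto_compose_blinfun tendsto_diff tendsto_const S s_lim)
  qed
  have GS: "G w - S = (w - \<mu>) *\<^sub>C (G w o\<^sub>L S)" if w: "w \<in> D" for w
  proof (rule LIMSEQ_unique)
    show "(\<lambda>n. G w - G (s n)) \<longlonglongrightarrow> G w - S"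
      by (intro tendsto_diff tendsto_const S)
    show "(\<lambda>n. G w - G (s n)) \<longlonglongrightarrow> (w - \<mu>) *\<^sub>C (G w o\<^sub>L S)"
      unfolding pseudo_resolvent_diff[OF G w sD]
      by (intro tendsto_scaleC_blinfun tendsto_compose_blinfun tendsto_diff tendsto_const S s_lim)
  qed
  show thesis
  proof
    show "complex_linear P" "complex_linear S"
      by (rule linP, rule linS)
    show "P\<^sup>\<dagger> = P" "S\<^sup>\<dagger> = S"
      by (rule hilbert_adjoint_unique, rule symP, rule hilbert_adjoint_unique, rule symS)
    show "P o\<^sub>L S = 0"
    proof (rule LIMSEQ_unique)
      show "(\<lambda>n. P o\<^sub>L G (s n)) \<longlonglongrightarrow> (P o\<^sub>L S)"
        by (intro tendsto_compose_blinfun tendsto_const S)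
    qed (simp add: PG sD)
    show "(\<mu> - z) *\<^sub>C (F z o\<^sub>L P) = P" if "z \<in> ball \<mu> d - {\<mu>}" for z
      using FP that unfolding D_def by blast
    have Gif: "(if z = \<mu> then S else F z - (1 / (\<mu> - z)) *\<^sub>C P) = (if z = \<mu> then S else G z)" for z
      by (simp add: G_def)
    show "pseudo_resolvent (\<lambda>z. if z = \<mu> then S else F z - (1 / (\<mu> - z)) *\<^sub>C P) (ball \<mu> d)"
      unfolding Gif pseudo_resolvent_def
    proof (intro conjI ballI)
      fix z w assume "z \<in> ball \<mu> d" "w \<in> ball \<mu> d"
      then have "z = \<mu> \<or> z \<in> D" "w = \<mu> \<or> w \<in> D"
        by (auto simp: D_def)
      then show "(if z = \<mu> then S else G z) - (if w = \<mu> then S else G w)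
          = (z - w) *\<^sub>C ((if z = \<mu> then S else G z) o\<^sub>L (if w = \<mu> then S else G w))"
        using SG GS pseudo_resolvent_diff[OF G] by auto
    next
      fix z assume "z \<in> ball \<mu> d"
      then show "complex_linear (if z = \<mu> then S else G z)"
        using linS pseudo_resolvent_linear[OF G] by (auto simp: D_def)
    qed
  qed
qed

section \<open>Boundary triplets and Krein-type resolvent formulas\<close>

lemma symplectic_J_apply: "\<J> f = (snd f, - fst f)"
  by (rule symplectic_J.rep_eq[THEN fun_cong])

lemma symplectic_J_surj: "\<exists>g. f = \<J> g"
  by (rule exI[of _ "(- snd f, fst f)"]) (simp add: symplectic_J_apply)

locale boundary_triplet_setting =
  fixes A :: "'h::complex_hilbert \<rightharpoonup> 'h" and \<Gamma>\<^sub>0 \<Gamma>\<^sub>1 :: "'h \<Rightarrow> 'k::complex_hilbert"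
    and T :: "'h \<Rightarrow> 'k \<times> 'k"
  assumes dense: "densely_defined A" and triplet: "boundary_triplet A \<Gamma>\<^sub>0 \<Gamma>\<^sub>1"
    and T_eq: "T = (\<lambda>u. (\<Gamma>\<^sub>0 u, \<Gamma>\<^sub>1 u))"
begin

abbreviation "D \<equiv> dom (op_adjoint A)"
abbreviation "As \<equiv> \<lambda>u. the (op_adjoint A u)"

lemma As_test: "u \<in> D \<Longrightarrow> x \<in> dom A \<Longrightarrow> cinner (the (A x)) u = cinner x (As u)"
  using op_adjoint_eq_Some_iff[OF dense] by (metis domIff option.collapse)

lemma As_eqI:
  assumes "\<And>x. x \<in> dom A \<Longrightarrow> cinner (the (A x)) u = cinner x v"
  shows "u \<in> D" "As u = v"
proof -
  have "op_adjoint A u = Some v"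
    using assms op_adjoint_eq_Some_iff[OF dense] by blast
  then show "u \<in> D" "As u = v"
    by auto
qed

lemma As_linear: "linear_operator (op_adjoint A)"
proof -
  have add: "u + v \<in> D" "As (u + v) = As u + As v" if "u \<in> D" "v \<in> D" for u v
  proof -
    have "cinner (the (A x)) (u + v) = cinner x (As u + As v)" if "x \<in> dom A" for x
      by (simp only: cinner_simps As_test \<open>u \<in> D\<close> \<open>v \<in> D\<close> that)
    from As_eqI[OF this] show "u + v \<in> D" "As (u + v) = As u + As v"
      by blast+
  qed
  have scaleC: "c *\<^sub>C u \<in> D" "As (c *\<^sub>C u) = c *\<^sub>C As u" if "u \<in> D" for c u
  proof -
    have "cinner (the (A x)) (c *\<^sub>C u) = cinner x (c *\<^sub>C As u)" if "x \<in> dom A" for x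
      by (simp only: cinner_simps As_test \<open>u \<in> D\<close> that)
    from As_eqI[OF this] show "c *\<^sub>C u \<in> D" "As (c *\<^sub>C u) = c *\<^sub>C As u"
      by blast+
  qed
  have "0 \<in> D"
    by (rule As_eqI(1)[of 0 0]) simp
  then have "complex_vector.subspace D"
    using add scaleC by (intro complex_vector.subspaceI) auto
  then show ?thesis
    unfolding linear_operator_def using add scaleC by blast
qed

lemmas As_facts = linear_operator_facts[OF As_linear]

lemma
  shows T_add: "u \<in> D \<Longrightarrow> v \<in> D \<Longrightarrow> T (u + v) = T u + T v"
    and T_scaleC: "u \<in> D \<Longrightarrow> T (c *\<^sub>C u) = c *\<^sub>C T u"
    and T_surj: "\<exists>u\<in>D. T u = f"
    and green: "u \<in> D \<Longrightarrow> v \<in> D \<Longrightarrow> cinner (As u) v - cinner u (As v) = cinner (\<J> (T u)) (T v)"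
proof -
  note bt = triplet[unfolded boundary_triplet_def Let_def, folded T_eq]
  show "u \<in> D \<Longrightarrow> v \<in> D \<Longrightarrow> T (u + v) = T u + T v"
    unfolding T_eq using bt by blast
  show "u \<in> D \<Longrightarrow> T (c *\<^sub>C u) = c *\<^sub>C T u"
    unfolding T_eq using bt by blast
  have "f \<in> T ` D"
    using bt by blast
  then show "\<exists>u\<in>D. T u = f"
    by blast
  show "u \<in> D \<Longrightarrow> v \<in> D \<Longrightarrow> cinner (As u) v - cinner u (As v) = cinner (\<J> (T u)) (T v)"
    using bt by (simp add: symplectic_form_J[symmetric] symplectic_form_def T_eq)
qed

lemma T_diff: "u \<in> D \<Longrightarrow> v \<in> D \<Longrightarrow> T (u - v) = T u - T v"
  using T_add[of u "(- 1) *\<^sub>C v"] T_scaleC[of v "- 1"] As_facts(2)[of v "- 1"] by simp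

lemma T_bounded: "\<exists>K\<ge>0. \<forall>u\<in>D. norm (T u) \<le> K * (norm u + norm (As u))"
proof -
  obtain K where K: "\<And>u. u \<in> D \<Longrightarrow> norm (T u) \<le> K * graph_norm (op_adjoint A) u"
    using triplet unfolding boundary_triplet_def Let_def T_eq by blast
  have "norm (T u) \<le> \<bar>K\<bar> * (norm u + norm (As u))" if u: "u \<in> D" for u
  proof -
    have g: "graph_norm (op_adjoint A) u = sqrt ((norm u)\<^sup>2 + (norm (As u))\<^sup>2)"
      by (simp add: graph_norm_def graph_cinner_def cinner_norm)
    have "norm (T u) \<le> K * graph_norm (op_adjoint A) u"
      by (rule K[OF u])
    also have "\<dots> \<le> \<bar>K\<bar> * graph_norm (op_adjoint A) u"
      unfolding g by (intro mult_right_mono) auto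
    also have "\<dots> \<le> \<bar>K\<bar> * (norm u + norm (As u))"
      unfolding g by (intro mult_left_mono sqrt_sum_squares_le_sum) auto
    finally show ?thesis .
  qed
  then show ?thesis
    by (intro exI[of _ "\<bar>K\<bar>"]) auto
qed

lemma boundary_compose:
  fixes X :: "'a::complex_hilbert \<Rightarrow>\<^sub>L 'h"
  assumes lin: "complex_linear X" and dom: "\<And>x. X x \<in> D" and bound: "\<And>x. norm (As (X x)) \<le> C * norm x"
  shows "(T \<odot> X) x = T (X x)" and "complex_linear (T \<odot> X)"
proof -
  obtain K where K: "K \<ge> 0" "\<And>u. u \<in> D \<Longrightarrow> norm (T u) \<le> K * (norm u + norm (As u))"
    using T_bounded by blast
  have "bounded_linear (\<lambda>x. T (X x))"
  proof (rule bounded_linear_intro)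
    fix x y and r :: real
    show "T (X (x + y)) = T (X x) + T (X y)"
      by (simp add: blinfun.bilinear_simps T_add dom)
    show "T (X (r *\<^sub>R x)) = r *\<^sub>R T (X x)"
      by (simp add: scaleR_scaleC complex_linear_apply[OF lin] T_scaleC dom)
    have "norm (T (X x)) \<le> K * (norm (X x) + norm (As (X x)))"
      by (rule K(2)[OF dom])
    also have "\<dots> \<le> K * (norm X * norm x + C * norm x)"
      by (intro mult_left_mono add_mono norm_blinfun bound K(1))
    finally show "norm (T (X x)) \<le> norm x * (K * (norm X + C))"
      by (simp add: algebra_simps)
  qed
  then have app: "(T \<odot> X) x = T (X x)" for x
    unfolding boundary_compose_def by (simp add: bounded_linear_Blinfun_apply)
  then show "(T \<odot> X) x = T (X x)" .
  show "complex_linear (T \<odot> X)"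
    unfolding complex_linear_def app by (simp add: complex_linear_apply[OF lin] T_scaleC dom)
qed

definition extension :: "('k \<times> 'k) \<Rightarrow>\<^sub>L ('k \<times> 'k) \<Rightarrow> ('h \<rightharpoonup> 'h) \<Rightarrow> bool" where
  "extension Q B \<longleftrightarrow> orthogonal_projection Q \<and> lagrangian (range Q) \<and> self_adjoint B
     \<and> A \<subseteq>\<^sub>m B \<and> T ` dom B = range Q"

context
  fixes Q B assumes ext: "extension Q B"
begin

lemma ext_self_adjoint: "self_adjoint B"
  using ext unfolding extension_def by blast

lemma Q_linear: "complex_linear Q"
  using ext unfolding extension_def orthogonal_projection_def by blast

lemma Q_idem: "Q (Q f) = Q f"
proof -
  have "Q o\<^sub>L Q = Q"
    using ext unfolding extension_def orthogonal_projection_def by blast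
  then show ?thesis
    by (metis blinfun_apply_blinfun_compose)
qed

lemma Q_symmetric: "cinner (Q f) g = cinner f (Q g)"
proof -
  have "Q\<^sup>\<dagger> = Q"
    using ext unfolding extension_def orthogonal_projection_def by blast
  then show ?thesis
    using cinner_adjoint[OF Q_linear] by simp
qed

lemma ext_dom:
  assumes u: "u \<in> dom B"
  shows "u \<in> D" "As u = the (B u)"
proof -
  have "cinner (the (A x)) u = cinner x (the (B u))" if x: "x \<in> dom A" for x
  proof -
    have "A x = B x" "x \<in> dom B"
      using ext x unfolding extension_def map_le_def by (auto dest: bspec)
    then show ?thesis
      using self_adjoint_symmetric[OF ext_self_adjoint _ u] by simp
  qed
  from As_eqI[OF this] show "u \<in> D" "As u = the (B u)"
    by auto
qed

lemma ext_Q_T: "u \<in> dom B \<Longrightarrow> Q (T u) = T u"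
proof -
  assume "u \<in> dom B"
  then have "T u \<in> range Q"
    using ext unfolding extension_def by blast
  then show ?thesis
    using Q_idem by auto
qed

lemma ext_T_surj: "\<exists>u\<in>dom B. T u = Q f"
  using ext unfolding extension_def by (metis imageE rangeI)

text \<open>Choose \<open>v \<in> dom B\<close> with the boundary values of \<open>u\<close>. By Green's formula, \<open>n = u - v\<close> satisfies
  \<open>\<langle>B x, n\<rangle> = \<langle>x, A\<^sup>* n\<rangle>\<close> for all \<open>x \<in> dom B\<close>, so \<open>n\<close> lies in \<open>dom (B\<^sup>*) = dom B\<close>.\<close>

lemma ext_domI:
  assumes u: "u \<in> D" and Tu: "T u \<in> range Q"
  shows "u \<in> dom B"
proof -
  obtain v where v: "v \<in> dom B" "T v = T u"
    using ext Tu unfolding extension_def by (metis imageE)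
  have n: "u - v \<in> D" "T (u - v) = 0"
    using u ext_dom[OF v(1)] v(2) by (simp_all add: As_facts T_diff)
  have "cinner (the (B x)) (u - v) = cinner x (As (u - v))" if x: "x \<in> dom B" for x
    using green[OF ext_dom(1)[OF x] n(1)] ext_dom(2)[OF x] n(2) by simp
  from self_adjoint_domI(1)[OF ext_self_adjoint this] have "u - v \<in> dom B"
    by blast
  moreover have "linear_operator B"
    using ext_self_adjoint unfolding self_adjoint_def by blast
  ultimately have "u - v + v \<in> dom B"
    using v(1) linear_operator_add_dom by blast
  then show ?thesis
    by simp
qed

lemma Q_J_Q: "Q (\<J> (Q f)) = 0"
proof (rule cinner_eq_all_left)
  fix g
  have "symplectic_form (Q f) (Q g) = 0"
    using ext unfolding extension_def lagrangian_def by blast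
  then show "cinner (Q (\<J> (Q f))) g = cinner 0 g"
    by (simp add: Q_symmetric symplectic_form_J)
qed

lemma lagrangian_memI:
  assumes "Q (\<J> f) = 0"
  shows "f \<in> range Q"
proof -
  have "symplectic_form f (Q g) = 0" for g
    by (simp add: symplectic_form_J assms flip: Q_symmetric)
  then have "f \<in> {f. \<forall>g\<in>range Q. symplectic_form f g = 0}"
    by blast
  then show ?thesis
    using ext unfolding extension_def lagrangian_def by blast
qed

end

text \<open>The gamma field turns boundary data into solutions of \<open>A\<^sup>* u = z u\<close>, and the Weyl function
  assigns to the data the boundary values of the solution. Both are taken on all of
  \<open>'k \<times> 'k\<close> rather than on the range of the projection that belongs to \<open>B\<close>.\<close>

definition gamma_field :: "('h \<rightharpoonup> 'h) \<Rightarrow> complex \<Rightarrow> ('k \<times> 'k) \<Rightarrow>\<^sub>L 'h" where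
  "gamma_field B z = (T \<odot> resolvent B (cnj z))\<^sup>\<dagger>"

definition weyl_function :: "('h \<rightharpoonup> 'h) \<Rightarrow> complex \<Rightarrow> ('k \<times> 'k) \<Rightarrow>\<^sub>L ('k \<times> 'k)" where
  "weyl_function B z = T \<odot> gamma_field B z"

context
  fixes Q B z assumes ext: "extension Q B" and z: "z \<notin> spectrum B"
begin

private lemma R: "is_resolvent_at B z (resolvent B z)"
  by (rule is_resolvent_at_resolvent[OF z])

lemma resolvent_linear: "complex_linear (resolvent B z)"
  by (rule is_resolvent_linear[OF R])

lemma resolvent_dom: "resolvent B z x \<in> dom B" "resolvent B z x \<in> D"
  using is_resolvent_dom[OF R] ext_dom[OF ext] by blast+

lemma As_resolvent: "As (resolvent B z x) = x + z *\<^sub>C resolvent B z x"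
  using ext_dom(2)[OF ext is_resolvent_dom[OF R]] is_resolvent_right[OF R] by simp

lemma T_resolvent:
  shows T_resolvent_apply: "(T \<odot> resolvent B z) x = T (resolvent B z x)"
    and T_resolvent_linear: "complex_linear (T \<odot> resolvent B z)"
proof -
  have "norm (As (resolvent B z x)) \<le> (1 + cmod z * norm (resolvent B z)) * norm x" for x
  proof -
    have "norm (As (resolvent B z x)) \<le> norm x + cmod z * norm (resolvent B z x)"
      unfolding As_resolvent by (rule order_trans[OF norm_triangle_ineq]) (simp add: norm_scaleC)
    also have "\<dots> \<le> norm x + cmod z * (norm (resolvent B z) * norm x)"
      by (intro add_left_mono mult_left_mono norm_blinfun) simp
    finally show ?thesis
      by (simp add: algebra_simps)
  qed
  from boundary_compose[OF resolvent_linear resolvent_dom(2) this]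
  show "(T \<odot> resolvent B z) x = T (resolvent B z x)" "complex_linear (T \<odot> resolvent B z)"
    by auto
qed

end

context
  fixes Q B z assumes ext: "extension Q B" and z: "z \<notin> spectrum B"
begin

private lemma z': "cnj z \<notin> spectrum B"
  by (rule resolvent_cnj(1)[OF ext_self_adjoint[OF ext] z])

lemma gamma_field_linear: "complex_linear (gamma_field B z)"
  unfolding gamma_field_def by (intro complex_linear_intros T_resolvent_linear[OF ext z'])

lemma cinner_gamma_field: "cinner (gamma_field B z f) x = cinner f (T (resolvent B (cnj z) x))"
  by (simp add: gamma_field_def cinner_adjoint'[OF T_resolvent_linear[OF ext z']]
      T_resolvent_apply[OF ext z'])

lemma gamma_field_Q: "gamma_field B z (Q f) = gamma_field B z f"
  by (rule cinner_eq_all_left)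
    (simp add: cinner_gamma_field Q_symmetric[OF ext] ext_Q_T[OF ext] resolvent_dom[OF ext z'])

text \<open>This is Green's formula for \<open>u\<close> and \<open>w = R(cnj z) y\<close>, with arbitrary \<open>y\<close>. For \<open>u\<close> in
  \<open>ker (A\<^sup>* - z)\<close> it shows that the gamma field recovers \<open>- u\<close> from its boundary values; for \<open>u\<close> in the
  range of another resolvent it is the Krein formula.\<close>

lemma gamma_field_green:
  assumes u: "u \<in> D"
  shows "gamma_field B z (\<J> (T u)) = resolvent B z (As u - z *\<^sub>C u) - u"
proof (rule cinner_eq_all_left)
  fix y
  define w where "w = resolvent B (cnj z) y"
  have w: "w \<in> D" "As w = y + cnj z *\<^sub>C w"
    unfolding w_def using resolvent_dom[OF ext z'] As_resolvent[OF ext z'] by auto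
  have adj: "cinner (resolvent B z x) y = cinner x w" for x
    unfolding w_def resolvent_cnj(2)[OF ext_self_adjoint[OF ext] z]
    by (rule cinner_adjoint[OF resolvent_linear[OF ext z]])
  have "cinner (gamma_field B z (\<J> (T u))) y = cinner (\<J> (T u)) (T w)"
    unfolding cinner_gamma_field w_def ..
  also have "\<dots> = cinner (As u) w - cinner u (As w)"
    by (simp add: green[OF u w(1)])
  also have "\<dots> = cinner (resolvent B z (As u - z *\<^sub>C u) - u) y"
    unfolding cinner_diff_left adj w(2) by (simp add: cinner_simps)
  finally show "cinner (gamma_field B z (\<J> (T u))) y = cinner (resolvent B z (As u - z *\<^sub>C u) - u) y" .
qed

lemma gamma_field_kernel: "gamma_field B z f \<in> D" "As (gamma_field B z f) = z *\<^sub>C gamma_field B z f"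
proof -
  obtain g where g: "f = \<J> g"
    using symplectic_J_surj by blast
  obtain u where u: "u \<in> D" "T u = g"
    using T_surj by blast
  have eq: "gamma_field B z f = resolvent B z (As u - z *\<^sub>C u) - u"
    using gamma_field_green[OF u(1)] by (simp add: u(2) g)
  show "gamma_field B z f \<in> D"
    unfolding eq by (intro As_facts u resolvent_dom[OF ext z])
  show "As (gamma_field B z f) = z *\<^sub>C gamma_field B z f"
    unfolding eq As_facts(7)[OF resolvent_dom(2)[OF ext z] u(1)] As_resolvent[OF ext z]
    by (simp add: complex_vector.scale_right_diff_distrib)
qed

lemma weyl_function:
  shows weyl_function_apply: "weyl_function B z f = T (gamma_field B z f)"
    and weyl_function_linear: "complex_linear (weyl_function B z)"
proof -
  have "norm (As (gamma_field B z f)) \<le> (cmod z * norm (gamma_field B z)) * norm f" for f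
    unfolding gamma_field_kernel norm_scaleC mult.assoc by (intro mult_left_mono norm_blinfun) simp
  from boundary_compose[OF gamma_field_linear gamma_field_kernel(1) this]
  show "weyl_function B z f = T (gamma_field B z f)" "complex_linear (weyl_function B z)"
    unfolding weyl_function_def by auto
qed

end

text \<open>The boundary values of \<open>R x\<close>, where \<open>R\<close> is the resolvent of the extension given by \<open>Q\<close>, lie
  in \<open>ran Q\<close>, and \<open>\<J>\<close> maps them into the kernel of \<open>Q\<close>. The gamma field of \<open>B'\<close> sees its argument
  only through \<open>Q'\<close>. This is how the difference \<open>Q' - Q\<close> enters.\<close>

lemma krein_formula:
  assumes ext: "extension Q B" and z: "z \<notin> spectrum B"
    and ext': "extension Q' B'" and z': "z \<notin> spectrum B'"
  shows "resolvent B' z = resolvent B z + (gamma_field B' z o\<^sub>L (Q' - Q) o\<^sub>L \<J> o\<^sub>L (T \<odot> resolvent B z))"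
proof (rule blinfun_eqI)
  fix x
  define u where "u = resolvent B z x"
  have u: "u \<in> D" "As u = x + z *\<^sub>C u" "Q (T u) = T u"
    unfolding u_def using resolvent_dom[OF ext z] As_resolvent[OF ext z] ext_Q_T[OF ext] by auto
  have "Q (\<J> (T u)) = 0"
    using Q_J_Q[OF ext, of "T u"] u(3) by simp
  then have "gamma_field B' z ((Q' - Q) (\<J> (T u))) = gamma_field B' z (\<J> (T u))"
    by (simp add: blinfun.bilinear_simps gamma_field_Q[OF ext' z'])
  also have "\<dots> = resolvent B' z x - u"
    unfolding gamma_field_green[OF ext' z' u(1)] u(2) by simp
  finally show "resolvent B' z x
      = (resolvent B z + (gamma_field B' z o\<^sub>L (Q' - Q) o\<^sub>L \<J> o\<^sub>L (T \<odot> resolvent B z))) x"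
    by (simp add: blinfun.bilinear_simps T_resolvent_apply[OF ext z] u_def)
qed

lemma T_resolvent_perturbed:
  assumes ext: "extension Q B" and z: "z \<notin> spectrum B"
    and ext': "extension Q' B'" and z': "z \<notin> spectrum B'"
  shows "T \<odot> resolvent B' z = (T \<odot> resolvent B z)
    + (weyl_function B z o\<^sub>L (Q' - Q) o\<^sub>L \<J> o\<^sub>L (T \<odot> resolvent B' z))"
proof (rule blinfun_eqI)
  fix x
  define g where "g = (Q' - Q) (\<J> (T (resolvent B' z x)))"
  have "resolvent B z x = resolvent B' z x - gamma_field B z g"
    unfolding krein_formula[OF ext' z' ext z] g_def
    by (simp add: blinfun.bilinear_simps T_resolvent_apply[OF ext' z'])
  then have "resolvent B' z x = resolvent B z x + gamma_field B z g"
    by simp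
  then have "T (resolvent B' z x) = T (resolvent B z x) + T (gamma_field B z g)"
    using T_add resolvent_dom[OF ext z] gamma_field_kernel[OF ext z] by simp
  then show "(T \<odot> resolvent B' z) x = ((T \<odot> resolvent B z)
      + (weyl_function B z o\<^sub>L (Q' - Q) o\<^sub>L \<J> o\<^sub>L (T \<odot> resolvent B' z))) x"
    by (simp only: blinfun.add_left blinfun_apply_blinfun_compose T_resolvent_apply[OF ext' z']
        T_resolvent_apply[OF ext z] weyl_function_apply[OF ext z] g_def)
qed

text \<open>Solvability of \<open>(B' - z) u = y\<close> for \<open>Q'\<close> near \<open>Q\<close>: the boundary value \<open>f = T u\<close> of a solution
  satisfies the fixed point equation \<open>f = T R y + W (Q' - Q) J f\<close>, a contraction. Conversely the
  fixed point defines \<open>u\<close> with \<open>(A\<^sup>* - z) u = y\<close> and \<open>T u = f\<close>, and comparison with Green's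
  formula shows \<open>Q Q' J f = 0\<close>; as \<open>\<parallel>Q' - Q\<parallel> < 1\<close>, this forces \<open>f \<in> ran Q'\<close>.\<close>

lemma resolvent_set_stable:
  assumes ext: "extension Q B" and z: "z \<notin> spectrum B" and ext': "extension Q' B'"
    and near: "norm (Q' - Q) < 1"
    and small: "norm (weyl_function B z o\<^sub>L (Q' - Q) o\<^sub>L \<J>) \<le> 1 / 2"
  shows "z \<notin> spectrum B'" and "norm (T \<odot> resolvent B' z) \<le> 2 * norm (T \<odot> resolvent B z)"
proof -
  define N where "N = weyl_function B z o\<^sub>L (Q' - Q) o\<^sub>L \<J>"
  define G where "G = gamma_field B z o\<^sub>L (Q' - Q) o\<^sub>L \<J>"
  have N: "norm (N f) \<le> 1 / 2 * norm f" for f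
    using norm_blinfun[of N f] mult_right_mono[OF small, of "norm f"] by (simp add: N_def)
  have TG: "T (G f) = N f" and GD: "G f \<in> D" "As (G f) = z *\<^sub>C G f" for f
    using gamma_field_kernel[OF ext z] by (simp_all add: N_def G_def weyl_function_apply[OF ext z])
  have fixp_bound: "norm f \<le> 2 * norm g" if "f = g + N f" for f g
    using norm_triangle_ineq[of g "N f"] N[of f] that by simp
  have sol: "u = resolvent B z x + G (T u)" "norm (T u) \<le> 2 * norm (T (resolvent B z x))"
    if u: "u \<in> dom B'" and x: "x = the (B' u) - z *\<^sub>C u" for u x
  proof -
    have uD: "u \<in> D" "As u = the (B' u)" "Q' (T u) = T u"
      using ext_dom[OF ext' u] ext_Q_T[OF ext' u] by auto
    have "Q' (\<J> (T u)) = 0"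
      using Q_J_Q[OF ext', of "T u"] uD(3) by simp
    then have "G (T u) = - gamma_field B z (\<J> (T u))"
      by (simp add: G_def blinfun.bilinear_simps gamma_field_Q[OF ext z])
    also have "\<dots> = u - resolvent B z x"
      unfolding gamma_field_green[OF ext z uD(1)] uD(2) x by simp
    finally show eq: "u = resolvent B z x + G (T u)"
      by simp
    have "T u = T (resolvent B z x) + N (T u)"
      using arg_cong[OF eq, of T] T_add[OF resolvent_dom(2)[OF ext z] GD(1)] by (simp add: TG)
    then show "norm (T u) \<le> 2 * norm (T (resolvent B z x))"
      by (rule fixp_bound)
  qed
  have TR: "norm (T (resolvent B z x)) \<le> norm (T \<odot> resolvent B z) * norm x" for x
    using norm_blinfun[of "T \<odot> resolvent B z" x] by (simp add: T_resolvent_apply[OF ext z])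
  have surj: "\<exists>u\<in>dom B'. the (B' u) - z *\<^sub>C u = y" for y
  proof -
    have "\<exists>!f. T (resolvent B z y) + N f = f"
    proof (rule banach_fix_type[where c = "1/2"], goal_cases)
      case 3
      show ?case
        by (simp only: dist_norm add_diff_cancel_left blinfun.diff_right[symmetric] N simp_thms)
    qed simp_all
    then obtain f where f: "f = T (resolvent B z y) + N f"
      by metis
    define u where "u = resolvent B z y + G f"
    have uD: "u \<in> D"
      unfolding u_def by (intro As_facts resolvent_dom[OF ext z] GD)
    have Tu: "T u = f"
      using f by (simp add: u_def T_add[OF resolvent_dom(2)[OF ext z] GD(1)] TG)
    have Asu: "As u = y + z *\<^sub>C u"
      unfolding u_def As_facts(5)[OF resolvent_dom(2)[OF ext z] GD(1)] As_resolvent[OF ext z] GD(2)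
      by (simp add: scaleC_add_right)
    have "gamma_field B z (\<J> f) = - G f"
      using gamma_field_green[OF ext z uD] unfolding Tu Asu by (simp add: u_def)
    then have zero: "gamma_field B z (Q (Q' (\<J> f))) = 0"
      by (simp add: G_def blinfun.bilinear_simps gamma_field_Q[OF ext z])
    define g where "g = Q (Q' (\<J> f))"
    obtain v where v: "v \<in> dom B" "T v = g"
      using ext_T_surj[OF ext] unfolding g_def by blast
    have "v = resolvent B (cnj z) (the (B v) - cnj z *\<^sub>C v)"
      using is_resolvent_left[OF is_resolvent_at_resolvent[OF resolvent_cnj(1)[OF ext_self_adjoint[OF ext] z]] v(1)]
      by simp
    then have "cinner g g = 0"
      using cinner_gamma_field[OF ext z, of g "the (B v) - cnj z *\<^sub>C v"] zero v(2) by (simp add: g_def)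
    then have g0: "Q (Q' (\<J> f)) = 0"
      by (simp add: g_def)
    have "norm (Q' (\<J> f)) = norm ((Q' - Q) (Q' (\<J> f)))"
      by (simp add: blinfun.bilinear_simps g0 Q_idem[OF ext'])
    also have "\<dots> \<le> norm (Q' - Q) * norm (Q' (\<J> f))"
      by (rule norm_blinfun)
    finally have "Q' (\<J> f) = 0"
      using near by (metis mult_le_cancel_right1 norm_eq_zero norm_ge_zero not_less order_le_less)
    then have "u \<in> dom B'"
      using ext_domI[OF ext' uD] lagrangian_memI[OF ext'] Tu by blast
    then show ?thesis
      using Asu ext_dom(2)[OF ext'] by (intro bexI[of _ u]) auto
  qed
  have bound: "norm u \<le> (norm (resolvent B z) + norm G * (2 * norm (T \<odot> resolvent B z))) * norm (the (B' u) - z *\<^sub>C u)"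
    if u: "u \<in> dom B'" for u
  proof -
    define x where "x = the (B' u) - z *\<^sub>C u"
    note s = sol[OF u x_def]
    have "norm u \<le> norm (resolvent B z x) + norm (G (T u))"
      by (subst s(1)) (rule norm_triangle_ineq)
    also have "\<dots> \<le> norm (resolvent B z) * norm x + norm G * norm (T u)"
      by (intro add_mono norm_blinfun)
    also have "\<dots> \<le> norm (resolvent B z) * norm x
        + norm G * (2 * (norm (T \<odot> resolvent B z) * norm x))"
      using s(2) TR[of x] by (intro add_left_mono mult_left_mono) auto
    finally show ?thesis
      unfolding x_def[symmetric] by (simp add: algebra_simps)
  qed
  have "linear_operator B'"
    using ext_self_adjoint[OF ext'] unfolding self_adjoint_def by blast
  then show z': "z \<notin> spectrum B'"
    by (rule resolvent_existsI[OF _ surj bound])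
  show "norm (T \<odot> resolvent B' z) \<le> 2 * norm (T \<odot> resolvent B z)"
  proof (rule norm_blinfun_bound)
    fix x
    define u where "u = resolvent B' z x"
    have "u \<in> dom B'" "x = the (B' u) - z *\<^sub>C u"
      using is_resolvent_at_resolvent[OF z'] by (auto simp: u_def is_resolvent_dom is_resolvent_right)
    from sol(2)[OF this] TR[of x]
    show "norm ((T \<odot> resolvent B' z) x) \<le> 2 * norm (T \<odot> resolvent B z) * norm x"
      by (simp add: T_resolvent_apply[OF ext' z'] u_def)
  qed simp
qed

text \<open>Inserting the perturbation formula for the boundary values of \<open>R'\<close> twice into the Krein
  formula expands the resolvent up to an error of third order in \<open>Q' - Q\<close>.\<close>

lemma resolvent_second_order:
  assumes ext: "extension Q B" and z: "z \<notin> spectrum B"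
    and ext': "extension Q' B'" and z': "z \<notin> spectrum B'"
  defines "E \<equiv> (Q' - Q) o\<^sub>L \<J>" and "W \<equiv> weyl_function B (cnj z)"
  shows "resolvent B' z - resolvent B z
      - ((T \<odot> resolvent B (cnj z))\<^sup>\<dagger> o\<^sub>L E o\<^sub>L (T \<odot> resolvent B z))
      - ((W o\<^sub>L E o\<^sub>L (T \<odot> resolvent B (cnj z)))\<^sup>\<dagger> o\<^sub>L E o\<^sub>L (T \<odot> resolvent B z))
    = (W o\<^sub>L E o\<^sub>L W o\<^sub>L E o\<^sub>L (T \<odot> resolvent B' (cnj z)))\<^sup>\<dagger> o\<^sub>L E o\<^sub>L (T \<odot> resolvent B z)"
proof -
  have cz: "cnj z \<notin> spectrum B" "cnj z \<notin> spectrum B'"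
    using resolvent_cnj(1)[OF ext_self_adjoint[OF ext] z]
      resolvent_cnj(1)[OF ext_self_adjoint[OF ext'] z'] by auto
  define X where "X = T \<odot> resolvent B (cnj z)"
  define X' where "X' = T \<odot> resolvent B' (cnj z)"
  have lin: "complex_linear X" "complex_linear X'" "complex_linear W" "complex_linear E"
    unfolding X_def X'_def W_def E_def using T_resolvent_linear[OF ext cz(1)]
      T_resolvent_linear[OF ext' cz(2)] weyl_function_linear[OF ext cz(1)] Q_linear[OF ext] Q_linear[OF ext']
    by (auto intro!: complex_linear_intros)
  have step: "X' = X + (W o\<^sub>L E o\<^sub>L X')"
    using T_resolvent_perturbed[OF ext cz(1) ext' cz(2)]
    unfolding X_def X'_def W_def E_def by (simp add: compose_assoc)
  then have "X' = X + (W o\<^sub>L E o\<^sub>L X) + (W o\<^sub>L E o\<^sub>L W o\<^sub>L E o\<^sub>L X')"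
    by (metis (no_types, lifting) add.assoc compose_assoc blinfun_compose_distribs(2))
  then have "X'\<^sup>\<dagger> = X\<^sup>\<dagger> + (W o\<^sub>L E o\<^sub>L X)\<^sup>\<dagger> + (W o\<^sub>L E o\<^sub>L W o\<^sub>L E o\<^sub>L X')\<^sup>\<dagger>"
    using lin by (metis adjoint_add complex_linear_add complex_linear_compose)
  moreover have "resolvent B' z - resolvent B z = (X'\<^sup>\<dagger> o\<^sub>L E o\<^sub>L (T \<odot> resolvent B z))"
    using krein_formula[OF ext z ext' z'] by (simp add: gamma_field_def X'_def E_def compose_assoc)
  ultimately show ?thesis
    unfolding X_def[symmetric] X'_def[symmetric] by (simp add: blinfun_compose_distribs)
qed

end

section \<open>Laurent expansions at an isolated eigenvalue\<close>

lemma expansion_compose_const_right: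
  assumes "open D" "expansion \<mu> D F a b c" "complex_linear K"
  shows "expansion \<mu> D (\<lambda>z. F z o\<^sub>L K) (a o\<^sub>L K) (b o\<^sub>L K) (c o\<^sub>L K)"
  using expansion_compose[OF assms(1,2) expansion_const[OF assms(3)]] by simp

lemma expansion_compose_const_left:
  assumes "open D" "expansion \<mu> D F a b c" "complex_linear K"
  shows "expansion \<mu> D (\<lambda>z. K o\<^sub>L F z) (K o\<^sub>L a) (K o\<^sub>L b) (K o\<^sub>L c)"
  using expansion_compose[OF assms(1) expansion_const[OF assms(3)] assms(2)] by simp

text \<open>The coefficients of the Laurent series of the resolvent: the powers of \<open>S\<close> come from iterating
  the resolvent identity for the reduced resolvent between \<open>\<mu>\<close> and \<open>z\<close>.\<close>

lemma resolvent_laurent: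
  fixes B :: "'h::complex_hilbert \<rightharpoonup> 'h"
  assumes B: "self_adjoint B" and \<mu>: "\<mu> \<in> \<real>" and r: "0 < r" "r < d"
    and iso: "ball \<mu> d \<inter> spectrum B \<subseteq> {\<mu>}"
  defines "P \<equiv> circle_residue \<mu> r (resolvent B)"
    and "S \<equiv> circle_residue \<mu> r (\<lambda>z. inverse (\<mu> - z) *\<^sub>C resolvent B z)"
  shows "complex_linear P" "complex_linear S" "P\<^sup>\<dagger> = P" "S\<^sup>\<dagger> = S" "P o\<^sub>L S = 0"
    and "\<And>z. z \<in> ball \<mu> d - {\<mu>} \<Longrightarrow> P = resolvent B z o\<^sub>L ((\<mu> - z) *\<^sub>C P)"
    and "\<And>z. z \<in> ball \<mu> d - {\<mu>} \<Longrightarrow> S = resolvent B z o\<^sub>L (id_blinfun - P + (\<mu> - z) *\<^sub>C S)"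
    and "expansion \<mu> (ball \<mu> d) (\<lambda>z. (\<mu> - z) *\<^sub>C resolvent B z) P S (- (S o\<^sub>L S))"
proof -
  have d: "d > 0"
    using r by simp
  have ps: "pseudo_resolvent (resolvent B) (ball \<mu> d - {\<mu>})"
    using iso by (intro pseudo_resolvent_subset[OF pseudo_resolvent_resolvent]) auto
  have sym: "cinner (resolvent B s x) y = cinner x (resolvent B s y)"
    if "s \<in> \<real>" "s \<in> ball \<mu> d - {\<mu>}" for s x y
  proof -
    have "s \<notin> spectrum B"
      using that iso by blast
    from resolvent_cnj(2)[OF B this] have "(resolvent B s)\<^sup>\<dagger> = resolvent B s"
      using that(1) by (simp add: Reals_cnj_iff)
    then show ?thesis
      using cinner_adjoint[OF pseudo_resolvent_linear[OF ps that(2)]] by metis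
  qed
  obtain P0 S0 where lin: "complex_linear P0" "complex_linear S0" and adj: "P0\<^sup>\<dagger> = P0" "S0\<^sup>\<dagger> = S0"
    and PS: "P0 o\<^sub>L S0 = 0"
    and RP: "\<And>z. z \<in> ball \<mu> d - {\<mu>} \<Longrightarrow> (\<mu> - z) *\<^sub>C (resolvent B z o\<^sub>L P0) = P0"
    and G: "pseudo_resolvent (\<lambda>z. if z = \<mu> then S0 else resolvent B z - (1 / (\<mu> - z)) *\<^sub>C P0) (ball \<mu> d)"
    using isolated_point_simple_pole[OF d \<mu> ps sym] by blast
  define G where "G = (\<lambda>z. if z = \<mu> then S0 else resolvent B z - (1 / (\<mu> - z)) *\<^sub>C P0)"
  note G = G[folded G_def]
  have \<mu>d: "\<mu> \<in> ball \<mu> d"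
    using d by simp
  have G\<mu>: "G \<mu> = S0"
    by (simp add: G_def)
  have SG: "G z = S0 - (\<mu> - z) *\<^sub>C (S0 o\<^sub>L G z)" and GS: "S0 = G z + (\<mu> - z) *\<^sub>C (G z o\<^sub>L S0)"
    if "z \<in> ball \<mu> d" for z
    using pseudo_resolvent_diff[OF G \<mu>d that] pseudo_resolvent_diff[OF G that \<mu>d]
      pseudo_resolvent_commute[OF G \<mu>d that] unfolding G\<mu> by (simp_all add: algebra_simps)
  have wR: "(\<mu> - z) *\<^sub>C resolvent B z = P0 + (\<mu> - z) *\<^sub>C G z" if "z \<in> ball \<mu> d - {\<mu>}" for z
  proof -
    have "\<mu> - z \<noteq> 0"
      using that by auto
    then have "(\<mu> - z) *\<^sub>C ((1 / (\<mu> - z)) *\<^sub>C P0) = P0"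
      by simp
    moreover have "resolvent B z = (1 / (\<mu> - z)) *\<^sub>C P0 + G z"
      using that by (simp add: G_def)
    ultimately show ?thesis
      by (simp only: scaleC_blinfun_distribs(2))
  qed
  have ex: "expansion \<mu> (ball \<mu> d) (\<lambda>z. (\<mu> - z) *\<^sub>C resolvent B z) P0 S0 (- (S0 o\<^sub>L S0))"
    unfolding expansion_def
  proof (intro conjI exI ballI)
    show "op_holomorphic (\<lambda>z. (S0 o\<^sub>L S0) o\<^sub>L G z) (ball \<mu> d)"
      by (intro op_holomorphic_compose[OF op_holomorphic_const] pseudo_resolvent_holomorphic[OF G]
          complex_linear_intros lin) simp
    fix z assume z: "z \<in> ball \<mu> d - {\<mu>}"
    define w where "w = \<mu> - z"
    have "G z = S0 - w *\<^sub>C (S0 o\<^sub>L (S0 - w *\<^sub>C (S0 o\<^sub>L G z)))"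
      using SG[of z] z unfolding w_def by (metis DiffD1)
    then have "G z = S0 + w *\<^sub>C (- (S0 o\<^sub>L S0)) + w ^ 2 *\<^sub>C ((S0 o\<^sub>L S0) o\<^sub>L G z)"
      by (simp add: blinfun_compose_distribs compose_scaleC_right lin scaleC_blinfun_distribs
          compose_assoc power2_eq_square algebra_simps)
    then have "w *\<^sub>C G z = w *\<^sub>C (S0 + w *\<^sub>C (- (S0 o\<^sub>L S0)) + w ^ 2 *\<^sub>C ((S0 o\<^sub>L S0) o\<^sub>L G z))"
      by (rule arg_cong)
    then show "(\<mu> - z) *\<^sub>C resolvent B z = P0 + (\<mu> - z) *\<^sub>C S0 + (\<mu> - z) ^ 2 *\<^sub>C (- (S0 o\<^sub>L S0))
        + (\<mu> - z) ^ 3 *\<^sub>C ((S0 o\<^sub>L S0) o\<^sub>L G z)"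
      unfolding wR[OF z] unfolding w_def[symmetric]
      by (simp only: scaleC_blinfun_distribs scaleC_blinfun_scaleC power2_eq_square power3_eq_cube
          ac_simps)
  qed (intro complex_linear_intros lin)+
  have nz: "\<mu> - z \<noteq> 0" if "z \<in> sphere \<mu> r" for z
    using that r by auto
  have "P = circle_residue \<mu> r (\<lambda>z. (1 / (\<mu> - z)) *\<^sub>C ((\<mu> - z) *\<^sub>C resolvent B z))"
    unfolding P_def using r by (intro circle_residue_cong) (auto dest: nz)
  then have P: "P = P0"
    using circle_residue_expansion1[OF r ex] by simp
  have "S = circle_residue \<mu> r (\<lambda>z. (1 / (\<mu> - z) ^ 2) *\<^sub>C ((\<mu> - z) *\<^sub>C resolvent B z))"
    unfolding S_def using r
    by (intro circle_residue_cong) (auto dest: nz simp: power2_eq_square divide_simps)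
  then have S: "S = S0"
    using circle_residue_expansion2[OF r ex] by simp
  show "complex_linear P" "complex_linear S" "P\<^sup>\<dagger> = P" "S\<^sup>\<dagger> = S" "P o\<^sub>L S = 0"
    unfolding P S by (rule lin adj PS)+
  show "expansion \<mu> (ball \<mu> d) (\<lambda>z. (\<mu> - z) *\<^sub>C resolvent B z) P S (- (S o\<^sub>L S))"
    unfolding P S by (rule ex)
  fix z assume z: "z \<in> ball \<mu> d - {\<mu>}"
  note linR = pseudo_resolvent_linear[OF ps z]
  have w0: "\<mu> - z \<noteq> 0"
    using z by auto
  show RP': "P = resolvent B z o\<^sub>L ((\<mu> - z) *\<^sub>C P)"
    unfolding P using RP[OF z] by (simp add: compose_scaleC_right linR)
  have "G z = resolvent B z - (1 / (\<mu> - z)) *\<^sub>C P"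
    using z by (simp add: G_def P)
  also have "(1 / (\<mu> - z)) *\<^sub>C P = resolvent B z o\<^sub>L P"
    using w0 by (subst RP') (simp add: compose_scaleC_right linR)
  finally have Gz: "G z = resolvent B z o\<^sub>L (id_blinfun - P)"
    by (simp add: blinfun_compose_distribs)
  have "S = G z + (\<mu> - z) *\<^sub>C (G z o\<^sub>L S)"
    unfolding S using GS z by blast
  also have "G z o\<^sub>L S = resolvent B z o\<^sub>L S"
    unfolding Gz using PS by (simp add: compose_assoc blinfun_compose_distribs P S)
  finally show "S = resolvent B z o\<^sub>L (id_blinfun - P + (\<mu> - z) *\<^sub>C S)"
    unfolding Gz blinfun_compose_distribs(2) compose_scaleC_right[OF linR] .
qed

lemma boundary_compose_eqI:
  fixes T :: "'h::complex_hilbert \<Rightarrow> 'b::complex_hilbert" and X :: "'a::complex_hilbert \<Rightarrow>\<^sub>L 'h::complex_hilbert"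
    and Y :: "'a \<Rightarrow>\<^sub>L 'b"
  assumes "\<And>x. T (X x) = Y x"
  shows "T \<odot> X = Y"
  unfolding boundary_compose_def assms by (rule blinfun_apply_inverse)

context boundary_triplet_setting
begin

text \<open>The operator \<open>(B - s)(B - z)\<^sup>-\<^sup>1\<close>. Through it, \<open>T R(z)\<close>, the gamma field and the Weyl function
  at \<open>z\<close> are expressed by their values at a fixed real point \<open>s\<close>, so that their dependence on \<open>z\<close> is
  that of a bounded operator in the Hilbert space of \<open>B\<close>.\<close>

definition transfer :: "('h \<rightharpoonup> 'h) \<Rightarrow> complex \<Rightarrow> complex \<Rightarrow> 'h \<Rightarrow>\<^sub>L 'h" where
  "transfer B s z = id_blinfun + (z - s) *\<^sub>C resolvent B z"

lemma base_point_formulas: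
  assumes ext: "extension Q B" and s: "s \<in> \<real>" "s \<notin> spectrum B" and z: "z \<notin> spectrum B"
  defines "b \<equiv> T \<odot> resolvent B s"
  shows T_resolvent_base: "T \<odot> resolvent B z = b o\<^sub>L transfer B s z"
    and gamma_base: "(T \<odot> resolvent B (cnj z))\<^sup>\<dagger> = transfer B s z o\<^sub>L b\<^sup>\<dagger>"
    and weyl_base: "weyl_function B z = weyl_function B s
      + (z - s) *\<^sub>C (b o\<^sub>L transfer B s z o\<^sub>L b\<^sup>\<dagger>)"
    and weyl_base_adjoint: "(weyl_function B (cnj z))\<^sup>\<dagger> = (weyl_function B s)\<^sup>\<dagger>
      + (z - s) *\<^sub>C (b o\<^sub>L transfer B s z o\<^sub>L b\<^sup>\<dagger>)"
    and gamma_base_real: "gamma_field B s = b\<^sup>\<dagger>"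
proof -
  have cs: "cnj s = s"
    using s(1) by (simp add: Reals_cnj_iff)
  note B = ext_self_adjoint[OF ext]
  have gamma: "gamma_field B s = b\<^sup>\<dagger>"
    by (simp add: gamma_field_def b_def cs)
  then show "gamma_field B s = b\<^sup>\<dagger>" .
  have tr_lin: "complex_linear (transfer B s u)" if "u \<notin> spectrum B" for u
    unfolding transfer_def by (intro complex_linear_intros resolvent_linear[OF ext that])
  have tr_adj: "(transfer B s (cnj u))\<^sup>\<dagger> = transfer B s u" if "u \<notin> spectrum B" for u
    using resolvent_linear[OF ext resolvent_cnj(1)[OF B that]] resolvent_cnj[OF B that]
      adjoint_adjoint[OF resolvent_linear[OF ext that]]
    by (simp add: transfer_def adjoint_add adjoint_scaleC adjoint_id complex_linear_intros cs)
  have base: "T \<odot> resolvent B u = b o\<^sub>L transfer B s u" if u: "u \<notin> spectrum B" for u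
  proof (rule boundary_compose_eqI)
    fix x
    have "resolvent B u - resolvent B s = (u - s) *\<^sub>C (resolvent B s o\<^sub>L resolvent B u)"
      using pseudo_resolvent_diff[OF pseudo_resolvent_resolvent, of u B s]
        pseudo_resolvent_commute[OF pseudo_resolvent_resolvent, of u B s] u s by simp
    then have "resolvent B u = resolvent B s + (u - s) *\<^sub>C (resolvent B s o\<^sub>L resolvent B u)"
      by (metis add_diff_cancel_left' diff_add_cancel add.commute)
    then have "resolvent B u = resolvent B s o\<^sub>L transfer B s u"
      by (simp add: transfer_def blinfun_compose_distribs compose_scaleC_right resolvent_linear[OF ext s(2)])
    then have "resolvent B u x = resolvent B s (transfer B s u x)"
      by (metis blinfun_apply_blinfun_compose)
    then show "T (resolvent B u x) = (b o\<^sub>L transfer B s u) x"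
      by (simp add: b_def T_resolvent_apply[OF ext s(2)])
  qed
  show "T \<odot> resolvent B z = b o\<^sub>L transfer B s z"
    by (rule base[OF z])
  note linB = T_resolvent_linear[OF ext s(2), folded b_def]
  have gbase: "gamma_field B u = transfer B s u o\<^sub>L b\<^sup>\<dagger>" if u: "u \<notin> spectrum B" for u
    unfolding gamma_field_def base[OF resolvent_cnj(1)[OF B u]]
      adjoint_compose[OF linB tr_lin[OF resolvent_cnj(1)[OF B u]]] tr_adj[OF u] ..
  show "(T \<odot> resolvent B (cnj z))\<^sup>\<dagger> = transfer B s z o\<^sub>L b\<^sup>\<dagger>"
    using gbase[OF z] by (simp add: gamma_field_def)
  have wbase: "weyl_function B u = weyl_function B s
      + (u - s) *\<^sub>C (b o\<^sub>L transfer B s u o\<^sub>L b\<^sup>\<dagger>)"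
    if u: "u \<notin> spectrum B" for u
    unfolding weyl_function_def[of _ u]
  proof (rule boundary_compose_eqI)
    fix f
    define g where "g = (b\<^sup>\<dagger>) f"
    have g: "g \<in> D" "T g = weyl_function B s f"
      using gamma_field_kernel(1)[OF ext s(2), of f] weyl_function_apply[OF ext s(2), of f]
      by (simp_all add: g_def gamma)
    have "gamma_field B u f = g + (u - s) *\<^sub>C resolvent B u g"
      by (simp add: gbase[OF u] transfer_def blinfun.bilinear_simps g_def)
    then have "T (gamma_field B u f) = weyl_function B s f + (u - s) *\<^sub>C (T \<odot> resolvent B u) g"
      using g resolvent_dom(2)[OF ext u] As_facts(2)
      by (simp add: T_add T_scaleC T_resolvent_apply[OF ext u])
    then show "T (gamma_field B u f) = (weyl_function B s
        + (u - s) *\<^sub>C (b o\<^sub>L transfer B s u o\<^sub>L b\<^sup>\<dagger>)) f"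
      by (simp add: blinfun.bilinear_simps g_def base[OF u])
  qed
  show "weyl_function B z = weyl_function B s
      + (z - s) *\<^sub>C (b o\<^sub>L transfer B s z o\<^sub>L b\<^sup>\<dagger>)"
    by (rule wbase[OF z])
  show "(weyl_function B (cnj z))\<^sup>\<dagger> = (weyl_function B s)\<^sup>\<dagger>
      + (z - s) *\<^sub>C (b o\<^sub>L transfer B s z o\<^sub>L b\<^sup>\<dagger>)"
    unfolding wbase[OF resolvent_cnj(1)[OF B z]]
    using linB tr_lin[OF resolvent_cnj(1)[OF B z]] weyl_function_linear[OF ext s(2)]
    by (simp add: adjoint_add adjoint_scaleC adjoint_compose adjoint_adjoint complex_linear_intros
        tr_adj[OF z] cs compose_assoc)
qed

lemma continuous_on_boundary_maps:
  assumes ext: "extension Q B" and s: "s \<in> \<real>" "s \<notin> spectrum B"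
  shows "continuous_on (- spectrum B) (\<lambda>z. T \<odot> resolvent B z)"
    and "continuous_on (- spectrum B) (\<lambda>z. (T \<odot> resolvent B (cnj z))\<^sup>\<dagger>)"
    and "continuous_on (- spectrum B) (weyl_function B)"
    and "continuous_on (- spectrum B) (\<lambda>z. (weyl_function B (cnj z))\<^sup>\<dagger>)"
proof -
  have "continuous_on (- spectrum B) (transfer B s)"
    unfolding transfer_def
    by (intro continuous_intros bounded_bilinear.continuous_on[OF bounded_bilinear_scaleC_blinfun]
        pseudo_resolvent_continuous_on pseudo_resolvent_resolvent)
  note cont = this continuous_intros bounded_bilinear.continuous_on[OF bounded_bilinear_scaleC_blinfun]
    bounded_bilinear.continuous_on[OF bounded_bilinear_blinfun_compose]
  note base = base_point_formulas[OF ext s]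
  have "continuous_on (- spectrum B) (\<lambda>z. (T \<odot> resolvent B s) o\<^sub>L transfer B s z)"
    by (intro cont)
  then show "continuous_on (- spectrum B) (\<lambda>z. T \<odot> resolvent B z)"
    by (rule continuous_on_eq) (simp add: base(1))
  have "continuous_on (- spectrum B) (\<lambda>z. transfer B s z o\<^sub>L (T \<odot> resolvent B s)\<^sup>\<dagger>)"
    by (intro cont)
  then show "continuous_on (- spectrum B) (\<lambda>z. (T \<odot> resolvent B (cnj z))\<^sup>\<dagger>)"
    by (rule continuous_on_eq) (simp add: base(2))
  have "continuous_on (- spectrum B) (\<lambda>z. weyl_function B s
      + (z - s) *\<^sub>C ((T \<odot> resolvent B s) o\<^sub>L transfer B s z o\<^sub>L (T \<odot> resolvent B s)\<^sup>\<dagger>))"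
    by (intro cont)
  then show "continuous_on (- spectrum B) (weyl_function B)"
    by (rule continuous_on_eq) (simp add: base(3))
  have "continuous_on (- spectrum B) (\<lambda>z. (weyl_function B s)\<^sup>\<dagger>
      + (z - s) *\<^sub>C ((T \<odot> resolvent B s) o\<^sub>L transfer B s z o\<^sub>L (T \<odot> resolvent B s)\<^sup>\<dagger>))"
    by (intro cont)
  then show "continuous_on (- spectrum B) (\<lambda>z. (weyl_function B (cnj z))\<^sup>\<dagger>)"
    by (rule continuous_on_eq) (simp add: base(4))
qed

text \<open>The Laurent coefficients of \<open>T R\<close>, of the gamma field and of the adjoint Weyl function arise
  from \<open>P\<close>, \<open>S\<close> and \<open>- S\<^sup>2\<close> by applying the respective operation to each coefficient. The formulas at the
  base point reduce the claims about boundary maps to the expansion of the resolvent, and show that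
  the ranges of \<open>(T \<odot> X)\<^sup>\<dagger>\<close> lie in \<open>D\<close>, where \<open>T\<close> acts as a bounded operator.\<close>

lemma boundary_laurent:
  assumes ext: "extension Q B" and \<mu>: "\<mu> \<in> \<real>" and r: "0 < r" "r < d"
    and iso: "ball \<mu> d \<inter> spectrum B \<subseteq> {\<mu>}"
  defines "P \<equiv> circle_residue \<mu> r (resolvent B)"
    and "S \<equiv> circle_residue \<mu> r (\<lambda>z. inverse (\<mu> - z) *\<^sub>C resolvent B z)"
  shows "expansion \<mu> (ball \<mu> d) (\<lambda>z. (\<mu> - z) *\<^sub>C (T \<odot> resolvent B z)) (T \<odot> P) (T \<odot> S) (- (T \<odot> (S o\<^sub>L S)))"
      (is ?B)
    and "expansion \<mu> (ball \<mu> d) (\<lambda>z. (\<mu> - z) *\<^sub>C (T \<odot> resolvent B (cnj z))\<^sup>\<dagger>)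
      ((T \<odot> P)\<^sup>\<dagger>) ((T \<odot> S)\<^sup>\<dagger>) (- (T \<odot> (S o\<^sub>L S))\<^sup>\<dagger>)" (is ?G)
    and "expansion \<mu> (ball \<mu> d) (\<lambda>z. (\<mu> - z) *\<^sub>C (weyl_function B (cnj z))\<^sup>\<dagger>)
      ((T \<odot> (T \<odot> P)\<^sup>\<dagger>)\<^sup>\<dagger>) ((T \<odot> (T \<odot> S)\<^sup>\<dagger>)\<^sup>\<dagger>) (- (T \<odot> (T \<odot> (S o\<^sub>L S))\<^sup>\<dagger>)\<^sup>\<dagger>)" (is ?W)
    and "X \<in> {P, S, S o\<^sub>L S} \<Longrightarrow> complex_linear (T \<odot> X)"
    and "X \<in> {P, S, S o\<^sub>L S} \<Longrightarrow> complex_linear (T \<odot> (T \<odot> X)\<^sup>\<dagger>)"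
    and "X \<in> {P, S, S o\<^sub>L S} \<Longrightarrow> T \<odot> ((T \<odot> X)\<^sup>\<dagger> o\<^sub>L Z) = (T \<odot> (T \<odot> X)\<^sup>\<dagger>) o\<^sub>L (Z :: 'a::complex_hilbert \<Rightarrow>\<^sub>L ('k \<times> 'k))"
proof -
  define s where "s = \<mu> + of_real r"
  have s: "s \<in> \<real>" "s \<in> ball \<mu> d - {\<mu>}"
    using \<mu> r by (auto simp: s_def dist_norm)
  then have s': "s \<notin> spectrum B"
    using iso by blast
  have cs: "cnj (\<mu> - s) = \<mu> - s"
    using s(1) \<mu> by (simp add: Reals_cnj_iff)
  note laurent = resolvent_laurent[OF ext_self_adjoint[OF ext] \<mu> r iso, folded P_def S_def]
  note lin = laurent(1,2)
  note base = base_point_formulas[OF ext s(1) s']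
  define B1 where "B1 = T \<odot> resolvent B s"
  define Rs where "Rs = resolvent B s"
  define M where "M = weyl_function B s"
  have linR: "complex_linear Rs"
    unfolding Rs_def by (rule resolvent_linear[OF ext s'])
  have linB: "complex_linear B1" and linM: "complex_linear M"
    unfolding B1_def M_def by (rule T_resolvent_linear[OF ext s'] weyl_function_linear[OF ext s'])+
  define a where "a = (\<mu> - s) *\<^sub>C P"
  define b where "b = id_blinfun - P + (\<mu> - s) *\<^sub>C S"
  define c where "c = S + (\<mu> - s) *\<^sub>C (S o\<^sub>L S)"
  have linabc: "complex_linear a" "complex_linear b" "complex_linear c"
    unfolding a_def b_def c_def by (intro complex_linear_intros lin)+
  have Pa: "P = Rs o\<^sub>L a" and Sb: "S = Rs o\<^sub>L b"
    unfolding Rs_def a_def b_def by (rule laurent(6)[OF s(2)], rule laurent(7)[OF s(2)])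
  have "b o\<^sub>L S = c"
    by (simp add: b_def c_def blinfun_compose_distribs compose_scaleC_left laurent(5))
  then have SSc: "S o\<^sub>L S = Rs o\<^sub>L c"
    using compose_assoc[of Rs b S] Sb by simp
  have T_Rs: "T (Rs x) = B1 x" for x
    by (simp add: B1_def Rs_def T_resolvent_apply[OF ext s'])
  have Rs_D: "Rs x \<in> D" for x
    by (simp add: Rs_def resolvent_dom[OF ext s'])
  have TX: "T \<odot> X = B1 o\<^sub>L Y" if "X = Rs o\<^sub>L Y" for X Y :: "'h \<Rightarrow>\<^sub>L 'h"
    using that T_Rs by (intro boundary_compose_eqI) simp
  have TP: "T \<odot> P = B1 o\<^sub>L a" and TS: "T \<odot> S = B1 o\<^sub>L b" and TSS: "T \<odot> (S o\<^sub>L S) = B1 o\<^sub>L c"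
    by (rule TX[OF Pa], rule TX[OF Sb], rule TX[OF SSc])
  have adj: "a\<^sup>\<dagger> = a" "b\<^sup>\<dagger> = b" "c\<^sup>\<dagger> = c"
    using lin laurent(3,4) cs by (simp_all add: a_def b_def c_def adjoint_add adjoint_diff
        adjoint_scaleC adjoint_compose adjoint_id complex_linear_intros)
  have TP': "(T \<odot> P)\<^sup>\<dagger> = a o\<^sub>L B1\<^sup>\<dagger>" and TS': "(T \<odot> S)\<^sup>\<dagger> = b o\<^sub>L B1\<^sup>\<dagger>"
    and TSS': "(T \<odot> (S o\<^sub>L S))\<^sup>\<dagger> = c o\<^sub>L B1\<^sup>\<dagger>"
    unfolding TP TS TSS by (simp_all add: adjoint_compose linB linabc adj)
  have gB: "((B1\<^sup>\<dagger>) f) \<in> D" "T ((B1\<^sup>\<dagger>) f) = M f" for f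
    using gamma_field_kernel(1)[OF ext s', of f] weyl_function_apply[OF ext s', of f]
    unfolding base(5)[OF s'] B1_def M_def by auto
  \<comment> \<open>The range of \<open>B1\<^sup>\<dagger>\<close> lies in \<open>D\<close>, but in general not in \<open>dom B\<close>. The part \<open>\<epsilon> B1\<^sup>\<dagger>\<close> contributes the Weyl
    function \<open>M\<close> at \<open>s\<close>; on the rest, \<open>T\<close> acts through \<open>T R(s) = B1\<close>.\<close>
  have TXX: "T \<odot> (((\<epsilon> *\<^sub>C id_blinfun + (Rs o\<^sub>L K)) o\<^sub>L B1\<^sup>\<dagger>) o\<^sub>L Z)
      = (\<epsilon> *\<^sub>C M + (B1 o\<^sub>L K o\<^sub>L B1\<^sup>\<dagger>)) o\<^sub>L Z"
    for \<epsilon> K and Z :: "'b::complex_hilbert \<Rightarrow>\<^sub>L ('k \<times> 'k)"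
    by (rule boundary_compose_eqI)
      (simp add: blinfun.bilinear_simps T_add T_scaleC gB Rs_D T_Rs As_facts)
  have a': "a = 0 *\<^sub>C id_blinfun + (Rs o\<^sub>L ((\<mu> - s) *\<^sub>C a))"
    by (simp add: compose_scaleC_right linR flip: Pa) (simp add: a_def)
  have b': "b = 1 *\<^sub>C id_blinfun + (Rs o\<^sub>L ((\<mu> - s) *\<^sub>C b - a))"
    by (simp add: blinfun_compose_distribs compose_scaleC_right linR flip: Pa Sb) (simp add: b_def)
  have c': "c = 0 *\<^sub>C id_blinfun + (Rs o\<^sub>L (b + (\<mu> - s) *\<^sub>C c))"
    by (simp add: blinfun_compose_distribs compose_scaleC_right linR flip: Sb SSc) (simp add: c_def)
  define NP where "NP = B1 o\<^sub>L ((\<mu> - s) *\<^sub>C a) o\<^sub>L B1\<^sup>\<dagger>"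
  define NS where "NS = M + (B1 o\<^sub>L ((\<mu> - s) *\<^sub>C b - a) o\<^sub>L B1\<^sup>\<dagger>)"
  define NSS where "NSS = B1 o\<^sub>L (b + (\<mu> - s) *\<^sub>C c) o\<^sub>L B1\<^sup>\<dagger>"
  have NZ: "T \<odot> ((T \<odot> P)\<^sup>\<dagger> o\<^sub>L Z) = NP o\<^sub>L Z" "T \<odot> ((T \<odot> S)\<^sup>\<dagger> o\<^sub>L Z) = NS o\<^sub>L Z"
    "T \<odot> ((T \<odot> (S o\<^sub>L S))\<^sup>\<dagger> o\<^sub>L Z) = NSS o\<^sub>L Z" for Z :: "'b::complex_hilbert \<Rightarrow>\<^sub>L ('k \<times> 'k)"
    using TXX[of 0 "(\<mu> - s) *\<^sub>C a" Z, folded a'] TXX[of 1 "(\<mu> - s) *\<^sub>C b - a" Z, folded b']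
      TXX[of 0 "b + (\<mu> - s) *\<^sub>C c" Z, folded c']
    by (simp_all add: TP' TS' TSS' NP_def NS_def NSS_def)
  have N: "T \<odot> (T \<odot> P)\<^sup>\<dagger> = NP" "T \<odot> (T \<odot> S)\<^sup>\<dagger> = NS" "T \<odot> (T \<odot> (S o\<^sub>L S))\<^sup>\<dagger> = NSS"
    using NZ[of id_blinfun] by simp_all
  have linN: "complex_linear NP" "complex_linear NS" "complex_linear NSS"
    unfolding NP_def NS_def NSS_def by (intro complex_linear_intros linabc linB linM)+
  show "X \<in> {P, S, S o\<^sub>L S} \<Longrightarrow> complex_linear (T \<odot> X)"
    using TP TS TSS linabc linB by (auto intro!: complex_linear_intros)
  show "X \<in> {P, S, S o\<^sub>L S} \<Longrightarrow> complex_linear (T \<odot> (T \<odot> X)\<^sup>\<dagger>)"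
    using N linN by auto
  show "X \<in> {P, S, S o\<^sub>L S} \<Longrightarrow> T \<odot> ((T \<odot> X)\<^sup>\<dagger> o\<^sub>L Z) = (T \<odot> (T \<odot> X)\<^sup>\<dagger>) o\<^sub>L Z"
    using N NZ by auto
  have NP': "NP\<^sup>\<dagger> = B1 o\<^sub>L ((\<mu> - s) *\<^sub>C a) o\<^sub>L B1\<^sup>\<dagger>"
    and NS': "NS\<^sup>\<dagger> = M\<^sup>\<dagger> + (B1 o\<^sub>L ((\<mu> - s) *\<^sub>C b - a) o\<^sub>L B1\<^sup>\<dagger>)"
    and NSS': "NSS\<^sup>\<dagger> = B1 o\<^sub>L (b + (\<mu> - s) *\<^sub>C c) o\<^sub>L B1\<^sup>\<dagger>"
    unfolding NP_def NS_def NSS_def using linabc linB linM adj cs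
    by (simp_all add: adjoint_add adjoint_diff adjoint_scaleC adjoint_compose adjoint_adjoint
        complex_linear_intros compose_assoc)
  note opn = open_ball[of \<mu> d]
  have ns: "z \<notin> spectrum B" if "z \<in> ball \<mu> d - {\<mu>}" for z
    using that iso by blast
  have cong: "expansion \<mu> (ball \<mu> d) F' x y w" if "expansion \<mu> (ball \<mu> d) F x y w"
      "\<And>z. z \<in> ball \<mu> d - {\<mu>} \<Longrightarrow> F z = F' z"
    for F F' :: "complex \<Rightarrow> 'b::complex_hilbert \<Rightarrow>\<^sub>L 'c::complex_hilbert" and x y w
    using that unfolding expansion_def by auto
  have scal: "(\<mu> - s) + (- 1) * (\<mu> - z) = z - s" "0 + 1 * (\<mu> - z) = \<mu> - z" for z
    by simp_all
  have exU: "expansion \<mu> (ball \<mu> d) (\<lambda>z. (\<mu> - z) *\<^sub>C transfer B s z) a b (- c)"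
  proof (rule cong)
    show "expansion \<mu> (ball \<mu> d)
        (\<lambda>z. (0 + 1 * (\<mu> - z)) *\<^sub>C id_blinfun + ((\<mu> - s) + (- 1) * (\<mu> - z)) *\<^sub>C ((\<mu> - z) *\<^sub>C resolvent B z))
        a b (- c)"
      using expansion_add[OF expansion_scalar[OF opn expansion_const[OF complex_linear_id], of \<mu> 0 1]
          expansion_scalar[OF opn laurent(8), of "\<mu> - s" "- 1"]]
      by (simp add: a_def b_def c_def scaleC_blinfun_distribs algebra_simps)
  qed (simp only: scal transfer_def scaleC_blinfun_distribs(2) scaleC_blinfun_scaleC mult.commute)
  show ?B
  proof (rule cong)
    show "expansion \<mu> (ball \<mu> d) (\<lambda>z. B1 o\<^sub>L ((\<mu> - z) *\<^sub>C transfer B s z)) (T \<odot> P) (T \<odot> S) (- (T \<odot> (S o\<^sub>L S)))"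
      using expansion_compose_const_left[OF opn exU linB]
      by (simp add: TP TS TSS blinfun_compose_distribs)
  qed (simp add: base(1)[OF ns] B1_def[symmetric] compose_scaleC_right linB)
  show ?G
  proof (rule cong)
    show "expansion \<mu> (ball \<mu> d) (\<lambda>z. ((\<mu> - z) *\<^sub>C transfer B s z) o\<^sub>L B1\<^sup>\<dagger>)
        ((T \<odot> P)\<^sup>\<dagger>) ((T \<odot> S)\<^sup>\<dagger>) (- (T \<odot> (S o\<^sub>L S))\<^sup>\<dagger>)"
      using expansion_compose_const_right[OF opn exU complex_linear_adjoint[OF linB]]
      by (simp add: TP' TS' TSS' blinfun_compose_distribs)
  qed (simp add: base(2)[OF ns] B1_def[symmetric] compose_scaleC_left)
  show ?W
  proof (rule cong)
    have ex2: "expansion \<mu> (ball \<mu> d) (\<lambda>z. B1 o\<^sub>L ((\<mu> - z) *\<^sub>C transfer B s z) o\<^sub>L B1\<^sup>\<dagger>)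
        (B1 o\<^sub>L a o\<^sub>L B1\<^sup>\<dagger>) (B1 o\<^sub>L b o\<^sub>L B1\<^sup>\<dagger>) (B1 o\<^sub>L (- c) o\<^sub>L B1\<^sup>\<dagger>)"
      by (intro expansion_compose_const_right[OF opn] expansion_compose_const_left[OF opn] exU
          complex_linear_intros linB)
    show "expansion \<mu> (ball \<mu> d) (\<lambda>z. (0 + 1 * (\<mu> - z)) *\<^sub>C M\<^sup>\<dagger>
        + ((\<mu> - s) + (- 1) * (\<mu> - z)) *\<^sub>C (B1 o\<^sub>L ((\<mu> - z) *\<^sub>C transfer B s z) o\<^sub>L B1\<^sup>\<dagger>))
        ((T \<odot> (T \<odot> P)\<^sup>\<dagger>)\<^sup>\<dagger>) ((T \<odot> (T \<odot> S)\<^sup>\<dagger>)\<^sup>\<dagger>) (- (T \<odot> (T \<odot> (S o\<^sub>L S))\<^sup>\<dagger>)\<^sup>\<dagger>)"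
      using expansion_add[OF expansion_scalar[OF opn expansion_const[OF complex_linear_adjoint[OF linM]], of \<mu> 0 1]
          expansion_scalar[OF opn ex2, of "\<mu> - s" "- 1"]]
      unfolding N NP' NS' NSS'
      by (simp add: scaleC_blinfun_distribs blinfun_compose_distribs compose_scaleC_left
          compose_scaleC_right linB algebra_simps)
  qed (simp only: scal base(4)[OF ns] B1_def[symmetric] M_def[symmetric] scaleC_blinfun_distribs(2)
      compose_scaleC_right[OF linB] compose_scaleC_left scaleC_blinfun_scaleC mult.commute)
qed

end

section \<open>Second-order expansion of the Riesz projection\<close>

context boundary_triplet_setting
begin

text \<open>Both outer factors have a simple pole. The coefficient of order \<open>-1\<close> of the product pairs the
  polar part of one factor with the constant term of the other.\<close>

lemma circle_residue_first_order:
  fixes C :: "('k \<times> 'k) \<Rightarrow>\<^sub>L ('k \<times> 'k)"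
  assumes ext: "extension Q B" and \<mu>: "\<mu> \<in> \<real>" and r: "0 < r" "r < d"
    and iso: "ball \<mu> d \<inter> spectrum B \<subseteq> {\<mu>}" and C: "complex_linear C"
  defines "P \<equiv> circle_residue \<mu> r (resolvent B)"
    and "S \<equiv> circle_residue \<mu> r (\<lambda>z. inverse (\<mu> - z) *\<^sub>C resolvent B z)"
  shows "circle_residue \<mu> r (\<lambda>z. (T \<odot> resolvent B (cnj z))\<^sup>\<dagger> o\<^sub>L C o\<^sub>L (T \<odot> resolvent B z))
    = ((T \<odot> P)\<^sup>\<dagger> o\<^sub>L C o\<^sub>L (T \<odot> S)) + ((T \<odot> S)\<^sup>\<dagger> o\<^sub>L C o\<^sub>L (T \<odot> P))"
proof -
  note laurent = boundary_laurent[OF ext \<mu> r iso, folded P_def S_def]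
  define G where "G = (\<lambda>z. (T \<odot> resolvent B (cnj z))\<^sup>\<dagger>)"
  define R where "R = (\<lambda>z. T \<odot> resolvent B z)"
  have ex: "expansion \<mu> (ball \<mu> d) (\<lambda>z. (((\<mu> - z) *\<^sub>C G z) o\<^sub>L C) o\<^sub>L ((\<mu> - z) *\<^sub>C R z))
      ((T \<odot> P)\<^sup>\<dagger> o\<^sub>L C o\<^sub>L (T \<odot> P))
      (((T \<odot> P)\<^sup>\<dagger> o\<^sub>L C o\<^sub>L (T \<odot> S)) + ((T \<odot> S)\<^sup>\<dagger> o\<^sub>L C o\<^sub>L (T \<odot> P)))
      (((T \<odot> P)\<^sup>\<dagger> o\<^sub>L C o\<^sub>L (- (T \<odot> (S o\<^sub>L S)))) + ((T \<odot> S)\<^sup>\<dagger> o\<^sub>L C o\<^sub>L (T \<odot> S))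
        + ((- (T \<odot> (S o\<^sub>L S))\<^sup>\<dagger>) o\<^sub>L C o\<^sub>L (T \<odot> P)))"
    unfolding G_def R_def
    by (intro expansion_compose expansion_compose_const_right laurent(1,2) C open_ball)
  have "circle_residue \<mu> r (\<lambda>z. G z o\<^sub>L C o\<^sub>L R z)
      = circle_residue \<mu> r (\<lambda>z. (1 / (\<mu> - z) ^ 2) *\<^sub>C ((((\<mu> - z) *\<^sub>C G z) o\<^sub>L C) o\<^sub>L ((\<mu> - z) *\<^sub>C R z)))"
  proof (rule circle_residue_cong)
    fix z assume z: "z \<in> sphere \<mu> r"
    then have nz: "\<mu> - z \<noteq> 0" and zB: "z \<notin> spectrum B"
      using r iso by auto
    have "complex_linear (G z)"
      unfolding G_def using T_resolvent_linear[OF ext resolvent_cnj(1)[OF ext_self_adjoint[OF ext] zB]]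
      by (rule complex_linear_adjoint)
    then show "G z o\<^sub>L C o\<^sub>L R z
        = (1 / (\<mu> - z) ^ 2) *\<^sub>C ((((\<mu> - z) *\<^sub>C G z) o\<^sub>L C) o\<^sub>L ((\<mu> - z) *\<^sub>C R z))"
      using nz by (simp add: compose_scaleC_left compose_scaleC_right complex_linear_intros C power2_eq_square)
  qed (use r in simp)
  also have "\<dots> = ((T \<odot> P)\<^sup>\<dagger> o\<^sub>L C o\<^sub>L (T \<odot> S)) + ((T \<odot> S)\<^sup>\<dagger> o\<^sub>L C o\<^sub>L (T \<odot> P))"
    by (rule circle_residue_expansion2[OF r ex])
  finally show ?thesis
    by (simp only: G_def R_def)
qed

text \<open>After taking the adjoint, the integrand is a product of three functions with simple poles:
  gamma field, adjoint Weyl function and \<open>T R\<close>. The orders of the three coefficients add up to \<open>-1\<close>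
  either as \<open>(-1) + 0 + 0\<close> or as \<open>(-1) + (-1) + 1\<close>. The coefficient of order \<open>1\<close> comes from \<open>- S\<^sup>2\<close>,
  hence the three negative terms. In \<open>t X Y Z\<close>, the coefficient \<open>X\<close> stems from the Weyl function, \<open>Y\<close>
  from the gamma field and \<open>Z\<close> from \<open>T R\<close>.\<close>

lemma circle_residue_second_order:
  fixes C :: "('k \<times> 'k) \<Rightarrow>\<^sub>L ('k \<times> 'k)"
  assumes ext: "extension Q B" and \<mu>: "\<mu> \<in> \<real>" and r: "0 < r" "r < d"
    and iso: "ball \<mu> d \<inter> spectrum B \<subseteq> {\<mu>}" and C: "complex_linear C"
  defines "P \<equiv> circle_residue \<mu> r (resolvent B)"
    and "S \<equiv> circle_residue \<mu> r (\<lambda>z. inverse (\<mu> - z) *\<^sub>C resolvent B z)"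
    and "t \<equiv> (\<lambda>X Y Z. (T \<odot> ((T \<odot> X)\<^sup>\<dagger> o\<^sub>L C o\<^sub>L (T \<odot> Y)))\<^sup>\<dagger> o\<^sub>L C o\<^sub>L (T \<odot> Z))"
  shows "circle_residue \<mu> r (\<lambda>z. (weyl_function B (cnj z) o\<^sub>L C o\<^sub>L (T \<odot> resolvent B (cnj z)))\<^sup>\<dagger>
      o\<^sub>L C o\<^sub>L (T \<odot> resolvent B z))
    = t S S P + t S P S + t P S S - t (S o\<^sub>L S) P P - t P (S o\<^sub>L S) P - t P P (S o\<^sub>L S)"
proof -
  note laurent = boundary_laurent[OF ext \<mu> r iso, folded P_def S_def]
  define G where "G = (\<lambda>z. (T \<odot> resolvent B (cnj z))\<^sup>\<dagger>)"
  define W where "W = (\<lambda>z. (weyl_function B (cnj z))\<^sup>\<dagger>)"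
  define R where "R = (\<lambda>z. T \<odot> resolvent B z)"
  have t: "t X Y Z = (T \<odot> Y)\<^sup>\<dagger> o\<^sub>L C\<^sup>\<dagger> o\<^sub>L (T \<odot> (T \<odot> X)\<^sup>\<dagger>)\<^sup>\<dagger> o\<^sub>L C o\<^sub>L (T \<odot> Z)"
    if "X \<in> {P, S, S o\<^sub>L S}" "Y \<in> {P, S, S o\<^sub>L S}" for X Y Z
    using laurent(4)[OF that(2)] laurent(5)[OF that(1)] C
    by (simp add: t_def compose_assoc laurent(6)[OF that(1)] adjoint_compose complex_linear_intros)
  define F where "F = (\<lambda>z. (((((\<mu> - z) *\<^sub>C G z) o\<^sub>L C\<^sup>\<dagger>) o\<^sub>L ((\<mu> - z) *\<^sub>C W z)) o\<^sub>L C) o\<^sub>L ((\<mu> - z) *\<^sub>C R z))"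
  note ex = expansion_compose[OF open_ball expansion_compose_const_right[OF open_ball
    expansion_compose[OF open_ball expansion_compose_const_right[OF open_ball laurent(2)
      complex_linear_adjoint[OF C]] laurent(3)] C] laurent(1)]
  have "circle_residue \<mu> r (\<lambda>z. (weyl_function B (cnj z) o\<^sub>L C o\<^sub>L (T \<odot> resolvent B (cnj z)))\<^sup>\<dagger>
      o\<^sub>L C o\<^sub>L (T \<odot> resolvent B z)) = circle_residue \<mu> r (\<lambda>z. (1 / (\<mu> - z) ^ 3) *\<^sub>C F z)"
  proof (rule circle_residue_cong)
    fix z assume z: "z \<in> sphere \<mu> r"
    then have nz: "\<mu> - z \<noteq> 0" and zB: "z \<notin> spectrum B"
      using r iso by auto
    note cz = resolvent_cnj(1)[OF ext_self_adjoint[OF ext] zB]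
    note lin = T_resolvent_linear[OF ext cz] weyl_function_linear[OF ext cz]
    have linGW: "complex_linear (G z)" "complex_linear (W z)"
      unfolding G_def W_def using lin by (auto intro: complex_linear_adjoint)
    have "(weyl_function B (cnj z) o\<^sub>L C o\<^sub>L (T \<odot> resolvent B (cnj z)))\<^sup>\<dagger> o\<^sub>L C o\<^sub>L (T \<odot> resolvent B z)
        = G z o\<^sub>L C\<^sup>\<dagger> o\<^sub>L W z o\<^sub>L C o\<^sub>L R z"
      unfolding G_def W_def R_def using lin C
      by (simp add: adjoint_compose complex_linear_intros compose_assoc)
    also have "\<dots> = (1 / (\<mu> - z) ^ 3) *\<^sub>C F z"
      using nz linGW C by (simp add: F_def compose_scaleC_left compose_scaleC_right
          complex_linear_intros power3_eq_cube)
    finally show "(weyl_function B (cnj z) o\<^sub>L C o\<^sub>L (T \<odot> resolvent B (cnj z)))\<^sup>\<dagger> o\<^sub>L C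
        o\<^sub>L (T \<odot> resolvent B z) = (1 / (\<mu> - z) ^ 3) *\<^sub>C F z" .
  qed (use r in simp)
  also have "\<dots> = t S S P + t S P S + t P S S - t (S o\<^sub>L S) P P - t P (S o\<^sub>L S) P - t P P (S o\<^sub>L S)"
    unfolding F_def G_def W_def R_def unfolding circle_residue_expansion3[OF r ex]
    by (simp add: t blinfun_compose_distribs algebra_simps)
  finally show ?thesis .
qed

text \<open>The three terms of the bound are the third-order error of the resolvent formula, the error of
  replacing \<open>E\<close> by its second-order expansion in the linear term, and the error of replacing \<open>E\<close> by
  \<open>\<tau> C1\<close> in the quadratic term.\<close>

lemma resolvent_expansion_error:
  fixes C1 C2 :: "('k \<times> 'k) \<Rightarrow>\<^sub>L ('k \<times> 'k)" and \<tau> :: real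
  assumes ext: "extension Q B" and z: "z \<notin> spectrum B"
    and ext': "extension Q' B'" and z': "z \<notin> spectrum B'"
    and C: "complex_linear C1" "complex_linear C2"
    and K: "norm (T \<odot> resolvent B z) \<le> K" "norm (T \<odot> resolvent B (cnj z)) \<le> K"
      "norm (weyl_function B (cnj z)) \<le> K" "norm (T \<odot> resolvent B' (cnj z)) \<le> 2 * K"
  defines "E \<equiv> (Q' - Q) o\<^sub>L \<J>" and "W \<equiv> weyl_function B (cnj z)"
    and "X \<equiv> T \<odot> resolvent B (cnj z)" and "Y \<equiv> T \<odot> resolvent B z"
  shows "norm (resolvent B' z - resolvent B z - (\<tau> *\<^sub>R (X\<^sup>\<dagger> o\<^sub>L C1 o\<^sub>L Y)
      + (1/2 * \<tau>\<^sup>2) *\<^sub>R ((X\<^sup>\<dagger> o\<^sub>L C2 o\<^sub>L Y) + 2 *\<^sub>R ((W o\<^sub>L C1 o\<^sub>L X)\<^sup>\<dagger> o\<^sub>L C1 o\<^sub>L Y))))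
    \<le> 2 * K ^ 4 * norm E ^ 3 + K\<^sup>2 * norm (E - (\<tau> *\<^sub>R C1 + (1/2 * \<tau>\<^sup>2) *\<^sub>R C2))
      + K ^ 3 * norm (E - \<tau> *\<^sub>R C1) * (norm E + \<bar>\<tau>\<bar> * norm C1)"
proof -
  have cz: "cnj z \<notin> spectrum B" "cnj z \<notin> spectrum B'"
    using resolvent_cnj(1)[OF ext_self_adjoint[OF ext] z]
      resolvent_cnj(1)[OF ext_self_adjoint[OF ext'] z'] by auto
  define X' where "X' = T \<odot> resolvent B' (cnj z)"
  have lin: "complex_linear X" "complex_linear X'" "complex_linear W" "complex_linear E"
    unfolding X_def X'_def W_def E_def using T_resolvent_linear[OF ext cz(1)]
      T_resolvent_linear[OF ext' cz(2)] weyl_function_linear[OF ext cz(1)] Q_linear[OF ext] Q_linear[OF ext']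
    by (auto intro!: complex_linear_intros)
  have mul: "norm (F o\<^sub>L G) \<le> a * b" if "norm F \<le> a" "norm G \<le> b"
    for F :: "'b::complex_hilbert \<Rightarrow>\<^sub>L 'c::complex_hilbert" and G :: "'a::complex_hilbert \<Rightarrow>\<^sub>L 'b" and a b
    by (rule order_trans[OF norm_blinfun_compose mult_mono])
      (use that order_trans[OF norm_ge_zero that(1)] in auto)
  have adj: "norm (F\<^sup>\<dagger>) \<le> a" if "complex_linear F" "norm F \<le> a"
    for F :: "'a::complex_hilbert \<Rightarrow>\<^sub>L 'b::complex_hilbert" and a
    using norm_adjoint_le[OF that(1)] that(2) by (rule order_trans)
  define E3 where "E3 = (W o\<^sub>L E o\<^sub>L W o\<^sub>L E o\<^sub>L X')\<^sup>\<dagger> o\<^sub>L E o\<^sub>L Y"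
  define E1 where "E1 = X\<^sup>\<dagger> o\<^sub>L (E - (\<tau> *\<^sub>R C1 + (1/2 * \<tau>\<^sup>2) *\<^sub>R C2)) o\<^sub>L Y"
  define E2 where "E2 = ((W o\<^sub>L (E - \<tau> *\<^sub>R C1) o\<^sub>L X)\<^sup>\<dagger> o\<^sub>L E o\<^sub>L Y)
    + ((W o\<^sub>L (\<tau> *\<^sub>R C1) o\<^sub>L X)\<^sup>\<dagger> o\<^sub>L (E - \<tau> *\<^sub>R C1) o\<^sub>L Y)"
  have "resolvent B' z - resolvent B z
      = (X\<^sup>\<dagger> o\<^sub>L E o\<^sub>L Y) + ((W o\<^sub>L E o\<^sub>L X)\<^sup>\<dagger> o\<^sub>L E o\<^sub>L Y) + E3"
    using resolvent_second_order[OF ext z ext' z']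
    unfolding E_def[symmetric] W_def[symmetric] X_def[symmetric] Y_def[symmetric] X'_def[symmetric]
      E3_def[symmetric]
    by (simp add: algebra_simps)
  moreover have "(X\<^sup>\<dagger> o\<^sub>L E o\<^sub>L Y)
      = \<tau> *\<^sub>R (X\<^sup>\<dagger> o\<^sub>L C1 o\<^sub>L Y) + (1/2 * \<tau>\<^sup>2) *\<^sub>R (X\<^sup>\<dagger> o\<^sub>L C2 o\<^sub>L Y) + E1"
    unfolding E1_def by (simp add: blinfun_compose_distribs algebra_simps)
  moreover have "((W o\<^sub>L E o\<^sub>L X)\<^sup>\<dagger> o\<^sub>L E o\<^sub>L Y)
      = (1/2 * \<tau>\<^sup>2) *\<^sub>R (2 *\<^sub>R ((W o\<^sub>L C1 o\<^sub>L X)\<^sup>\<dagger> o\<^sub>L C1 o\<^sub>L Y)) + E2"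
    unfolding E2_def using lin C
    by (simp add: blinfun_compose_distribs adjoint_diff adjoint_scaleR complex_linear_intros
        power2_eq_square algebra_simps)
  ultimately have eq: "resolvent B' z - resolvent B z - (\<tau> *\<^sub>R (X\<^sup>\<dagger> o\<^sub>L C1 o\<^sub>L Y)
      + (1/2 * \<tau>\<^sup>2) *\<^sub>R ((X\<^sup>\<dagger> o\<^sub>L C2 o\<^sub>L Y) + 2 *\<^sub>R ((W o\<^sub>L C1 o\<^sub>L X)\<^sup>\<dagger> o\<^sub>L C1 o\<^sub>L Y))) = E3 + E1 + E2"
    by (simp only: scaleR_add_right) (simp add: algebra_simps)
  note K' = K[folded X_def Y_def W_def X'_def]
  have "norm E3 \<le> (K * norm E * K * norm E * (2 * K)) * norm E * K"
    unfolding E3_def by (intro mul adj complex_linear_intros lin K' order_refl)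
  then have n3: "norm E3 \<le> 2 * K ^ 4 * norm E ^ 3"
    by (simp add: eval_nat_numeral mult_ac)
  have "norm E1 \<le> K * norm (E - (\<tau> *\<^sub>R C1 + (1/2 * \<tau>\<^sup>2) *\<^sub>R C2)) * K"
    unfolding E1_def by (intro mul adj complex_linear_intros lin K' order_refl)
  then have n1: "norm E1 \<le> K\<^sup>2 * norm (E - (\<tau> *\<^sub>R C1 + (1/2 * \<tau>\<^sup>2) *\<^sub>R C2))"
    by (simp add: power2_eq_square mult_ac)
  have "norm E2 \<le> (K * norm (E - \<tau> *\<^sub>R C1) * K) * norm E * K
      + (K * norm (\<tau> *\<^sub>R C1) * K) * norm (E - \<tau> *\<^sub>R C1) * K"
    unfolding E2_def by (intro order_trans[OF norm_triangle_ineq add_mono] mul adj complex_linear_intros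
        lin C K' order_refl)
  then have n2: "norm E2 \<le> K ^ 3 * norm (E - \<tau> *\<^sub>R C1) * (norm E + \<bar>\<tau>\<bar> * norm C1)"
    by (simp add: power3_eq_cube algebra_simps)
  have "norm (E3 + E1 + E2) \<le> norm E3 + norm E1 + norm E2"
    by (intro order_trans[OF norm_triangle_ineq] add_mono norm_triangle_ineq order_refl)
  then show ?thesis
    unfolding eq using n1 n2 n3 by linarith
qed

text \<open>Continuity on the compact circle makes all bounds uniform in \<open>z\<close>, so the pointwise expansion of
  the resolvent can be integrated.\<close>

theorem riesz_projection_expansion:
  fixes Q :: "real \<Rightarrow> ('k \<times> 'k) \<Rightarrow>\<^sub>L ('k \<times> 'k)" and B :: "real \<Rightarrow> ('h \<rightharpoonup> 'h)" and t\<^sub>0 :: real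
  assumes ext: "\<And>t. t \<in> {0..1} \<Longrightarrow> extension (Q t) (B t)" and t0: "t\<^sub>0 \<in> {0..1}"
    and Q: "second_order_expansion Q t\<^sub>0 Q' Q''"
    and \<mu>: "\<mu> \<in> \<real>" and r: "0 < r" "r < d" and iso: "ball \<mu> d \<inter> spectrum (B t\<^sub>0) \<subseteq> {\<mu>}"
  defines "X \<equiv> (\<lambda>z. T \<odot> resolvent (B t\<^sub>0) (cnj z))" and "Y \<equiv> (\<lambda>z. T \<odot> resolvent (B t\<^sub>0) z)"
    and "W \<equiv> (\<lambda>z. weyl_function (B t\<^sub>0) (cnj z))"
  shows "second_order_expansion (\<lambda>t. circle_residue \<mu> r (resolvent (B t))) t\<^sub>0
    (circle_residue \<mu> r (\<lambda>z. (X z)\<^sup>\<dagger> o\<^sub>L (Q' o\<^sub>L \<J>) o\<^sub>L Y z))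
    (circle_residue \<mu> r (\<lambda>z. (X z)\<^sup>\<dagger> o\<^sub>L (Q'' o\<^sub>L \<J>) o\<^sub>L Y z)
      + 2 *\<^sub>R circle_residue \<mu> r (\<lambda>z. (W z o\<^sub>L (Q' o\<^sub>L \<J>) o\<^sub>L X z)\<^sup>\<dagger> o\<^sub>L (Q' o\<^sub>L \<J>) o\<^sub>L Y z))"
proof -
  let ?J = "\<J> :: ('k \<times> 'k) \<Rightarrow>\<^sub>L _"
  let ?I = "circle_residue \<mu> r"
  note ext0 = ext[OF t0]
  have r0: "0 \<le> r"
    using r by simp
  have sph: "z \<notin> spectrum (B t\<^sub>0)" "cnj z \<in> sphere \<mu> r" if z: "z \<in> sphere \<mu> r" for z
  proof -
    show "z \<notin> spectrum (B t\<^sub>0)"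
      using z r iso by auto
    have "dist \<mu> (cnj z) = dist \<mu> z"
      unfolding dist_norm using \<mu> by (metis Reals_cnj_iff complex_cnj_diff complex_mod_cnj)
    with z show "cnj z \<in> sphere \<mu> r"
      by simp
  qed
  then have sub: "sphere \<mu> r \<subseteq> - spectrum (B t\<^sub>0)"
    by blast
  define s where "s = \<mu> + of_real r"
  have s: "s \<in> \<real>" "s \<in> sphere \<mu> r"
    using \<mu> r by (auto simp: s_def dist_norm)
  note cont = continuous_on_boundary_maps[OF ext0 s(1) sph(1)[OF s(2)], THEN continuous_on_subset[OF _ sub]]
  obtain K1 where K1: "\<And>z. z \<in> sphere \<mu> r \<Longrightarrow> norm (T \<odot> resolvent (B t\<^sub>0) z) \<le> K1"
    using compact_imp_bounded[OF compact_continuous_image[OF cont(1) compact_sphere]]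
    unfolding bounded_iff by blast
  obtain K2 where K2: "\<And>z. z \<in> sphere \<mu> r \<Longrightarrow> norm (weyl_function (B t\<^sub>0) z) \<le> K2"
    using compact_imp_bounded[OF compact_continuous_image[OF cont(3) compact_sphere]]
    unfolding bounded_iff by blast
  define K where "K = max K1 K2"
  have K: "norm (T \<odot> resolvent (B t\<^sub>0) z) \<le> K" "norm (weyl_function (B t\<^sub>0) z) \<le> K"
    if "z \<in> sphere \<mu> r" for z
    using K1[OF that] K2[OF that] by (auto simp: K_def)
  have K0: "0 \<le> K"
    using K(1)[OF s(2)] norm_ge_zero order_trans by blast
  define C1 where "C1 = Q' o\<^sub>L \<J>"
  define C2 where "C2 = Q'' o\<^sub>L \<J>"
  have C: "complex_linear C1" "complex_linear C2"
    using Q unfolding second_order_expansion_def C1_def C2_def by (auto intro!: complex_linear_intros)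
  define V1 where "V1 = (\<lambda>z. (X z)\<^sup>\<dagger> o\<^sub>L C1 o\<^sub>L Y z)"
  define V2 where "V2 = (\<lambda>z. (X z)\<^sup>\<dagger> o\<^sub>L C2 o\<^sub>L Y z)"
  define V3 where "V3 = (\<lambda>z. (W z o\<^sub>L C1 o\<^sub>L X z)\<^sup>\<dagger> o\<^sub>L C1 o\<^sub>L Y z)"
  have linXYW: "complex_linear (X z)" "complex_linear (Y z)" "complex_linear (W z)" if z: "z \<in> sphere \<mu> r" for z
    unfolding X_def Y_def W_def
    by (intro T_resolvent_linear[OF ext0] weyl_function_linear[OF ext0] sph that)+
  have linV: "complex_linear (V1 z)" "complex_linear (V2 z)" "complex_linear (V3 z)" if "z \<in> sphere \<mu> r" for z
    unfolding V1_def V2_def V3_def by (intro complex_linear_intros linXYW[OF that] C)+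
  have contV12: "continuous_on (sphere \<mu> r) V1" "continuous_on (sphere \<mu> r) V2"
    unfolding V1_def V2_def X_def Y_def by (intro bounded_bilinear.continuous_on[OF bounded_bilinear_blinfun_compose]
        cont continuous_on_const)+
  have "continuous_on (sphere \<mu> r) (\<lambda>z. (X z)\<^sup>\<dagger> o\<^sub>L C1\<^sup>\<dagger> o\<^sub>L (W z)\<^sup>\<dagger> o\<^sub>L C1 o\<^sub>L Y z)"
    unfolding X_def Y_def W_def by (intro bounded_bilinear.continuous_on[OF bounded_bilinear_blinfun_compose]
        cont continuous_on_const)
  then have contV3: "continuous_on (sphere \<mu> r) V3"
    by (rule continuous_on_eq)
      (simp add: V3_def adjoint_compose complex_linear_intros linXYW C compose_assoc del: mem_sphere)
  note contV = contV12 contV3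
  define V where "V = (\<lambda>\<tau> z. \<tau> *\<^sub>R V1 z + (1/2 * \<tau>\<^sup>2) *\<^sub>R (V2 z + 2 *\<^sub>R V3 z))"
  have contVt: "continuous_on (sphere \<mu> r) (V \<tau>)" for \<tau>
    unfolding V_def by (intro continuous_intros contV)
  have resV: "?I (V \<tau>) = \<tau> *\<^sub>R ?I V1
      + (1/2 * \<tau>\<^sup>2) *\<^sub>R (?I V2 + 2 *\<^sub>R ?I V3)" for \<tau>
    unfolding V_def
    by (simp only: circle_residue_add[OF r0] circle_residue_scaleR contV continuous_on_scaleR
        continuous_on_const continuous_on_add)
  have contR: "continuous_on (sphere \<mu> r) (resolvent (B t))"
    if "sphere \<mu> r \<subseteq> - spectrum (B t)" for t
    using pseudo_resolvent_continuous_on[OF pseudo_resolvent_resolvent] that continuous_on_subset by blast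
  have linR: "complex_linear (?I (resolvent (B t)))"
    if "sphere \<mu> r \<subseteq> - spectrum (B t)" for t
    using that by (intro complex_linear_circle_residue[OF r0 contR]
        pseudo_resolvent_linear[OF pseudo_resolvent_resolvent]) auto
  define \<delta> where "\<delta> = (\<lambda>t. norm (Q t - (Q t\<^sub>0 + (t - t\<^sub>0) *\<^sub>R Q' + (1/2 * (t - t\<^sub>0)\<^sup>2) *\<^sub>R Q'')))"
  have \<delta>: "\<delta> \<in> o[at t\<^sub>0 within {0..1}](\<lambda>t. (t - t\<^sub>0)\<^sup>2)"
    using Q unfolding second_order_expansion_def \<delta>_def by blast
  have \<delta>0: "0 \<le> \<delta> t" for t
    by (simp add: \<delta>_def)
  define n where "n = norm ?J"
  have n0: "0 \<le> n"
    by (simp add: n_def)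
  define c where "c = 1 + norm Q' + norm Q''"
  have c0: "1 \<le> c" "norm Q' \<le> c"
    by (simp_all add: c_def)
  define M where "M = 2 * K ^ 4 * (c * n) ^ 3 + K ^ 3 * (c * n) * (2 * (c * n))"
  have M0: "0 \<le> M"
    unfolding M_def using K0 n0 c0 by (intro add_nonneg_nonneg mult_nonneg_nonneg zero_le_power) auto
  \<comment> \<open>For \<open>\<bar>t - t\<^sub>0\<bar> \<le> \<eta>\<close>, the estimate \<open>\<parallel>Q t - Q t\<^sub>0\<parallel> \<le> c \<bar>t - t\<^sub>0\<bar>\<close> ensures both smallness conditions
    under which the circle stays in the resolvent set.\<close>
  define \<eta> where "\<eta> = 1 / (2 * c * (K * n + 1))"
  have \<eta>: "0 < \<eta>" "\<eta> \<le> 1" "c * \<eta> < 1" "K * (c * \<eta> * n) \<le> 1 / 2"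
  proof -
    have Kn: "1 \<le> K * n + 1" "K * n \<le> K * n + 1"
      using K0 n0 by auto
    have eq: "c * \<eta> = 1 / (2 * (K * n + 1))"
      using c0 by (simp add: \<eta>_def)
    show "0 < \<eta>"
      using c0 Kn by (simp add: \<eta>_def)
    show less: "c * \<eta> < 1"
      unfolding eq using Kn by (simp add: divide_less_eq)
    have "1 * \<eta> \<le> c * \<eta>"
      using c0 \<open>0 < \<eta>\<close> by (intro mult_right_mono) auto
    with less show "\<eta> \<le> 1"
      by simp
    have "K * (c * \<eta> * n) = (K * n) / (2 * (K * n + 1))"
      unfolding eq by simp
    also have "\<dots> \<le> 1 / 2"
      using Kn by (simp add: divide_le_eq)
    finally show "K * (c * \<eta> * n) \<le> 1 / 2" .
  qed
  have main: "sphere \<mu> r \<subseteq> - spectrum (B t) \<and> norm (?I (resolvent (B t))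
      - (?I (resolvent (B t\<^sub>0)) + ?I (V (t - t\<^sub>0))))
    \<le> r * (M * \<bar>t - t\<^sub>0\<bar> ^ 3 + K\<^sup>2 * n * \<delta> t)"
    if t: "t \<in> {0..1}" and small: "\<bar>t - t\<^sub>0\<bar> \<le> \<eta>" and \<delta>t: "\<delta> t \<le> (t - t\<^sub>0)\<^sup>2" for t
  proof -
    note ext1 = ext[OF t]
    define \<tau> where "\<tau> = t - t\<^sub>0"
    have \<tau>1: "\<bar>\<tau>\<bar> \<le> 1"
      using small \<eta>(2) by (simp add: \<tau>_def)
    have \<tau>2: "\<tau>\<^sup>2 \<le> \<bar>\<tau>\<bar>"
    proof -
      have "\<bar>\<tau>\<bar> * \<bar>\<tau>\<bar> \<le> \<bar>\<tau>\<bar> * 1"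
        using \<tau>1 by (intro mult_left_mono) auto
      then show ?thesis
        by (simp add: power2_eq_square)
    qed
    define \<epsilon> where "\<epsilon> = Q t - (Q t\<^sub>0 + \<tau> *\<^sub>R Q' + (1/2 * \<tau>\<^sup>2) *\<^sub>R Q'')"
    have \<epsilon>: "norm \<epsilon> = \<delta> t"
      by (simp add: \<epsilon>_def \<delta>_def \<tau>_def)
    define \<Delta> where "\<Delta> = Q t - Q t\<^sub>0"
    have d1: "norm (\<Delta> - \<tau> *\<^sub>R Q') \<le> c * \<tau>\<^sup>2"
    proof -
      have "\<Delta> - \<tau> *\<^sub>R Q' = \<epsilon> + (1/2 * \<tau>\<^sup>2) *\<^sub>R Q''"
        by (simp add: \<Delta>_def \<epsilon>_def)
      then have "norm (\<Delta> - \<tau> *\<^sub>R Q') \<le> norm \<epsilon> + norm ((1/2 * \<tau>\<^sup>2) *\<^sub>R Q'')"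
        by (simp only: norm_triangle_ineq)
      also have "\<dots> \<le> \<tau>\<^sup>2 + norm Q'' * \<tau>\<^sup>2"
        using \<delta>t[folded \<tau>_def] by (intro add_mono) (simp_all add: \<epsilon> mult_ac)
      also have "\<dots> \<le> c * \<tau>\<^sup>2"
        by (simp add: c_def distrib_right)
      finally show ?thesis .
    qed
    have d0: "norm \<Delta> \<le> c * \<bar>\<tau>\<bar>"
    proof -
      have "\<Delta> = \<epsilon> + \<tau> *\<^sub>R Q' + (1/2 * \<tau>\<^sup>2) *\<^sub>R Q''"
        by (simp add: \<Delta>_def \<epsilon>_def)
      then have "norm \<Delta> \<le> norm \<epsilon> + norm (\<tau> *\<^sub>R Q') + norm ((1/2 * \<tau>\<^sup>2) *\<^sub>R Q'')"
        by (simp only:) (intro order_trans[OF norm_triangle_ineq] add_mono norm_triangle_ineq order_refl)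
      also have "\<dots> \<le> \<bar>\<tau>\<bar> + norm Q' * \<bar>\<tau>\<bar> + norm Q'' * \<bar>\<tau>\<bar>"
      proof (intro add_mono)
        show "norm \<epsilon> \<le> \<bar>\<tau>\<bar>"
          using \<delta>t[folded \<tau>_def] \<tau>2 by (simp add: \<epsilon>)
        have "\<tau>\<^sup>2 / 2 \<le> \<bar>\<tau>\<bar>"
          using \<tau>2 zero_le_power2[of \<tau>] by linarith
        then show "norm ((1/2 * \<tau>\<^sup>2) *\<^sub>R Q'') \<le> norm Q'' * \<bar>\<tau>\<bar>"
          using mult_left_mono[of "\<tau>\<^sup>2 / 2" "\<bar>\<tau>\<bar>" "norm Q''"] by (simp add: mult_ac)
      qed (simp add: mult.commute)
      also have "\<dots> = c * \<bar>\<tau>\<bar>"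
        by (simp add: c_def distrib_right)
      finally show ?thesis .
    qed
    have d0': "norm \<Delta> \<le> c * \<eta>"
      using small c0 by (intro order_trans[OF d0] mult_left_mono) (auto simp: \<tau>_def)
    have near: "norm (Q t - Q t\<^sub>0) < 1"
      using d0' \<eta>(3) by (simp add: \<Delta>_def)
    have smallW: "norm (weyl_function (B t\<^sub>0) z o\<^sub>L (Q t - Q t\<^sub>0) o\<^sub>L \<J>) \<le> 1 / 2"
      if z: "z \<in> sphere \<mu> r" for z
    proof -
      have "norm (weyl_function (B t\<^sub>0) z o\<^sub>L \<Delta> o\<^sub>L \<J>) \<le> norm (weyl_function (B t\<^sub>0) z) * norm \<Delta> * n"
        unfolding n_def
        by (intro order_trans[OF norm_blinfun_compose] mult_right_mono norm_blinfun_compose) simp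
      also have "\<dots> \<le> K * (c * \<eta>) * n"
        using K(2)[OF z] d0' K0 n0 by (intro mult_right_mono mult_mono) auto
      also have "\<dots> \<le> 1 / 2"
        using \<eta>(4) by (simp add: mult.assoc)
      finally show ?thesis
        by (simp add: \<Delta>_def)
    qed
    have stable: "z \<notin> spectrum (B t)" "norm (T \<odot> resolvent (B t) z) \<le> 2 * K" if z: "z \<in> sphere \<mu> r" for z
      using resolvent_set_stable[OF ext0 sph(1)[OF z] ext1 near smallW[OF z]] K(1)[OF z] by auto
    define E where "E = \<Delta> o\<^sub>L \<J>"
    have nE: "norm E \<le> c * n * \<bar>\<tau>\<bar>"
      using norm_blinfun_compose[of \<Delta> ?J] mult_right_mono[OF d0 n0]
      by (simp add: E_def n_def mult_ac)
    have nE1: "norm (E - \<tau> *\<^sub>R C1) \<le> c * n * \<tau>\<^sup>2"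
    proof -
      have "E - \<tau> *\<^sub>R C1 = (\<Delta> - \<tau> *\<^sub>R Q') o\<^sub>L \<J>"
        by (simp add: E_def C1_def blinfun_compose_distribs)
      then show ?thesis
        using norm_blinfun_compose[of "\<Delta> - \<tau> *\<^sub>R Q'" ?J] mult_right_mono[OF d1 n0]
        by (simp add: n_def mult_ac)
    qed
    have nE2: "norm (E - (\<tau> *\<^sub>R C1 + (1/2 * \<tau>\<^sup>2) *\<^sub>R C2)) \<le> n * \<delta> t"
    proof -
      have "E - (\<tau> *\<^sub>R C1 + (1/2 * \<tau>\<^sup>2) *\<^sub>R C2) = \<epsilon> o\<^sub>L \<J>"
        by (simp add: E_def C1_def C2_def \<epsilon>_def \<Delta>_def blinfun_compose_distribs algebra_simps)
      then show ?thesis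
        using norm_blinfun_compose[of \<epsilon> ?J] by (simp add: n_def \<epsilon> mult.commute)
    qed
    have nC1: "\<bar>\<tau>\<bar> * norm C1 \<le> c * n * \<bar>\<tau>\<bar>"
    proof -
      have "norm C1 \<le> c * n"
        using norm_blinfun_compose[of Q' ?J] mult_right_mono[OF c0(2) n0]
        by (simp add: C1_def n_def)
      then show ?thesis
        by (simp add: mult.commute mult_left_mono)
    qed
    have point: "norm (resolvent (B t) z - resolvent (B t\<^sub>0) z - V \<tau> z) \<le> M * \<bar>\<tau>\<bar> ^ 3 + K\<^sup>2 * n * \<delta> t"
      if z: "z \<in> sphere \<mu> r" for z
    proof -
      have "norm (resolvent (B t) z - resolvent (B t\<^sub>0) z - V \<tau> z)
          \<le> 2 * K ^ 4 * norm E ^ 3 + K\<^sup>2 * norm (E - (\<tau> *\<^sub>R C1 + (1/2 * \<tau>\<^sup>2) *\<^sub>R C2))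
            + K ^ 3 * norm (E - \<tau> *\<^sub>R C1) * (norm E + \<bar>\<tau>\<bar> * norm C1)"
        unfolding V_def V1_def V2_def V3_def X_def Y_def W_def E_def \<Delta>_def
        by (rule resolvent_expansion_error[OF ext0 sph(1)[OF z] ext1 stable(1)[OF z] C K(1)[OF z]
              K(1)[OF sph(2)[OF z]] K(2)[OF sph(2)[OF z]] stable(2)[OF sph(2)[OF z]]])
      also have "\<dots> \<le> 2 * K ^ 4 * (c * n * \<bar>\<tau>\<bar>) ^ 3 + K\<^sup>2 * (n * \<delta> t)
            + K ^ 3 * (c * n * \<tau>\<^sup>2) * (c * n * \<bar>\<tau>\<bar> + c * n * \<bar>\<tau>\<bar>)"
        using K0 c0 n0 by (intro add_mono mult_mono mult_left_mono power_mono nE nE1 nE2 nC1) auto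
      also have "\<dots> = M * \<bar>\<tau>\<bar> ^ 3 + K\<^sup>2 * n * \<delta> t"
      proof -
        have "\<tau>\<^sup>2 = \<bar>\<tau>\<bar> * \<bar>\<tau>\<bar>"
          by (simp add: power2_eq_square)
        then show ?thesis
          unfolding M_def by (simp only: power_mult_distrib power3_eq_cube) (simp add: algebra_simps)
      qed
      finally show ?thesis .
    qed
    have sub': "sphere \<mu> r \<subseteq> - spectrum (B t)"
      using stable(1) by blast
    have "?I (\<lambda>z. resolvent (B t) z - resolvent (B t\<^sub>0) z - V \<tau> z)
        = ?I (resolvent (B t)) - ?I (resolvent (B t\<^sub>0)) - ?I (V \<tau>)"
      by (simp only: circle_residue_diff[OF r0] contR[OF sub] contR[OF sub'] contVt continuous_on_diff)
    moreover have "norm (?I (\<lambda>z. resolvent (B t) z - resolvent (B t\<^sub>0) z - V \<tau> z))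
        \<le> r * (M * \<bar>\<tau>\<bar> ^ 3 + K\<^sup>2 * n * \<delta> t)"
      by (intro norm_circle_residue_le[OF r0] continuous_on_diff contR[OF sub] contR[OF sub'] contVt point)
    ultimately show ?thesis
      using sub' by (simp add: \<tau>_def diff_diff_eq)
  qed
  define N where "N = r * M + r * (K\<^sup>2 * n) + 1"
  have N: "0 < N" "r * M \<le> N" "r * (K\<^sup>2 * n) \<le> N"
    using r M0 n0 by (auto simp: N_def add_nonneg_pos)
  have ev: "\<forall>\<^sub>F t in at t\<^sub>0 within {0..1}. sphere \<mu> r \<subseteq> - spectrum (B t) \<and> norm (?I (resolvent (B t))
      - (?I (resolvent (B t\<^sub>0)) + ?I (V (t - t\<^sub>0)))) \<le> e * (t - t\<^sub>0)\<^sup>2"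
    if e: "0 < e" for e
  proof -
    define b where "b = min 1 (e / (2 * N))"
    have b: "0 < b"
      using e N by (simp add: b_def)
    have 1: "\<forall>\<^sub>F t in at t\<^sub>0 within {0..1}. norm (\<delta> t) \<le> b * norm ((t - t\<^sub>0)\<^sup>2)"
      by (rule landau_o.smallD[OF \<delta> b])
    have 2: "\<forall>\<^sub>F t in at t\<^sub>0 within {0..1}. t \<in> {0..1} \<and> \<bar>t - t\<^sub>0\<bar> \<le> min \<eta> b"
      using \<eta>(1) b unfolding eventually_at
      by (intro exI[of _ "min \<eta> b"]) (auto simp: dist_real_def)
    show ?thesis
      using 1 2
    proof eventually_elim
      case (elim t)
      then have t: "t \<in> {0..1}" "\<bar>t - t\<^sub>0\<bar> \<le> \<eta>" "\<bar>t - t\<^sub>0\<bar> \<le> b" and \<delta>t: "\<delta> t \<le> b * (t - t\<^sub>0)\<^sup>2"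
        using \<delta>0 by auto
      have "\<delta> t \<le> 1 * (t - t\<^sub>0)\<^sup>2"
        by (rule order_trans[OF \<delta>t mult_right_mono]) (simp_all add: b_def)
      then have m: "sphere \<mu> r \<subseteq> - spectrum (B t)" "norm (?I (resolvent (B t))
          - (?I (resolvent (B t\<^sub>0)) + ?I (V (t - t\<^sub>0))))
        \<le> r * (M * \<bar>t - t\<^sub>0\<bar> ^ 3 + K\<^sup>2 * n * \<delta> t)"
        using main[OF t(1,2)] by auto
      note m(2)
      also have "r * (M * \<bar>t - t\<^sub>0\<bar> ^ 3 + K\<^sup>2 * n * \<delta> t)
          = (r * M) * (\<bar>t - t\<^sub>0\<bar> * (t - t\<^sub>0)\<^sup>2) + (r * (K\<^sup>2 * n)) * \<delta> t"
        by (simp add: power3_eq_cube power2_eq_square algebra_simps)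
      also have "\<dots> \<le> N * (b * (t - t\<^sub>0)\<^sup>2) + N * (b * (t - t\<^sub>0)\<^sup>2)"
        using N t(3) \<delta>t \<delta>0[of t] by (intro add_mono mult_mono mult_right_mono) auto
      also have "\<dots> = (2 * N * b) * (t - t\<^sub>0)\<^sup>2"
        by simp
      also have "\<dots> \<le> e * (t - t\<^sub>0)\<^sup>2"
      proof (rule mult_right_mono)
        have "2 * N * b \<le> 2 * N * (e / (2 * N))"
          using N by (intro mult_left_mono) (auto simp: b_def)
        then show "2 * N * b \<le> e"
          using N by simp
      qed simp
      finally show ?case
        using m(1) by blast
    qed
  qed
  show ?thesis
    unfolding second_order_expansion_def
    unfolding C1_def[symmetric] C2_def[symmetric]
    unfolding V1_def[symmetric] V2_def[symmetric] V3_def[symmetric]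
  proof (intro conjI)
    show "\<forall>\<^sub>F t in at t\<^sub>0 within {0..1}. complex_linear (?I (resolvent (B t)))"
      using ev[of 1] by (rule eventually_mono) (auto intro: linR)
    show "complex_linear (?I (resolvent (B t\<^sub>0)))"
      by (rule linR[OF sub])
    show "complex_linear (?I V1)"
      by (rule complex_linear_circle_residue[OF r0 contV(1) linV(1)])
    show "complex_linear (?I V2 + 2 *\<^sub>R ?I V3)"
      by (intro complex_linear_intros complex_linear_circle_residue[OF r0] contV linV)
    show "(\<lambda>t. norm (?I (resolvent (B t)) - (?I (resolvent (B t\<^sub>0))
        + (t - t\<^sub>0) *\<^sub>R ?I V1
        + (1/2 * (t - t\<^sub>0)\<^sup>2) *\<^sub>R (?I V2 + 2 *\<^sub>R ?I V3))))
      \<in> o[at t\<^sub>0 within {0..1}](\<lambda>t. (t - t\<^sub>0)\<^sup>2)"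
    proof (rule landau_o.smallI)
      fix e :: real assume "0 < e"
      from ev[OF this] show "\<forall>\<^sub>F t in at t\<^sub>0 within {0..1}. norm (norm (?I (resolvent (B t))
          - (?I (resolvent (B t\<^sub>0)) + (t - t\<^sub>0) *\<^sub>R ?I V1
          + (1/2 * (t - t\<^sub>0)\<^sup>2) *\<^sub>R (?I V2 + 2 *\<^sub>R ?I V3))))
        \<le> e * norm ((t - t\<^sub>0)\<^sup>2)"
        by (rule eventually_mono) (simp add: resV add.assoc)
    qed
  qed
qed

end

text \<open>The circle has half the distance to the rest of the spectrum as radius, which leaves a concentric
  disc of twice that radius for the Laurent expansion. If there is no other spectrum, any larger disc
  serves.\<close>

lemma eigenvalue_contour_isolates:
  assumes "\<mu> isolated_in spectrum B"
  obtains r d where "0 < r" "r < d" "ball \<mu> d \<inter> spectrum B \<subseteq> {\<mu>}"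
    "eigenvalue_contour B \<mu> = circlepath \<mu> r"
proof (cases "spectrum B \<subseteq> {\<mu>}")
  case True
  then show ?thesis
    by (intro that[of 1 2]) (auto simp: eigenvalue_contour_def)
next
  case False
  define \<rho> where "\<rho> = infdist \<mu> (spectrum B - {\<mu>})"
  obtain e where e: "e > 0" "\<And>y. y \<in> spectrum B \<Longrightarrow> dist \<mu> y < e \<Longrightarrow> y = \<mu>"
    using assms unfolding isolated_in_dist_Ex_iff by blast
  have ne: "spectrum B - {\<mu>} \<noteq> {}"
    using False by blast
  have "e \<le> \<rho>"
    unfolding \<rho>_def infdist_notempty[OF ne]
    by (rule cINF_greatest[OF ne]) (use e(2) in force)
  moreover have "ball \<mu> \<rho> \<inter> spectrum B \<subseteq> {\<mu>}"
    unfolding \<rho>_def using infdist_le[of _ "spectrum B - {\<mu>}" \<mu>] by fastforce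
  ultimately show ?thesis
    using e(1) False by (intro that[of "\<rho> / 2" \<rho>]) (auto simp: eigenvalue_contour_def \<rho>_def)
qed

theorem proposition2p8:
  fixes A :: "'h::complex_hilbert \<rightharpoonup> 'h"
    and \<Gamma>\<^sub>0 \<Gamma>\<^sub>1 :: "'h \<Rightarrow> 'k::complex_hilbert"
    and T :: "'h \<Rightarrow> 'k \<times> 'k"
    and Q :: "real \<Rightarrow> ('k \<times> 'k) \<Rightarrow>\<^sub>L ('k \<times> 'k)"
    and Q' Q'' :: "('k \<times> 'k) \<Rightarrow>\<^sub>L ('k \<times> 'k)"
    and \<A> :: "real \<Rightarrow> ('h \<rightharpoonup> 'h)"
    and t\<^sub>0 :: real and \<mu> :: complex and m :: nat
    and \<gamma> :: "real \<Rightarrow> complex"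
    and P :: "real \<Rightarrow> ('h \<Rightarrow>\<^sub>L 'h)" and S P' P'' :: "'h \<Rightarrow>\<^sub>L 'h"
  assumes "densely_defined A" and "symmetric_operator A" and "equal_deficiency_indices A"
    and "boundary_triplet A \<Gamma>\<^sub>0 \<Gamma>\<^sub>1" and T_def: "T = (\<lambda>u. (\<Gamma>\<^sub>0 u, \<Gamma>\<^sub>1 u))"
    and "t\<^sub>0 \<in> {0..1}"
    and "\<And>t. t \<in> {0..1} \<Longrightarrow> orthogonal_projection (Q t) \<and> lagrangian (range (Q t))"
    and "second_order_expansion Q t\<^sub>0 Q' Q''"
    and "\<And>t. t \<in> {0..1} \<Longrightarrow> self_adjoint (\<A> t) \<and> A \<subseteq>\<^sub>m \<A> t \<and> T ` dom (\<A> t) = range (Q t)"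
    and "isolated_eigenvalue (\<A> t\<^sub>0) \<mu> m"
    and \<gamma>_def: "\<gamma> = eigenvalue_contour (\<A> t\<^sub>0) \<mu>"
    and P_def: "P = (\<lambda>t. riesz_projection \<gamma> (\<A> t))"
    and S_def: "S = reduced_resolvent \<gamma> (\<A> t\<^sub>0) \<mu>"
    and P'_def: "P' =
        ((T \<odot> S)\<^sup>\<dagger> o\<^sub>L Q' o\<^sub>L \<J> o\<^sub>L (T \<odot> P t\<^sub>0))
      + ((T \<odot> P t\<^sub>0)\<^sup>\<dagger> o\<^sub>L Q' o\<^sub>L \<J> o\<^sub>L (T \<odot> S))"
    and P''_def: "P'' =
        ((T \<odot> S)\<^sup>\<dagger> o\<^sub>L Q'' o\<^sub>L \<J> o\<^sub>L (T \<odot> P t\<^sub>0))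
      + ((T \<odot> P t\<^sub>0)\<^sup>\<dagger> o\<^sub>L Q'' o\<^sub>L \<J> o\<^sub>L (T \<odot> S))
      + 2 *\<^sub>R ((T \<odot> ((T \<odot> S)\<^sup>\<dagger> o\<^sub>L Q' o\<^sub>L \<J> o\<^sub>L (T \<odot> S)))\<^sup>\<dagger> o\<^sub>L Q' o\<^sub>L \<J> o\<^sub>L (T \<odot> P t\<^sub>0))
      + 2 *\<^sub>R ((T \<odot> ((T \<odot> S)\<^sup>\<dagger> o\<^sub>L Q' o\<^sub>L \<J> o\<^sub>L (T \<odot> P t\<^sub>0)))\<^sup>\<dagger> o\<^sub>L Q' o\<^sub>L \<J> o\<^sub>L (T \<odot> S))
      + 2 *\<^sub>R ((T \<odot> ((T \<odot> P t\<^sub>0)\<^sup>\<dagger> o\<^sub>L Q' o\<^sub>L \<J> o\<^sub>L (T \<odot> S)))\<^sup>\<dagger> o\<^sub>L Q' o\<^sub>L \<J> o\<^sub>L (T \<odot> S))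
      - 2 *\<^sub>R ((T \<odot> ((T \<odot> (S o\<^sub>L S))\<^sup>\<dagger> o\<^sub>L Q' o\<^sub>L \<J> o\<^sub>L (T \<odot> P t\<^sub>0)))\<^sup>\<dagger> o\<^sub>L Q' o\<^sub>L \<J> o\<^sub>L (T \<odot> P t\<^sub>0))
      - 2 *\<^sub>R ((T \<odot> ((T \<odot> P t\<^sub>0)\<^sup>\<dagger> o\<^sub>L Q' o\<^sub>L \<J> o\<^sub>L (T \<odot> (S o\<^sub>L S))))\<^sup>\<dagger> o\<^sub>L Q' o\<^sub>L \<J> o\<^sub>L (T \<odot> P t\<^sub>0))
      - 2 *\<^sub>R ((T \<odot> ((T \<odot> P t\<^sub>0)\<^sup>\<dagger> o\<^sub>L Q' o\<^sub>L \<J> o\<^sub>L (T \<odot> P t\<^sub>0)))\<^sup>\<dagger> o\<^sub>L Q' o\<^sub>L \<J> o\<^sub>L (T \<odot> (S o\<^sub>L S)))"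
  shows "second_order_expansion P t\<^sub>0 P' P''"
proof -
  interpret boundary_triplet_setting A \<Gamma>\<^sub>0 \<Gamma>\<^sub>1 T
    by unfold_locales fact+
  have ext: "extension (Q t) (\<A> t)" if "t \<in> {0..1}" for t
    using assms(7,9)[OF that] unfolding extension_def by blast
  have \<mu>: "\<mu> \<in> \<real>"
    using self_adjoint_eigenvalue_real ext_self_adjoint[OF ext[OF \<open>t\<^sub>0 \<in> {0..1}\<close>]]
      \<open>isolated_eigenvalue (\<A> t\<^sub>0) \<mu> m\<close> unfolding isolated_eigenvalue_def by blast
  obtain r d where r: "0 < r" "r < d" and iso: "ball \<mu> d \<inter> spectrum (\<A> t\<^sub>0) \<subseteq> {\<mu>}"
    and \<gamma>: "\<gamma> = circlepath \<mu> r"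
    using eigenvalue_contour_isolates \<open>isolated_eigenvalue (\<A> t\<^sub>0) \<mu> m\<close> \<gamma>_def
    unfolding isolated_eigenvalue_def by metis
  note ext0 = ext[OF \<open>t\<^sub>0 \<in> {0..1}\<close>]
  have P: "P t = circle_residue \<mu> r (resolvent (\<A> t))" for t
    by (simp add: P_def riesz_projection_def circle_residue_def \<gamma>)
  have S: "S = circle_residue \<mu> r (\<lambda>z. inverse (\<mu> - z) *\<^sub>C resolvent (\<A> t\<^sub>0) z)"
    by (simp add: S_def reduced_resolvent_def circle_residue_def \<gamma>)
  have C: "complex_linear (Q' o\<^sub>L \<J>)" "complex_linear (Q'' o\<^sub>L \<J>)"
    using \<open>second_order_expansion Q t\<^sub>0 Q' Q''\<close> unfolding second_order_expansion_def
    by (auto intro!: complex_linear_intros)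
  note first = circle_residue_first_order[OF ext0 \<mu> r iso, folded P S]
  note second = circle_residue_second_order[OF ext0 \<mu> r iso, folded P S]
  note expansion = riesz_projection_expansion[OF ext \<open>t\<^sub>0 \<in> {0..1}\<close>
    \<open>second_order_expansion Q t\<^sub>0 Q' Q''\<close> \<mu> r iso, folded P]
  show ?thesis
    using expansion unfolding first[OF C(1)] first[OF C(2)] second[OF C(1)] P'_def P''_def
    by (simp add: compose_assoc algebra_simps)
qed

end
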